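(* Let $p>1$, let $(u_0,u_1)\in \big(W^{1,1}\cap W^{1,\infty}(\mathbb R)\big)\times\big(L^1\cap L^\infty(\mathbb R)\big)$ and let $\phi\in W^{1,1}\cap W^{1,\infty}(\mathbb R;(0,\infty))$. Assume that there exists a constant $C$ such that $$\phi(x)\le C\inf_{y\in(x-1,x+1)}\phi(y),\qquad \phi(x)\le C\inf_{|y|<2|x|}\phi(y),\qquad |\dot\phi(x)|\le C\phi(x)$$ hold for almost every $x\in\mathbb R$. Assume further that for any $\delta>0$ there exists a positive constant $C_\delta$ such that $e^{-\delta|x|}\le C_\delta\,\phi(x)$ holds for almost every $x\in\mathbb R$. Then there exist a positive constant $C$, $T_0>0$ large enough, and $\varepsilon_0>0$ small enough such that if $u_0$ and $u_1$ satisfy $$0\le u_0(x)\le C\frac{\varepsilon_0}{T_0^{p-1/2}}\phi(x),\qquad 0\le u_1(x)+\tfrac12u_0(x)\le C\frac{\varepsilon_0}{T_0^{p-1/2}}\phi(x)$$ for almost every $x\in\mathbb R$, then solutions $u$ to the Cauchy problem $$\partial_t^2u+\partial_tu-\Delta u+u^p=0\ \ (t>0,\ x\in\mathbb R),\qquad u(0,x)=u_0(x),\quad \partial_tu(0,x)=u_1(x)$$ satisfy $$0\le u(t,x)\le C\left(\frac{u_L(t+T_0,x)^{p-1}}{(t+T_0)\,u_L(t+T_0,x)^{p-1}+1}\right)^{\frac1{p-1}}$$ for almost every $x\in\mathbb R$ and $t\ge0$, where $u_L(t,x)=\varepsilon_0\,S(t)\phi(x)+\varepsilon_0\,\partial_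tS(t)\phi(x)$.
   Context: The space dimension is one, so $\Delta=\partial_x^2$, and $\dot\phi$ denotes the (weak) derivative of $\phi$. For locally integrable $f$, $$S(t)f(x)=\frac{e^{-t/2}}2\int_{-t}^tI_0\Big(\frac{\sqrt{t^2-y^2}}2\Big)f(x-y)\,dy,$$ where $I_0$ is the modified Bessel function of the first kind of order $0$; thus $S(t)f$ solves $(\partial_t^2+\partial_t-\Delta)S(t)f=0$ with $S(0)f=0$, $\partial_tS(0)f=f$. $\partial_tS(t)f$ denotes the time derivative of $S(t)f$. A solution $u$ of the Cauchy problem means a mild solution, i.e. $u$ is non-negative and satisfies $$u(t,x)=S(t)(u_0+u_1)+\partial_tS(t)u_0-\int_0^tS(t-\tau)u^p(\tau)\,d\tau .$$ *)

theory Defs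
  imports "HOL-Analysis.Analysis"
begin

text \<open>Elements of Lebesgue and Sobolev spaces on the line are represented by functions; every
  notion below is invariant under changing these representatives on a null set.\<close>

definition locally_integrable :: "(real \<Rightarrow> real) \<Rightarrow> bool" where
  "locally_integrable f \<longleftrightarrow> (\<forall>K. compact K \<longrightarrow> set_integrable lebesgue K f)"

definition L1 :: "(real \<Rightarrow> real) set" where
  "L1 = {f. integrable lebesgue f}"

definition Linf :: "(real \<Rightarrow> real) set" where
  "Linf = {f \<in> borel_measurable lebesgue. \<exists>M. AE x in lebesgue. \<bar>f x\<bar> \<le> M}"

definition test_function :: "(real \<Rightarrow> real) \<Rightarrow> bool" where
  "test_function \<eta> \<longleftrightarrow>
     (\<forall>k. (deriv ^^ k) \<eta> differentiable_on UNIV) \<and> compact (closure {x. \<eta> x \<noteq> 0})"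

definition has_weak_derivative :: "(real \<Rightarrow> real) \<Rightarrow> (real \<Rightarrow> real) \<Rightarrow> bool" where
  "has_weak_derivative f g \<longleftrightarrow>
     locally_integrable f \<and> locally_integrable g \<and>
     (\<forall>\<eta>. test_function \<eta> \<longrightarrow>
        (LINT x|lebesgue. f x * deriv \<eta> x) = - (LINT x|lebesgue. g x * \<eta> x))"

text \<open>\<open>W1 L1\<close> and \<open>W1 Linf\<close> are the Sobolev spaces of first order over \<open>L1\<close> and \<open>Linf\<close>.\<close>

definition W1 :: "(real \<Rightarrow> real) set \<Rightarrow> (real \<Rightarrow> real) set" where
  "W1 X = {f \<in> X. \<exists>g \<in> X. has_weak_derivative f g}"

definition bessel_I0 :: "real \<Rightarrow> real" where
  "bessel_I0 z = (\<Sum>k. (z / 2) ^ (2 * k) / (fact k)\<^sup>2)"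

text \<open>The operator \<open>S t\<close> is only meant for \<open>t \<ge> 0\<close>. Accordingly its time derivative is
  taken within \<open>{0..}\<close>: it is two-sided for \<open>t > 0\<close> and one-sided at \<open>t = 0\<close>.\<close>

definition S :: "real \<Rightarrow> (real \<Rightarrow> real) \<Rightarrow> real \<Rightarrow> real" where
  "S t f x = exp (- t / 2) / 2 *
     (LINT y:{-t..t}|lebesgue. bessel_I0 (sqrt (t\<^sup>2 - y\<^sup>2) / 2) * f (x - y))"

definition dt_S :: "real \<Rightarrow> (real \<Rightarrow> real) \<Rightarrow> real \<Rightarrow> real" where
  "dt_S t f x = vector_derivative (\<lambda>s. S s f x) (at t within {0..})"

text \<open>Global mild solutions with initial data \<open>(u0, u1)\<close>. The measurability and integrability
  clauses only express that the right-hand side of the integral equation is meaningful, so that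
  no integral silently takes a default value.\<close>

definition mild_solution ::
    "real \<Rightarrow> (real \<Rightarrow> real) \<Rightarrow> (real \<Rightarrow> real) \<Rightarrow> (real \<Rightarrow> real \<Rightarrow> real) \<Rightarrow> bool" where
  "mild_solution p u0 u1 u \<longleftrightarrow>
     (\<lambda>(t, x). u t x) \<in> borel_measurable (lebesgue_on ({0..} \<times> UNIV)) \<and>
     (\<forall>t\<ge>0. AE x in lebesgue. 0 \<le> u t x) \<and>
     (\<forall>t\<ge>0. locally_integrable (\<lambda>x. u t x powr p)) \<and>
     (\<forall>t\<ge>0. AE x in lebesgue.
        set_integrable lebesgue {0..t} (\<lambda>\<tau>. S (t - \<tau>) (\<lambda>y. u \<tau> y powr p) x) \<and>
        u t x = S t (\<lambda>y. u0 y + u1 y) x + dt_S t u0 x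
          - (LINT \<tau>:{0..t}|lebesgue. S (t - \<tau>) (\<lambda>y. u \<tau> y powr p) x))"

definition u_L :: "real \<Rightarrow> (real \<Rightarrow> real) \<Rightarrow> real \<Rightarrow> real \<Rightarrow> real" where
  "u_L \<epsilon> \<phi> t x = \<epsilon> * S t \<phi> x + \<epsilon> * dt_S t \<phi> x"

end

theory Submission
  imports Defs
begin

text \<open>
  Write \<open>m = 1 / (p - 1)\<close> and \<open>s = t + T\<^sub>0\<close>. The asserted bound is a multiple of
  \<open>(u_L powr (1 - p) + s) powr (- m)\<close>, which is comparable to the smaller of \<open>u_L\<close> and
  \<open>s powr (- m)\<close> (\<open>interpolation_bound\<close>). So it suffices to bound \<open>u\<close> separately by a multiple
  of \<open>u_L (t + T\<^sub>0)\<close> and by a multiple of \<open>s powr (- m)\<close>. The first bound ignores the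
  absorption \<open>u powr p\<close>, the second one ignores the shape of the data.

  Linear bound. The Duhamel term is non-negative, so \<open>u\<close> lies below the linear evolution of its
  data. With \<open>k t y = exp (- t / 2) / 2 * I\<^sub>0 (sqrt (t\<^sup>2 - y\<^sup>2) / 2)\<close>, the kernel of \<open>S t\<close>,
  that evolution consists of an integral against \<open>k\<close>, an integral against a multiple of the time
  derivative of \<open>I\<^sub>0\<close>, and boundary values at \<open>x + t\<close> and \<open>x - t\<close>. Convexity of \<open>I\<^sub>0\<close> in the
  variable \<open>t\<^sup>2 - y\<^sup>2\<close> bounds the first two by the same integral at time \<open>t + 1\<close>, and the
  local Harnack property of \<open>\<phi>\<close> does it for the boundary values. Passing from time \<open>t + 1\<close> to
  \<open>t + T\<^sub>0\<close> costs no more than the heat-like factor \<open>T\<^sub>0 powr (1/2)\<close>: this is the growth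
  estimate \<open>bessel_clifford_growth\<close>, read off from \<open>I\<^sub>0 z = 1/pi * \<integral> exp (z * cos \<theta>)\<close>. Since the
  data carry the factor \<open>T\<^sub>0 powr (1/2 - p)\<close>, what remains is \<open>T\<^sub>0 powr (1 - p)\<close>, and this is
  small for large \<open>T\<^sub>0\<close>.

  Nonlinear bound. The space-independent function \<open>W t = A * (t + T\<^sub>0) powr (- m)\<close> satisfies
  \<open>W'' + W' + W powr p \<ge> 0\<close> as soon as \<open>A powr (p - 1) \<ge> m\<close>, and for small \<open>\<epsilon>\<^sub>0\<close> it lies above
  the data. What is needed is a comparison principle for mild solutions. In the mild formulation
  the nonlinearity enters with the wrong sign, so no monotone iteration is available. However,
  \<open>v = exp (t / 2) * u\<close> solves \<open>v\<^sub>t\<^sub>t - v\<^sub>x\<^sub>x = exp (t / 2) * (u / 4 - u powr p)\<close>, whose right-hand side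
  increases with \<open>u\<close> where \<open>u\<close> is small, and the d'Alembert kernel is non-negative. The passage
  from the Bessel kernel to the d'Alembert kernel is made on the level of integral equations
  (\<open>wave_form_of_kg_form\<close>): convolving with the d'Alembert kernel and using two kernel identities,
  which become one-dimensional integrals in light-cone coordinates. After that, the excess of \<open>v\<close>
  over \<open>exp (t / 2) * W t\<close> shrinks by a factor 4 with each use of the equation
  (\<open>mild_solution_le_supersolution\<close>).

  The time derivative in the definition of a mild solution is a pointwise one, of an integral with
  moving end points. That it has the expected value for almost every \<open>x\<close> is a consequence of
  Lebesgue's differentiation theorem. All other integrals have non-negative integrands and are
  treated as extended non-negative integrals of Borel functions, so that Tonelli's theorem applies.
\<close>

section \<open>Lebesgue differentiation on the line\<close>

text \<open>The set consists of the points at which some difference quotients of the integral stay \<open>e\<close> away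
  from \<open>f\<close>. Vitali's covering lemma selects disjoint balls \<open>cball x \<bar>y - x\<bar>\<close> whose five-fold
  enlargements cover it, and the intervals between \<open>x\<close> and \<open>y\<close>, tagged by \<open>x\<close>, then form a partial
  division. On such a division Henstock's lemma makes the sum of all errors, hence the sum of all
  radii, as small as desired.\<close>

lemma negligible_Henstock_quotient:
  fixes f :: "real \<Rightarrow> real"
  assumes f: "f integrable_on cbox a b" and e: "e > 0"
  defines "J \<equiv> \<lambda>(x::real) y. cbox (min x y) (max x y)"
  shows "negligible {x \<in> cbox a b. \<forall>d>0. \<exists>y\<in>cbox a b. y \<noteq> x \<and> \<bar>y - x\<bar> < d \<and>
           e * \<bar>y - x\<bar> \<le> \<bar>\<bar>y - x\<bar> * f x - integral (J x y) f\<bar>}" (is "negligible ?E")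
  unfolding negligible_outer_le
proof (intro allI impI)
  fix \<eta> :: real assume \<eta>: "\<eta> > 0"
  obtain \<gamma> where \<gamma>: "gauge \<gamma>"
    and H: "\<And>p. \<lbrakk>p tagged_partial_division_of (cbox a b); \<gamma> fine p\<rbrakk> \<Longrightarrow>
             sum (\<lambda>(x,k). norm (measure lborel k *\<^sub>R f x - integral k f)) p < \<eta> * e / 10"
    using Henstock_lemma[OF f, of "\<eta> * e / 10"] \<eta> e by auto
  define r where "r = (\<lambda>i::real \<times> real. \<bar>snd i - fst i\<bar>)"
  define K where "K = {i. fst i \<in> cbox a b \<and> snd i \<in> cbox a b \<and> 0 < r i \<and>
    e * r i \<le> \<bar>r i * f (fst i) - integral (J (fst i) (snd i)) f\<bar> \<and> J (fst i) (snd i) \<subseteq> \<gamma> (fst i)}"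
  have cov: "?E \<subseteq> (\<Union>i\<in>K. cball (fst i) (r i))"
  proof
    fix x assume x: "x \<in> ?E"
    obtain d where d: "d > 0" "ball x d \<subseteq> \<gamma> x"
      using \<gamma> by (metis gauge_def openE)
    from x d obtain y where y: "y \<in> cbox a b" "y \<noteq> x" "\<bar>y - x\<bar> < d"
      "e * \<bar>y - x\<bar> \<le> \<bar>\<bar>y - x\<bar> * f x - integral (J x y) f\<bar>" by blast
    have "J x y \<subseteq> ball x d"
      using y(3) by (auto simp: J_def dist_real_def min_def max_def split: if_splits)
    then have "(x, y) \<in> K"
      using x y d by (auto simp: K_def r_def)
    moreover have "x \<in> cball (fst (x, y)) (r (x, y))" by (simp add: r_def)
    ultimately show "x \<in> (\<Union>i\<in>K. cball (fst i) (r i))" by blast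
  qed
  have rb: "\<And>i. i \<in> K \<Longrightarrow> 0 < r i \<and> r i \<le> b - a"
    by (auto simp: K_def r_def)
  obtain C where C: "countable C" "C \<subseteq> K"
    and disj: "pairwise (\<lambda>i j. disjnt (cball (fst i) (r i)) (cball (fst j) (r j))) C"
    and CE: "?E \<subseteq> (\<Union>i\<in>C. cball (fst i) (5 * r i))"
    using Vitali_covering_lemma_cballs[OF cov rb] by blast
  have fin: "measure lebesgue (\<Union>i\<in>I. cball (fst i) (5 * r i)) \<le> \<eta>" if I: "I \<subseteq> C" "finite I" for I
  proof -
    define g where "g = (\<lambda>i::real \<times> real. (fst i, J (fst i) (snd i)))"
    have IK: "i \<in> K" if "i \<in> I" for i using that I C by auto
    have Jb: "J (fst i) (snd i) \<subseteq> cball (fst i) (r i)" for i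
      by (auto simp: J_def r_def dist_real_def min_def max_def split: if_splits)
    have "cball (fst i) (r i) \<inter> cball (fst j) (r j) = {}" if "i \<in> I" "j \<in> I" "i \<noteq> j" for i j
      using disj that I by (meson disjnt_def pairwiseD subsetD)
    note dj = this
    have rp: "r i > 0" if "i \<in> I" for i using IK[OF that] by (simp add: K_def)
    have inj: "inj_on g I"
    proof (rule inj_onI, rule ccontr)
      fix i j assume ij: "i \<in> I" "j \<in> I" "g i = g j" "i \<noteq> j"
      then have "fst i \<in> cball (fst i) (r i) \<inter> cball (fst j) (r j)"
        using rp[of i] rp[of j] by (auto simp: g_def)
      with dj ij show False by blast
    qed
    have tp: "g ` I tagged_partial_division_of cbox a b"
      unfolding tagged_partial_division_of_def
    proof (intro conjI allI impI)
      show "finite (g ` I)" using I by simp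
    next
      fix x k assume "(x, k) \<in> g ` I"
      then obtain i where i: "i \<in> I" "x = fst i" "k = J (fst i) (snd i)" by (auto simp: g_def)
      with IK[OF i(1)] show "x \<in> k" "k \<subseteq> cbox a b" "\<exists>a b. k = cbox a b"
        by (auto simp: K_def J_def min_def max_def split: if_splits)
    next
      fix x1 k1 x2 k2 assume *: "(x1, k1) \<in> g ` I \<and> (x2, k2) \<in> g ` I \<and> (x1, k1) \<noteq> (x2, k2)"
      then obtain i j where "i \<in> I" "j \<in> I" "i \<noteq> j" "k1 = J (fst i) (snd i)" "k2 = J (fst j) (snd j)"
        by (auto simp: g_def)
      with dj[of i j] Jb[of i] Jb[of j] have "k1 \<inter> k2 = {}" by blast
      then show "interior k1 \<inter> interior k2 = {}"
        using interior_subset by blast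
    qed
    have "\<gamma> fine g ` I"
      by (auto simp: fine_def g_def dest!: IK) (auto simp: K_def)
    from H[OF tp this]
    have "(\<Sum>i\<in>I. \<bar>measure lborel (J (fst i) (snd i)) * f (fst i) - integral (J (fst i) (snd i)) f\<bar>) < \<eta> * e / 10"
      by (subst (asm) sum.reindex[OF inj]) (simp add: g_def)
    moreover have "measure lborel (J (fst i) (snd i)) = r i" for i
      by (auto simp: J_def r_def min_def max_def)
    ultimately have "(\<Sum>i\<in>I. \<bar>r i * f (fst i) - integral (J (fst i) (snd i)) f\<bar>) < \<eta> * e / 10"
      by simp
    moreover have "(\<Sum>i\<in>I. e * r i) \<le> (\<Sum>i\<in>I. \<bar>r i * f (fst i) - integral (J (fst i) (snd i)) f\<bar>)"
      by (intro sum_mono) (use IK in \<open>auto simp: K_def\<close>)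
    ultimately have "(\<Sum>i\<in>I. e * r i) \<le> e * (\<eta> / 10)"
      by (simp only: mult.commute times_divide_eq_right)
    then have "e * (\<Sum>i\<in>I. r i) \<le> e * (\<eta> / 10)"
      by (simp only: sum_distrib_left)
    then have "(\<Sum>i\<in>I. r i) \<le> \<eta> / 10"
      using e by (simp only: mult_le_cancel_left_pos)
    moreover have "measure lebesgue (\<Union>i\<in>I. cball (fst i) (5 * r i)) \<le> (\<Sum>i\<in>I. measure lebesgue (cball (fst i) (5 * r i)))"
      using I by (intro measure_UNION_le) auto
    moreover have "(\<Sum>i\<in>I. measure lebesgue (cball (fst i) (5 * r i))) = (\<Sum>i\<in>I. 10 * r i)"
      by (intro sum.cong refl) (use rp in \<open>force simp: cball_eq_atLeastAtMost\<close>)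
    ultimately show ?thesis
      by (simp add: sum_distrib_left[symmetric])
  qed
  show "\<exists>T. ?E \<subseteq> T \<and> T \<in> lmeasurable \<and> measure lebesgue T \<le> \<eta>"
    using CE fmeasurable_UN_bound[OF C(1), of "\<lambda>i. cball (fst i) (5 * r i)" lebesgue \<eta>]
      measure_UN_bound[OF C(1), of "\<lambda>i. cball (fst i) (5 * r i)" lebesgue \<eta>] fin
    by (meson lmeasurable_cball)
qed

theorem Lebesgue_differentiation:
  fixes f :: "real \<Rightarrow> real"
  assumes f: "f integrable_on {a..b}"
  shows "negligible {x \<in> {a<..<b}. \<not> ((\<lambda>u. integral {a..u} f) has_vector_derivative f x) (at x)}"
proof -
  define E where "E = (\<lambda>e. {x \<in> cbox a b. \<forall>d>0. \<exists>y\<in>cbox a b. y \<noteq> x \<and> \<bar>y - x\<bar> < d \<and>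
           e * \<bar>y - x\<bar> \<le> \<bar>\<bar>y - x\<bar> * f x - integral (cbox (min x y) (max x y)) f\<bar>})"
  have "negligible (E e)" if "e > 0" for e
    unfolding E_def using negligible_Henstock_quotient[of f a b e] f that by simp
  then have "negligible (\<Union>n::nat. E (inverse (Suc n)))"
    by (intro negligible_Union_nat) simp
  moreover have "{x \<in> {a<..<b}. \<not> ((\<lambda>u. integral {a..u} f) has_vector_derivative f x) (at x)}
      \<subseteq> (\<Union>n::nat. E (inverse (Suc n)))"
  proof (rule subsetI, rule ccontr)
    fix x assume x: "x \<in> {x \<in> {a<..<b}. \<not> ((\<lambda>u. integral {a..u} f) has_vector_derivative f x) (at x)}"
      and nE: "x \<notin> (\<Union>n::nat. E (inverse (Suc n)))"
    have "((\<lambda>u. integral {a..u} f) has_vector_derivative f x) (at x within {a..b})"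
      unfolding has_vector_derivative_def has_derivative_within_alt
    proof (intro conjI allI impI bounded_linear_scaleR_left)
      fix e :: real assume "e > 0"
      then obtain n where n: "inverse (real (Suc n)) < e"
        using reals_Archimedean by blast
      have "x \<notin> E (inverse (Suc n))" using nE by blast
      then have "\<exists>d>0. \<forall>y\<in>cbox a b. y \<noteq> x \<longrightarrow> \<bar>y - x\<bar> < d \<longrightarrow>
          \<bar>\<bar>y - x\<bar> * f x - integral (cbox (min x y) (max x y)) f\<bar> < inverse (Suc n) * \<bar>y - x\<bar>"
        unfolding E_def using x by (simp add: not_le) blast
      then obtain d where d: "d > 0" and
        D: "\<And>y. y \<in> cbox a b \<Longrightarrow> y \<noteq> x \<Longrightarrow> \<bar>y - x\<bar> < d \<Longrightarrow>
          \<bar>\<bar>y - x\<bar> * f x - integral (cbox (min x y) (max x y)) f\<bar> < inverse (Suc n) * \<bar>y - x\<bar>"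
        by blast
      have "\<bar>integral {a..y} f - integral {a..x} f - (y - x) * f x\<bar> \<le> e * \<bar>y - x\<bar>"
        if y: "y \<in> {a..b}" "\<bar>y - x\<bar> < d" for y
      proof (cases "x = y")
        case False
        have xab: "a \<le> x" "x \<le> b" using x by auto
        have "\<bar>integral {a..y} f - integral {a..x} f - (y - x) * f x\<bar> =
          \<bar>\<bar>y - x\<bar> * f x - integral (cbox (min x y) (max x y)) f\<bar>"
        proof (cases "x < y")
          case True
          have "f integrable_on {a..y}" using f y by (auto intro: integrable_subinterval_real)
          from Henstock_Kurzweil_Integration.integral_combine[of a x y f, OF _ _ this] True xab y
          show ?thesis by (simp add: abs_minus_commute algebra_simps min_def max_def)
        next
          case False
          have "f integrable_on {a..x}" using f xab by (auto intro: integrable_subinterval_real)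
          from Henstock_Kurzweil_Integration.integral_combine[of a y x f, OF _ _ this] False \<open>x \<noteq> y\<close> xab y
          have "integral {a..x} f = integral {a..y} f + integral {y..x} f" by auto
          with False \<open>x \<noteq> y\<close> show ?thesis by (simp add: algebra_simps min_def max_def)
        qed
        also have "\<dots> \<le> inverse (Suc n) * \<bar>y - x\<bar>" using D[of y] y False by auto
        also have "\<dots> \<le> e * \<bar>y - x\<bar>" using n by (intro mult_right_mono) auto
        finally show ?thesis .
      qed auto
      with d show "\<exists>d>0. \<forall>y\<in>{a..b}. norm (y - x) < d \<longrightarrow>
        norm (integral {a..y} f - integral {a..x} f - (y - x) *\<^sub>R f x) \<le> e * norm (y - x)"
        by (auto simp del: scaleR_conv_of_real)
    qed
    then have "((\<lambda>u. integral {a..u} f) has_vector_derivative f x) (at x)"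
      using x by (metis (no_types, lifting) at_within_Icc_at greaterThanLessThan_iff mem_Collect_eq)
    with x show False by simp
  qed
  ultimately show ?thesis using negligible_subset by blast
qed

section \<open>The Bessel--Clifford functions\<close>

text \<open>\<open>bessel_clifford n (z\<^sup>2 / 4) = (z / 2) powr (- n) * I\<^sub>n z\<close>. In the variable \<open>w = z\<^sup>2 / 4\<close> these
  functions are entire, differentiation raises the index, and no square root of \<open>t\<^sup>2 - y\<^sup>2\<close> is left.\<close>

definition bessel_clifford :: "nat \<Rightarrow> real \<Rightarrow> real" where
  "bessel_clifford n w = (\<Sum>k. w ^ k / (fact k * fact (k + n)))"

lemma summable_bessel_clifford: "summable (\<lambda>k. (w::real) ^ k / (fact k * fact (k + n)))"
proof (rule summable_comparison_test'[where N = 0])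
  show "summable (\<lambda>k. inverse (fact k) * \<bar>w\<bar> ^ k)"
    using summable_exp[of "\<bar>w\<bar>"] by simp
  show "norm (w ^ k / (fact k * fact (k + n))) \<le> inverse (fact k) * \<bar>w\<bar> ^ k" for k
  proof -
    have "(fact k :: real) \<le> fact k * fact (k + n)"
      using fact_ge_1[of "k + n", where 'a = real] by (simp add: mult_le_cancel_left1)
    then have "\<bar>w\<bar> ^ k / (fact k * fact (k + n)) \<le> \<bar>w\<bar> ^ k / fact k"
      by (intro divide_left_mono) auto
    then show ?thesis
      by (simp add: power_abs abs_mult divide_inverse mult.commute)
  qed
qed

lemma has_real_derivative_bessel_clifford:
  "(bessel_clifford n has_real_derivative bessel_clifford (Suc n) w) (at w)"
proof -
  let ?c = "\<lambda>k. 1 / (fact k * fact (k + n)) :: real"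
  have "((\<lambda>x. \<Sum>k. ?c k * x ^ k) has_real_derivative (\<Sum>k. diffs ?c k * w ^ k)) (at w)"
    by (rule termdiffs_strong_converges_everywhere)
       (use summable_bessel_clifford[of _ n] in \<open>simp add: mult.commute\<close>)
  moreover have "diffs ?c k * w ^ k = w ^ k / (fact k * fact (k + Suc n))" for k
    by (simp add: diffs_def field_simps del: of_nat_Suc)
  ultimately show ?thesis
    unfolding bessel_clifford_def[abs_def] by simp
qed

lemmas DERIV_bessel_clifford [derivative_intros] =
  has_real_derivative_bessel_clifford[THEN DERIV_chain2]

lemma continuous_on_bessel_clifford [continuous_intros]:
  "continuous_on A f \<Longrightarrow> continuous_on A (\<lambda>x. bessel_clifford n (f x))"
  by (rule continuous_on_compose2[of UNIV "bessel_clifford n"])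
     (auto intro: continuous_at_imp_continuous_on DERIV_isCont has_real_derivative_bessel_clifford)

lemma borel_measurable_bessel_clifford [measurable]: "bessel_clifford n \<in> borel_measurable borel"
  by (intro borel_measurable_continuous_onI continuous_intros)

lemma bessel_clifford_mono:
  assumes "0 \<le> w" "w \<le> w'" shows "bessel_clifford n w \<le> bessel_clifford n w'"
  unfolding bessel_clifford_def
  by (intro suminf_le summable_bessel_clifford divide_right_mono power_mono) (use assms in auto)

lemma bessel_clifford_0 [simp]: "bessel_clifford n 0 = 1 / fact n"
  unfolding bessel_clifford_def using powser_zero[of "\<lambda>k. 1 / (fact k * fact (k + n)) :: real"]
  by simp

lemma bessel_clifford_pos: "0 \<le> w \<Longrightarrow> 0 < bessel_clifford n w"
  using bessel_clifford_mono[of 0 w n] by (smt (verit) bessel_clifford_0 fact_gt_zero zero_less_divide_1_iff)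

lemma bessel_clifford_nonneg: "0 \<le> w \<Longrightarrow> 0 \<le> bessel_clifford n w"
  using bessel_clifford_pos by (rule less_imp_le)

lemma bessel_clifford_ge_1: "0 \<le> w \<Longrightarrow> 1 \<le> bessel_clifford 0 w"
  using bessel_clifford_mono[of 0 w 0] by simp

lemma bessel_clifford_recurrence:
  "bessel_clifford 0 w = bessel_clifford 1 w + w * bessel_clifford 2 w"
proof -
  let ?g = "\<lambda>k. (case k of 0 \<Rightarrow> 0 | Suc j \<Rightarrow> w * (w ^ j / (fact j * fact (j + 2))))"
  have "(\<lambda>j. ?g (Suc j)) sums (w * bessel_clifford 2 w)"
    unfolding bessel_clifford_def
    using sums_mult[OF summable_sums[OF summable_bessel_clifford[of w 2]], of w] by (simp del: fact_Suc add: add_2_eq_Suc')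
  then have "?g sums (w * bessel_clifford 2 w)"
    using sums_Suc_iff[of ?g "w * bessel_clifford 2 w"] by (simp only: nat.case add_0_right)
  from sums_add[OF summable_sums[OF summable_bessel_clifford[of w 1]] this]
  have "(\<lambda>k. w ^ k / (fact k * fact (k + 1)) + ?g k) sums (bessel_clifford 1 w + w * bessel_clifford 2 w)"
    unfolding bessel_clifford_def .
  moreover have "w ^ k / (fact k * fact (k + 1)) + ?g k = w ^ k / (fact k * fact (k + 0))" for k
    by (cases k) (auto simp: divide_simps, simp add: algebra_simps)
  ultimately show ?thesis
    unfolding bessel_clifford_def[of 0] by (simp add: sums_iff)
qed

text \<open>The derivative \<open>bessel_clifford 1\<close> increases on the half-line, so the graph lies above its tangents.\<close>

lemma bessel_clifford_tangent:
  assumes "0 \<le> w" "0 \<le> d"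
  shows "bessel_clifford 0 w + d * bessel_clifford 1 w \<le> bessel_clifford 0 (w + d)"
proof (cases "d = 0")
  case False
  have "\<exists>z>w. z < w + d \<and> bessel_clifford 0 (w + d) - bessel_clifford 0 w
       = (w + d - w) * bessel_clifford 1 z"
    using False assms has_real_derivative_bessel_clifford[of 0] by (intro MVT2) auto
  then obtain z where "z > w" "bessel_clifford 0 (w + d) - bessel_clifford 0 w = d * bessel_clifford 1 z"
    by auto
  then show ?thesis
    using bessel_clifford_mono[of w z 1] assms mult_left_mono[of "bessel_clifford 1 w" "bessel_clifford 1 z" d] by auto
qed simp

lemma bessel_I0_eq_clifford:
  assumes "\<bar>y\<bar> \<le> t"
  shows "bessel_I0 (sqrt (t\<^sup>2 - y\<^sup>2) / 2) = bessel_clifford 0 ((t\<^sup>2 - y\<^sup>2) / 16)"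
proof -
  have "y\<^sup>2 \<le> t\<^sup>2" using assms by (simp add: abs_le_square_iff[symmetric])
  then have "(sqrt (t\<^sup>2 - y\<^sup>2) / 2 / 2) ^ (2 * k) = ((t\<^sup>2 - y\<^sup>2) / 16) ^ k" for k
    by (simp add: power_mult power_divide)
  then show ?thesis
    by (simp add: bessel_I0_def bessel_clifford_def power2_eq_square)
qed

lemma integral_cos_power_Suc_Suc:
  "real (n + 2) * integral {0..pi} (\<lambda>\<theta>. cos \<theta> ^ (n + 2)) = real (n + 1) * integral {0..pi} (\<lambda>\<theta>. cos \<theta> ^ n)"
proof -
  have "((\<lambda>\<theta>. real (n + 2) * cos \<theta> ^ (n + 2) - real (n + 1) * cos \<theta> ^ n) has_integral
      (sin pi * cos pi ^ (n + 1) - sin 0 * cos 0 ^ (n + 1))) {0..pi}"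
  proof (rule fundamental_theorem_of_calculus)
    fix x :: real
    have "((\<lambda>\<theta>. cos \<theta> ^ (n + 1)) has_real_derivative real (n + 1) * cos x ^ n * - sin x) (at x within {0..pi})"
      using DERIV_power[OF DERIV_subset[OF DERIV_cos], where n = "n + 1"] by (simp add: mult_ac)
    from DERIV_mult[OF DERIV_subset[OF DERIV_sin] this]
    have "((\<lambda>\<theta>. sin \<theta> * cos \<theta> ^ (n + 1)) has_real_derivative
        cos x * cos x ^ (n + 1) + sin x * (real (n + 1) * cos x ^ n * - sin x)) (at x within {0..pi})"
      by (simp add: mult_ac add_ac)
    moreover have "cos x * cos x ^ (n + 1) + sin x * (real (n + 1) * cos x ^ n * - sin x)
        = real (n + 2) * cos x ^ (n + 2) - real (n + 1) * cos x ^ n"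
    proof -
      have "sin x * (real (n + 1) * cos x ^ n * - sin x) = - real (n + 1) * cos x ^ n * (sin x)\<^sup>2"
        by (simp add: power2_eq_square algebra_simps)
      also have "\<dots> = - real (n + 1) * cos x ^ n * (1 - (cos x)\<^sup>2)"
        by (simp only: sin_squared_eq)
      finally have "sin x * (real (n + 1) * cos x ^ n * - sin x) = - real (n + 1) * cos x ^ n * (1 - (cos x)\<^sup>2)" .
      moreover have "c * c ^ (n + 1) + - real (n + 1) * c ^ n * (1 - c\<^sup>2) = real (n + 2) * c ^ (n + 2) - real (n + 1) * c ^ n" for c :: real
        by (simp add: algebra_simps power2_eq_square)
      ultimately show ?thesis by presburger
    qed
    ultimately show "((\<lambda>\<theta>. sin \<theta> * cos \<theta> ^ (n + 1)) has_vector_derivative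
        real (n + 2) * cos x ^ (n + 2) - real (n + 1) * cos x ^ n) (at x within {0..pi})"
      by (simp add: has_real_derivative_iff_has_vector_derivative)
  qed simp
  then have "integral {0..pi} (\<lambda>\<theta>. real (n + 2) * cos \<theta> ^ (n + 2) - real (n + 1) * cos \<theta> ^ n) = 0"
    by (simp add: integral_unique)
  moreover have "integral {0..pi} (\<lambda>\<theta>. real (n + 2) * cos \<theta> ^ (n + 2) - real (n + 1) * cos \<theta> ^ n)
     = real (n + 2) * integral {0..pi} (\<lambda>\<theta>. cos \<theta> ^ (n + 2)) - real (n + 1) * integral {0..pi} (\<lambda>\<theta>. cos \<theta> ^ n)"
    by (subst Henstock_Kurzweil_Integration.integral_diff)
       (auto intro!: integrable_continuous_real continuous_intros simp del: of_nat_Suc of_nat_add)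
  ultimately show ?thesis by simp
qed

lemma integral_cos_power_odd: "integral {0..pi} (\<lambda>\<theta>. cos \<theta> ^ Suc (2 * k)) = 0"
proof (induction k)
  case 0
  have "(cos has_integral (sin pi - sin 0)) {0..pi}"
    by (intro fundamental_theorem_of_calculus)
       (auto simp flip: has_real_derivative_iff_has_vector_derivative intro!: derivative_eq_intros)
  then show ?case by (simp add: integral_unique)
next
  case (Suc k)
  then show ?case using integral_cos_power_Suc_Suc[of "Suc (2 * k)"] by simp
qed

lemma integral_cos_power_even:
  "integral {0..pi} (\<lambda>\<theta>. cos \<theta> ^ (2 * k)) = pi * fact (2 * k) / (4 ^ k * (fact k)\<^sup>2)"
proof (induction k)
  case (Suc k)
  have "integral {0..pi} (\<lambda>\<theta>. cos \<theta> ^ (2 * k + 2)) =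
    real (2 * k + 1) / real (2 * k + 2) * integral {0..pi} (\<lambda>\<theta>. cos \<theta> ^ (2 * k))"
    using integral_cos_power_Suc_Suc[of "2 * k"] by (simp add: field_simps)
  also have "\<dots> = pi * fact (2 * Suc k) / (4 ^ Suc k * (fact (Suc k))\<^sup>2)"
    unfolding Suc by (simp add: divide_simps power2_eq_square) (simp add: algebra_simps)
  finally show ?case by simp
qed simp

text \<open>Expanding the exponential and integrating term by term leaves the even moments of \<open>cos\<close>, which
  turn the exponential series into the Bessel--Clifford series.\<close>

lemma bessel_clifford_integral:
  "integral {0..pi} (\<lambda>\<theta>. exp (z * cos \<theta>)) = pi * bessel_clifford 0 (z\<^sup>2 / 4)"
proof -
  let ?M = "restrict_space lborel {0..pi}"
  let ?f = "\<lambda>n \<theta>. z ^ n / fact n * cos \<theta> ^ n"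
  have LI: "integral\<^sup>L ?M g = integral {0..pi} g" and int: "integrable ?M g"
    if "continuous_on {0..pi} g" for g :: "real \<Rightarrow> real"
    using borel_integrable_atLeastAtMost'[OF that] set_borel_integral_eq_integral(2)[of "{0..pi}" g]
    by (simp_all add: integral_restrict_space set_lebesgue_integral_def set_integrable_def integrable_restrict_space)
  have "(\<lambda>n. integral\<^sup>L ?M (?f n)) sums integral\<^sup>L ?M (\<lambda>\<theta>. \<Sum>n. ?f n \<theta>)"
  proof (rule sums_integral)
    show "integrable ?M (?f n)" for n by (intro int continuous_intros)
    have bnd: "norm (?f n \<theta>) \<le> inverse (fact n) * \<bar>z\<bar> ^ n" for n \<theta>
      by (simp add: power_abs abs_mult field_simps mult_left_le power_le_one mult_le_one)
    have s: "summable (\<lambda>n. inverse (fact n) * \<bar>z\<bar> ^ n)" using summable_exp[of "\<bar>z\<bar>"] by simp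
    show "AE \<theta> in ?M. summable (\<lambda>n. norm (?f n \<theta>))"
      by (intro AE_I2 summable_comparison_test'[OF s, where N = 0]) (use bnd in simp)
    show "summable (\<lambda>n. integral\<^sup>L ?M (\<lambda>\<theta>. norm (?f n \<theta>)))"
    proof (rule summable_comparison_test'[OF summable_mult[OF s, of pi], where N = 0])
      fix n
      let ?J = "integral {0..pi} (\<lambda>\<theta>. norm (?f n \<theta>))"
      have "?J \<le> integral {0..pi} (\<lambda>\<theta>. inverse (fact n) * \<bar>z\<bar> ^ n)"
        by (intro integral_le integrable_continuous_real continuous_intros) (use bnd in auto)
      also have "\<dots> = pi * (inverse (fact n) * \<bar>z\<bar> ^ n)"
        by (simp only: integral_const_real content_real pi_ge_zero real_scaleR_def) simp
      finally have "?J \<le> pi * (inverse (fact n) * \<bar>z\<bar> ^ n)" .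
      moreover have "0 \<le> ?J"
        by (intro Henstock_Kurzweil_Integration.integral_nonneg integrable_continuous_real continuous_intros) simp_all
      moreover have "integral\<^sup>L ?M (\<lambda>\<theta>. norm (?f n \<theta>)) = ?J"
        by (intro LI continuous_intros) simp_all
      ultimately show "norm (integral\<^sup>L ?M (\<lambda>\<theta>. norm (?f n \<theta>))) \<le> pi * (inverse (fact n) * \<bar>z\<bar> ^ n)"
        by (simp only: real_norm_def abs_of_nonneg)
    qed
  qed
  moreover have "(\<Sum>n. ?f n \<theta>) = exp (z * cos \<theta>)" for \<theta>
    by (simp add: exp_def power_mult_distrib field_simps)
  ultimately have "(\<lambda>n. z ^ n / fact n * integral {0..pi} (\<lambda>\<theta>. cos \<theta> ^ n)) sums
      integral {0..pi} (\<lambda>\<theta>. exp (z * cos \<theta>))" (is "?c sums _")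
    by (subst (asm) (1 2) LI) (auto intro!: continuous_intros)
  then have "(\<lambda>k. ?c (2 * k)) sums integral {0..pi} (\<lambda>\<theta>. exp (z * cos \<theta>))"
  proof (subst sums_mono_reindex)
    show "strict_mono (\<lambda>k::nat. 2 * k)" by (auto simp: strict_mono_def)
    fix n :: nat assume "n \<notin> range (\<lambda>k. 2 * k)"
    then have "odd n" by (auto elim!: evenE)
    then obtain k where "n = Suc (2 * k)" by (auto elim!: oddE)
    then show "?c n = 0" using integral_cos_power_odd[of k] by simp
  qed
  moreover have "?c (2 * k) = pi * ((z\<^sup>2 / 4) ^ k / (fact k * fact (k + 0)))" for k
    by (simp only: integral_cos_power_even) (simp add: power_mult power_divide power2_eq_square)
  ultimately have "(\<lambda>k. pi * ((z\<^sup>2 / 4) ^ k / (fact k * fact (k + 0)))) sums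
      integral {0..pi} (\<lambda>\<theta>. exp (z * cos \<theta>))" by simp
  moreover have "(\<lambda>k. pi * ((z\<^sup>2 / 4) ^ k / (fact k * fact (k + 0)))) sums (pi * bessel_clifford 0 (z\<^sup>2 / 4))"
    unfolding bessel_clifford_def by (intro sums_mult summable_sums summable_bessel_clifford)
  ultimately show ?thesis by (rule sums_unique2)
qed

text \<open>This is \<open>I\<^sub>0 (z + h) \<ge> exp (h - 1/2) / (pi * sqrt h) * I\<^sub>0 z\<close>, with the optimal power of \<open>h\<close>. In
  \<open>\<integral> exp (z * cos \<theta>) * exp (h * cos \<theta>)\<close> the second factor is at least \<open>exp (h - 1/2)\<close> for
  \<open>\<theta> \<le> 1 / sqrt h\<close>. Since the first factor decreases in \<open>\<theta>\<close>, this initial part of the interval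
  carries at least its proportional share of the integral.\<close>

lemma bessel_clifford_growth:
  assumes z: "0 \<le> z" and h: "1 \<le> h"
  shows "exp (h - 1/2) / (pi * sqrt h) * bessel_clifford 0 (z\<^sup>2 / 4) \<le> bessel_clifford 0 ((z + h)\<^sup>2 / 4)"
proof -
  let ?g = "\<lambda>\<theta>. exp (z * cos \<theta>)"
  \<comment> \<open>On \<open>{0..\<delta>}\<close> one has \<open>h * (1 - cos \<theta>) \<le> 1/2\<close>.\<close>
  define \<delta> where "\<delta> = 1 / sqrt h"
  have \<delta>: "0 < \<delta>" "\<delta> \<le> 1" "h * \<delta>\<^sup>2 = 1" using h by (auto simp: \<delta>_def power_divide)
  then have \<delta>pi: "\<delta> \<le> pi" using pi_gt3 by linarith
  have int: "f integrable_on {c..d}" if "continuous_on UNIV f" for f :: "real \<Rightarrow> real" and c d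
    using that by (intro integrable_continuous_real) (auto intro: continuous_on_subset)
  have dec: "?g b \<le> ?g a" if "0 \<le> a" "a \<le> b" "b \<le> pi" for a b
    using that z by (auto intro!: mult_left_mono cos_monotone_0_pi_le)
  have "integral {0..\<delta>} (\<lambda>_. ?g \<delta>) \<le> integral {0..\<delta>} ?g"
    using dec \<delta> \<delta>pi by (intro integral_le int continuous_intros) auto
  then have lo: "\<delta> * ?g \<delta> \<le> integral {0..\<delta>} ?g"
    using \<delta> by simp
  have "integral {\<delta>..pi} ?g \<le> integral {\<delta>..pi} (\<lambda>_. ?g \<delta>)"
    using dec \<delta> \<delta>pi by (intro integral_le int continuous_intros) auto
  then have hi: "integral {\<delta>..pi} ?g \<le> (pi - \<delta>) * ?g \<delta>"
    using \<delta>pi by simp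
  have split: "integral {0..pi} ?g = integral {0..\<delta>} ?g + integral {\<delta>..pi} ?g"
    using \<delta> \<delta>pi
    by (intro Henstock_Kurzweil_Integration.integral_combine[symmetric] int continuous_intros) auto
  have "\<delta> * integral {\<delta>..pi} ?g \<le> (pi - \<delta>) * (\<delta> * ?g \<delta>)"
    using mult_left_mono[OF hi, of \<delta>] \<delta> by (simp add: algebra_simps)
  also have "\<dots> \<le> (pi - \<delta>) * integral {0..\<delta>} ?g"
    using lo \<delta>pi by (intro mult_left_mono) auto
  \<comment> \<open>Averages of a decreasing function over initial segments are at least its total average.\<close>
  finally have cheb: "\<delta> / pi * integral {0..pi} ?g \<le> integral {0..\<delta>} ?g"
    unfolding split by (simp add: field_simps)
  have "exp (h - 1/2) * integral {0..\<delta>} ?g = integral {0..\<delta>} (\<lambda>\<theta>. exp (h - 1/2) * ?g \<theta>)"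
    by simp
  also have "\<dots> \<le> integral {0..\<delta>} (\<lambda>\<theta>. exp ((z + h) * cos \<theta>))"
  proof (intro integral_le int continuous_intros)
    fix \<theta> assume \<theta>: "\<theta> \<in> {0..\<delta>}"
    have "1 - cos \<theta> = 2 * (sin (\<theta> / 2))\<^sup>2" using cos_double_sin[of "\<theta> / 2"] by simp
    also have "\<dots> \<le> 2 * (\<theta> / 2)\<^sup>2"
      using abs_sin_x_le_abs_x[of "\<theta> / 2"] by (simp only: abs_le_square_iff[symmetric] mult_le_cancel_left_pos zero_less_numeral)
    finally have "h * (1 - cos \<theta>) \<le> h * (\<theta>\<^sup>2 / 2)"
      using h by (intro mult_left_mono) (auto simp: power_divide)
    also have "\<dots> \<le> h * \<delta>\<^sup>2 / 2"
      using h \<theta> power_mono[of \<theta> \<delta> 2] by auto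
    finally have "h - 1/2 \<le> h * cos \<theta>" using \<delta> by (simp add: algebra_simps)
    then show "exp (h - 1/2) * ?g \<theta> \<le> exp ((z + h) * cos \<theta>)"
      by (simp add: exp_add[symmetric] algebra_simps)
  qed
  also have "\<dots> \<le> integral {0..pi} (\<lambda>\<theta>. exp ((z + h) * cos \<theta>))"
    by (intro integral_subset_le int continuous_intros) (use \<delta>pi in auto)
  also have "\<dots> = pi * bessel_clifford 0 ((z + h)\<^sup>2 / 4)"
    by (rule bessel_clifford_integral)
  finally have *: "exp (h - 1/2) * integral {0..\<delta>} ?g \<le> pi * bessel_clifford 0 ((z + h)\<^sup>2 / 4)" .
  have "exp (h - 1/2) * (\<delta> / pi * (pi * bessel_clifford 0 (z\<^sup>2 / 4)))
      \<le> exp (h - 1/2) * integral {0..\<delta>} ?g"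
    using cheb bessel_clifford_integral[of z] by (intro mult_left_mono) auto
  also note *
  finally have "pi * (exp (h - 1/2) / (pi * sqrt h) * bessel_clifford 0 (z\<^sup>2 / 4))
      \<le> pi * bessel_clifford 0 ((z + h)\<^sup>2 / 4)"
    by (simp add: \<delta>_def)
  then show ?thesis by (simp only: mult_le_cancel_left_pos[OF pi_gt_zero])
qed

section \<open>Space-time convolutions and wave kernels\<close>

text \<open>The rule would turn the factors \<open>ennreal (1/2)\<close> into \<open>inverse 2\<close>, which no longer combines with
  other real factors.\<close>

declare ennreal_half [simp del]

lemma borel_measurable_fst_snd [measurable]:
  "fst \<in> borel_measurable (borel :: (real \<times> real) measure)"
  "snd \<in> borel_measurable (borel :: (real \<times> real) measure)"
  unfolding borel_prod[symmetric] by measurable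

text \<open>Convolution in space-time and in space alone. Kernels live on the whole plane and vanish outside
  the forward light cone. So causality needs no integration bounds, and the convolutions are
  associative like those on any group.\<close>

definition st_conv :: "(real \<times> real \<Rightarrow> ennreal) \<Rightarrow> (real \<times> real \<Rightarrow> ennreal) \<Rightarrow> real \<times> real \<Rightarrow> ennreal" where
  "st_conv K g = (\<lambda>(t, x). \<integral>\<^sup>+\<tau>. \<integral>\<^sup>+y. K (t - \<tau>, x - y) * g (\<tau>, y) \<partial>lborel \<partial>lborel)"

definition sp_conv :: "(real \<times> real \<Rightarrow> ennreal) \<Rightarrow> (real \<Rightarrow> ennreal) \<Rightarrow> real \<times> real \<Rightarrow> ennreal" where
  "sp_conv K f = (\<lambda>(t, x). \<integral>\<^sup>+y. K (t, x - y) * f y \<partial>lborel)"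

lemma borel_measurable_st_conv [measurable]:
  assumes [measurable]: "K \<in> borel_measurable borel" "g \<in> borel_measurable borel"
  shows "st_conv K g \<in> borel_measurable borel"
  unfolding st_conv_def borel_prod[symmetric] by measurable

lemma borel_measurable_sp_conv [measurable]:
  assumes [measurable]: "K \<in> borel_measurable borel" "f \<in> borel_measurable borel"
  shows "sp_conv K f \<in> borel_measurable borel"
  unfolding sp_conv_def borel_prod[symmetric] by measurable

lemma nn_integral_shift:
  fixes f :: "real \<Rightarrow> ennreal"
  assumes "f \<in> borel_measurable borel"
  shows "(\<integral>\<^sup>+x. f (x - c) \<partial>lborel) = (\<integral>\<^sup>+x. f x \<partial>lborel)"
  using nn_integral_real_affine[OF assms, of 1 "- c"] by (simp add: add.commute)

lemma nn_integral_swap: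
  fixes f :: "real \<Rightarrow> real \<Rightarrow> ennreal"
  assumes "(\<lambda>p. f (fst p) (snd p)) \<in> borel_measurable borel"
  shows "(\<integral>\<^sup>+x. \<integral>\<^sup>+y. f x y \<partial>lborel \<partial>lborel) = (\<integral>\<^sup>+y. \<integral>\<^sup>+x. f x y \<partial>lborel \<partial>lborel)"
  by (rule lborel_pair.Fubini'[symmetric])
     (use assms in \<open>simp add: case_prod_beta lborel_prod\<close>)

lemma st_conv_sp_conv:
  assumes [measurable]: "K \<in> borel_measurable borel" "L \<in> borel_measurable borel" "f \<in> borel_measurable borel"
  shows "st_conv K (sp_conv L f) = sp_conv (st_conv K L) f"
proof (rule ext, clarify)
  fix t x
  have "st_conv K (sp_conv L f) (t, x) =
      (\<integral>\<^sup>+\<tau>. \<integral>\<^sup>+y. \<integral>\<^sup>+z. K (t - \<tau>, x - y) * L (\<tau>, y - z) * f z \<partial>lborel \<partial>lborel \<partial>lborel)"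
    unfolding st_conv_def sp_conv_def by (simp add: nn_integral_cmult[symmetric] mult.assoc)
  also have "\<dots> = (\<integral>\<^sup>+\<tau>. \<integral>\<^sup>+z. \<integral>\<^sup>+y. K (t - \<tau>, x - y) * L (\<tau>, y - z) * f z \<partial>lborel \<partial>lborel \<partial>lborel)"
    by (intro nn_integral_cong nn_integral_swap) (unfold borel_prod[symmetric], measurable)
  also have "\<dots> = (\<integral>\<^sup>+z. \<integral>\<^sup>+\<tau>. \<integral>\<^sup>+y. K (t - \<tau>, x - y) * L (\<tau>, y - z) * f z \<partial>lborel \<partial>lborel \<partial>lborel)"
    by (intro nn_integral_swap) (unfold borel_prod[symmetric], measurable)
  also have "\<dots> = (\<integral>\<^sup>+z. \<integral>\<^sup>+\<tau>. \<integral>\<^sup>+y. K (t - \<tau>, x - z - y) * L (\<tau>, y) * f z \<partial>lborel \<partial>lborel \<partial>lborel)"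
  proof (rule nn_integral_cong, rule nn_integral_cong)
    fix z \<tau>
    show "(\<integral>\<^sup>+y. K (t - \<tau>, x - y) * L (\<tau>, y - z) * f z \<partial>lborel) =
        (\<integral>\<^sup>+y. K (t - \<tau>, x - z - y) * L (\<tau>, y) * f z \<partial>lborel)"
      using nn_integral_shift[of "\<lambda>y. K (t - \<tau>, x - z - y) * L (\<tau>, y) * f z" z] by simp
  qed
  also have "\<dots> = sp_conv (st_conv K L) f (t, x)"
    unfolding st_conv_def sp_conv_def by (simp add: nn_integral_multc)
  finally show "st_conv K (sp_conv L f) (t, x) = sp_conv (st_conv K L) f (t, x)" .
qed

text \<open>Tonelli's theorem and translation invariance.\<close>

lemma st_conv_assoc:
  assumes [measurable]: "K \<in> borel_measurable borel" "L \<in> borel_measurable borel" "g \<in> borel_measurable borel"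
  shows "st_conv K (st_conv L g) = st_conv (st_conv K L) g"
proof (rule ext, clarify)
  fix t x
  let ?I = "\<lambda>\<tau> y s z. K (t - \<tau>, x - y) * L (\<tau> - s, y - z) * g (s, z)"
  have "st_conv K (st_conv L g) (t, x) =
      (\<integral>\<^sup>+\<tau>. \<integral>\<^sup>+y. \<integral>\<^sup>+s. \<integral>\<^sup>+z. ?I \<tau> y s z \<partial>lborel \<partial>lborel \<partial>lborel \<partial>lborel)"
    unfolding st_conv_def by (simp add: nn_integral_cmult[symmetric] mult.assoc)
  also have "\<dots> = (\<integral>\<^sup>+\<tau>. \<integral>\<^sup>+s. \<integral>\<^sup>+y. \<integral>\<^sup>+z. ?I \<tau> y s z \<partial>lborel \<partial>lborel \<partial>lborel \<partial>lborel)"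
    by (intro nn_integral_cong nn_integral_swap) (unfold borel_prod[symmetric], measurable)
  also have "\<dots> = (\<integral>\<^sup>+s. \<integral>\<^sup>+\<tau>. \<integral>\<^sup>+y. \<integral>\<^sup>+z. ?I \<tau> y s z \<partial>lborel \<partial>lborel \<partial>lborel \<partial>lborel)"
    by (intro nn_integral_swap) (unfold borel_prod[symmetric], measurable)
  also have "\<dots> = (\<integral>\<^sup>+s. \<integral>\<^sup>+\<tau>. \<integral>\<^sup>+z. \<integral>\<^sup>+y. ?I \<tau> y s z \<partial>lborel \<partial>lborel \<partial>lborel \<partial>lborel)"
    by (intro nn_integral_cong nn_integral_swap) (unfold borel_prod[symmetric], measurable)
  also have "\<dots> = (\<integral>\<^sup>+s. \<integral>\<^sup>+z. \<integral>\<^sup>+\<tau>. \<integral>\<^sup>+y. ?I \<tau> y s z \<partial>lborel \<partial>lborel \<partial>lborel \<partial>lborel)"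
    by (intro nn_integral_cong nn_integral_swap) (unfold borel_prod[symmetric], measurable)
  also have "\<dots> = (\<integral>\<^sup>+s. \<integral>\<^sup>+z. \<integral>\<^sup>+\<tau>. \<integral>\<^sup>+y. K (t - s - \<tau>, x - z - y) * L (\<tau>, y) * g (s, z) \<partial>lborel \<partial>lborel \<partial>lborel \<partial>lborel)"
  proof (rule nn_integral_cong, rule nn_integral_cong)
    fix s z
    have "(\<integral>\<^sup>+\<tau>. \<integral>\<^sup>+y. ?I \<tau> y s z \<partial>lborel \<partial>lborel) =
        (\<integral>\<^sup>+\<tau>. \<integral>\<^sup>+y. K (t - \<tau>, x - z - y) * L (\<tau> - s, y) * g (s, z) \<partial>lborel \<partial>lborel)"
    proof (rule nn_integral_cong)
      fix \<tau>
      show "(\<integral>\<^sup>+y. ?I \<tau> y s z \<partial>lborel) =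
        (\<integral>\<^sup>+y. K (t - \<tau>, x - z - y) * L (\<tau> - s, y) * g (s, z) \<partial>lborel)"
        using nn_integral_shift[of "\<lambda>y. K (t - \<tau>, x - z - y) * L (\<tau> - s, y) * g (s, z)" z] by simp
    qed
    also have "\<dots> = (\<integral>\<^sup>+\<tau>. \<integral>\<^sup>+y. K (t - s - \<tau>, x - z - y) * L (\<tau>, y) * g (s, z) \<partial>lborel \<partial>lborel)"
      using nn_integral_shift[of "\<lambda>\<tau>. \<integral>\<^sup>+y. K (t - s - \<tau>, x - z - y) * L (\<tau>, y) * g (s, z) \<partial>lborel" s] by simp
    finally show "(\<integral>\<^sup>+\<tau>. \<integral>\<^sup>+y. ?I \<tau> y s z \<partial>lborel \<partial>lborel) =
        (\<integral>\<^sup>+\<tau>. \<integral>\<^sup>+y. K (t - s - \<tau>, x - z - y) * L (\<tau>, y) * g (s, z) \<partial>lborel \<partial>lborel)" .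
  qed
  also have "\<dots> = st_conv (st_conv K L) g (t, x)"
    unfolding st_conv_def by (simp add: nn_integral_multc)
  finally show "st_conv K (st_conv L g) (t, x) = st_conv (st_conv K L) g (t, x)" .
qed

text \<open>The coordinates are \<open>\<alpha> = \<tau> - y\<close> and \<open>\<beta> = \<tau> + y\<close>. In them the intersection of a forward and a
  backward light cone is a rectangle and \<open>\<tau>\<^sup>2 - y\<^sup>2\<close> becomes the product \<open>\<alpha> * \<beta>\<close>.\<close>

lemma nn_integral_light_cone:
  fixes g :: "real \<times> real \<Rightarrow> ennreal"
  assumes [measurable]: "g \<in> borel_measurable borel"
  shows "(\<integral>\<^sup>+\<tau>. \<integral>\<^sup>+y. g (\<tau>, y) \<partial>lborel \<partial>lborel) =
    (\<integral>\<^sup>+\<alpha>. \<integral>\<^sup>+\<beta>. ennreal (1/2) * g ((\<alpha> + \<beta>) / 2, (\<beta> - \<alpha>) / 2) \<partial>lborel \<partial>lborel)"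
proof -
  have "(\<integral>\<^sup>+\<tau>. \<integral>\<^sup>+y. g (\<tau>, y) \<partial>lborel \<partial>lborel) = (\<integral>\<^sup>+\<tau>. \<integral>\<^sup>+\<alpha>. g (\<tau>, \<tau> - \<alpha>) \<partial>lborel \<partial>lborel)"
  proof (rule nn_integral_cong)
    fix \<tau>
    show "(\<integral>\<^sup>+y. g (\<tau>, y) \<partial>lborel) = (\<integral>\<^sup>+\<alpha>. g (\<tau>, \<tau> - \<alpha>) \<partial>lborel)"
      using nn_integral_real_affine[of "\<lambda>y. g (\<tau>, y)" "-1" \<tau>] by simp
  qed
  also have "\<dots> = (\<integral>\<^sup>+\<alpha>. \<integral>\<^sup>+\<tau>. g (\<tau>, \<tau> - \<alpha>) \<partial>lborel \<partial>lborel)"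
    by (intro nn_integral_swap) (unfold borel_prod[symmetric], measurable)
  also have "\<dots> = (\<integral>\<^sup>+\<alpha>. \<integral>\<^sup>+\<beta>. ennreal (1/2) * g ((\<alpha> + \<beta>) / 2, (\<beta> - \<alpha>) / 2) \<partial>lborel \<partial>lborel)"
  proof (rule nn_integral_cong)
    fix \<alpha>
    have "\<alpha> / 2 + 1 / 2 * \<beta> = (\<alpha> + \<beta>) / 2" "\<alpha> / 2 + 1 / 2 * \<beta> - \<alpha> = (\<beta> - \<alpha>) / 2" for \<beta> :: real by (simp_all add: field_simps)
    then show "(\<integral>\<^sup>+\<tau>. g (\<tau>, \<tau> - \<alpha>) \<partial>lborel) = (\<integral>\<^sup>+\<beta>. ennreal (1/2) * g ((\<alpha> + \<beta>) / 2, (\<beta> - \<alpha>) / 2) \<partial>lborel)"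
      using nn_integral_real_affine[of "\<lambda>\<tau>. g (\<tau>, \<tau> - \<alpha>)" "1/2" "\<alpha> / 2"]
      by (simp add: nn_integral_cmult add_divide_distrib diff_divide_distrib)
  qed
  finally show ?thesis .
qed

text \<open>The d'Alembert kernel, the fundamental solution of \<open>v\<^sub>t\<^sub>t - v\<^sub>x\<^sub>x = 0\<close>.\<close>

definition wave_kernel :: "real \<times> real \<Rightarrow> real" where
  "wave_kernel = (\<lambda>(t, x). if \<bar>x\<bar> \<le> t then 1 / 2 else 0)"

text \<open>The kernel of \<open>exp (t / 2) * S t\<close>. It is the fundamental solution of \<open>v\<^sub>t\<^sub>t - v\<^sub>x\<^sub>x = v / 4\<close>, a
  Klein--Gordon equation with imaginary mass.\<close>

definition kg_kernel :: "real \<times> real \<Rightarrow> real" where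
  "kg_kernel = (\<lambda>(t, x). if \<bar>x\<bar> \<le> t then bessel_clifford 0 ((t\<^sup>2 - x\<^sup>2) / 16) / 2 else 0)"

text \<open>The time derivative of \<open>kg_kernel\<close> in the interior of the light cone.\<close>

definition kg_kernel_dt :: "real \<times> real \<Rightarrow> real" where
  "kg_kernel_dt = (\<lambda>(t, x). if \<bar>x\<bar> \<le> t then t / 16 * bessel_clifford 1 ((t\<^sup>2 - x\<^sup>2) / 16) else 0)"

abbreviation "enn f \<equiv> \<lambda>x. ennreal (f x)"
abbreviation "wave_K \<equiv> \<lambda>p. ennreal (wave_kernel p)"
abbreviation "kg_K \<equiv> \<lambda>p. ennreal (kg_kernel p)"
abbreviation "kg_dt_K \<equiv> \<lambda>p. ennreal (kg_kernel_dt p)"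

text \<open>The contribution to the time derivative of \<open>exp (t / 2) * S t f\<close> that comes from the moving end
  points; it is the free wave with initial position \<open>f\<close> and initial velocity 0.\<close>

definition sphere_mean :: "(real \<Rightarrow> ennreal) \<Rightarrow> real \<times> real \<Rightarrow> ennreal" where
  "sphere_mean f = (\<lambda>(t, x). if 0 \<le> t then ennreal (1/2) * (f (x + t) + f (x - t)) else 0)"

lemma borel_measurable_kernels [measurable]:
  "wave_kernel \<in> borel_measurable borel" "kg_kernel \<in> borel_measurable borel" "kg_kernel_dt \<in> borel_measurable borel"
  unfolding wave_kernel_def kg_kernel_def kg_kernel_dt_def borel_prod[symmetric] by measurable

lemma borel_measurable_sphere_mean [measurable]:
  assumes [measurable]: "f \<in> borel_measurable borel" shows "sphere_mean f \<in> borel_measurable borel"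
  unfolding sphere_mean_def borel_prod[symmetric] by measurable

lemma cone_nonneg: "\<bar>x\<bar> \<le> t \<Longrightarrow> 0 \<le> t\<^sup>2 - (x::real)\<^sup>2"
  by (simp add: abs_le_square_iff[symmetric])

lemma kernel_nonneg [simp]: "0 \<le> wave_kernel p" "0 \<le> kg_kernel p" "0 \<le> kg_kernel_dt p"
  using cone_nonneg[of "snd p" "fst p"]
  by (auto simp: wave_kernel_def kg_kernel_def kg_kernel_dt_def case_prod_beta intro!: mult_nonneg_nonneg bessel_clifford_nonneg)

lemma cone_coordinates:
  "\<bar>(\<beta> - \<alpha>) / 2\<bar> \<le> (\<alpha> + \<beta>) / 2 \<longleftrightarrow> 0 \<le> \<alpha> \<and> 0 \<le> (\<beta>::real)"
  "\<bar>x - (\<beta> - \<alpha>) / 2\<bar> \<le> t - (\<alpha> + \<beta>) / 2 \<longleftrightarrow> \<alpha> \<le> t - x \<and> \<beta> \<le> t + x"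
  "((\<alpha> + \<beta>) / 2)\<^sup>2 - ((\<beta> - \<alpha>) / 2)\<^sup>2 = \<alpha> * \<beta>"
  by (auto simp: abs_if field_simps power2_eq_square split: if_splits)

text \<open>The antiderivative \<open>\<beta> * bessel_clifford 1 (\<alpha> * \<beta> / 16)\<close> comes from the three-term recurrence.\<close>

lemma nn_integral_bessel_clifford_0:
  assumes "0 \<le> \<alpha>" "0 \<le> b"
  shows "(\<integral>\<^sup>+\<beta>. ennreal (bessel_clifford 0 (\<alpha> * \<beta> / 16)) * indicator {0..b} \<beta> \<partial>lborel)
    = ennreal (b * bessel_clifford 1 (\<alpha> * b / 16))"
proof -
  have "(\<integral>\<^sup>+\<beta>. ennreal (bessel_clifford 0 (\<alpha> * \<beta> / 16)) * indicator {0..b} \<beta> \<partial>lborel)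
    = ennreal (b * bessel_clifford 1 (\<alpha> * b / 16) - 0 * bessel_clifford 1 (\<alpha> * 0 / 16))"
  proof (rule nn_integral_FTC_Icc)
    show "((\<lambda>\<beta>. \<beta> * bessel_clifford 1 (\<alpha> * \<beta> / 16)) has_real_derivative bessel_clifford 0 (\<alpha> * \<beta> / 16)) (at \<beta>)" for \<beta>
      by (auto intro!: derivative_eq_intros simp: bessel_clifford_recurrence numeral_2_eq_2)
    show "0 \<le> bessel_clifford 0 (\<alpha> * \<beta> / 16)" if "\<beta> \<in> {0..b}" for \<beta>
      using assms that by (intro bessel_clifford_nonneg) auto
  qed (use assms in auto)
  then show ?thesis by simp
qed

lemma nn_integral_bessel_clifford_1:
  assumes "0 \<le> \<alpha>" "0 \<le> b"
  shows "(\<integral>\<^sup>+\<beta>. ennreal (\<alpha> / 16 * bessel_clifford 1 (\<alpha> * \<beta> / 16)) * indicator {0..b} \<beta> \<partial>lborel)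
    = ennreal (bessel_clifford 0 (\<alpha> * b / 16) - 1)"
proof -
  have "(\<integral>\<^sup>+\<beta>. ennreal (\<alpha> / 16 * bessel_clifford 1 (\<alpha> * \<beta> / 16)) * indicator {0..b} \<beta> \<partial>lborel)
    = ennreal (bessel_clifford 0 (\<alpha> * b / 16) - bessel_clifford 0 (\<alpha> * 0 / 16))"
  proof (rule nn_integral_FTC_Icc)
    show "((\<lambda>\<beta>. bessel_clifford 0 (\<alpha> * \<beta> / 16)) has_real_derivative \<alpha> / 16 * bessel_clifford 1 (\<alpha> * \<beta> / 16)) (at \<beta>)" for \<beta>
      by (auto intro!: derivative_eq_intros)
    show "0 \<le> \<alpha> / 16 * bessel_clifford 1 (\<alpha> * \<beta> / 16)" if "\<beta> \<in> {0..b}" for \<beta>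
      using assms that by (intro mult_nonneg_nonneg bessel_clifford_nonneg) auto
  qed (use assms in auto)
  then show ?thesis by simp
qed

section \<open>Convolutions with the d'Alembert kernel\<close>

text \<open>The space-time convolution of the d'Alembert kernel with half the Dirac masses on the two rays that
  bound the light cone, see \<open>st_conv_wave_sphere_mean\<close>.\<close>

definition ramp_kernel :: "real \<times> real \<Rightarrow> real" where
  "ramp_kernel = (\<lambda>(t, x). if \<bar>x\<bar> \<le> t then t / 4 else 0)"

lemma borel_measurable_ramp_kernel [measurable]: "ramp_kernel \<in> borel_measurable borel"
  unfolding ramp_kernel_def borel_prod[symmetric] by measurable

lemma ramp_kernel_nonneg [simp]: "0 \<le> ramp_kernel p"
  by (auto simp: ramp_kernel_def case_prod_beta)

text \<open>Duhamel's formula for \<open>kg_kernel\<close>, with \<open>v / 4\<close> treated as a source of the free wave equation. In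
  light-cone coordinates the left-hand side is a double integral of \<open>bessel_clifford 0 (\<alpha> * \<beta> / 16)\<close>
  over a rectangle.\<close>

lemma st_conv_wave_kg:
  "st_conv wave_K kg_K p + 4 * ennreal (wave_kernel p)
    = 4 * ennreal (kg_kernel p)"
proof (cases p)
  case (Pair t x)
  let ?c = "bessel_clifford 0 ((t\<^sup>2 - x\<^sup>2) / 16)"
  have "st_conv wave_K kg_K (t, x) =
     (\<integral>\<^sup>+\<alpha>. \<integral>\<^sup>+\<beta>. ennreal (1/2) * (ennreal (wave_kernel (t - (\<alpha> + \<beta>) / 2, x - (\<beta> - \<alpha>) / 2)) *
        ennreal (kg_kernel ((\<alpha> + \<beta>) / 2, (\<beta> - \<alpha>) / 2))) \<partial>lborel \<partial>lborel)" (is "?L = _")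
    unfolding st_conv_def
    by (simp add: nn_integral_light_cone[of "\<lambda>p. ennreal (wave_kernel (t - fst p, x - snd p)) * ennreal (kg_kernel p)", simplified])
  also have "\<dots> = (\<integral>\<^sup>+\<alpha>. \<integral>\<^sup>+\<beta>. ennreal (1/8) * indicator {0..t - x} \<alpha> *
      (ennreal (bessel_clifford 0 (\<alpha> * \<beta> / 16)) * indicator {0..t + x} \<beta>) \<partial>lborel \<partial>lborel)"
    by (intro nn_integral_cong)
       (auto simp: wave_kernel_def kg_kernel_def cone_coordinates ennreal_mult'[symmetric] split: split_indicator)
  also have "\<dots> = (\<integral>\<^sup>+\<alpha>. ennreal (1/8) * indicator {0..t - x} \<alpha> *
      (\<integral>\<^sup>+\<beta>. ennreal (bessel_clifford 0 (\<alpha> * \<beta> / 16)) * indicator {0..t + x} \<beta> \<partial>lborel) \<partial>lborel)"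
    by (simp add: nn_integral_cmult)
  finally have L: "?L = \<dots>" .
  show ?thesis
  proof (cases "\<bar>x\<bar> \<le> t")
    case True
    then have ab: "0 \<le> t - x" "0 \<le> t + x" "(t + x) * (t - x) = t\<^sup>2 - x\<^sup>2"
      by (auto simp: power2_eq_square algebra_simps)
    have "?L = (\<integral>\<^sup>+\<alpha>. ennreal 2 * (ennreal ((t + x) / 16 * bessel_clifford 1 ((t + x) * \<alpha> / 16)) * indicator {0..t - x} \<alpha>) \<partial>lborel)"
      unfolding L
    proof (rule nn_integral_cong)
      fix \<alpha> :: real
      have "ennreal (1/8) * ennreal ((t + x) * c) = ennreal 2 * ennreal ((t + x) / 16 * c)" for c
        by (subst (1 2) ennreal_mult'[symmetric]) (auto simp: mult.commute[of c])
      then show "ennreal (1/8) * indicator {0..t - x} \<alpha> *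
          (\<integral>\<^sup>+\<beta>. ennreal (bessel_clifford 0 (\<alpha> * \<beta> / 16)) * indicator {0..t + x} \<beta> \<partial>lborel)
        = ennreal 2 * (ennreal ((t + x) / 16 * bessel_clifford 1 ((t + x) * \<alpha> / 16)) * indicator {0..t - x} \<alpha>)"
        using ab nn_integral_bessel_clifford_0[of \<alpha> "t + x"]
        by (cases "\<alpha> \<in> {0..t - x}") (auto simp: mult.commute[of \<alpha> "t + x"])
    qed
    also have "\<dots> = ennreal 2 * ennreal (?c - 1)"
      using nn_integral_bessel_clifford_1[OF ab(2,1)] by (simp add: nn_integral_cmult ab)
    also have "\<dots> = ennreal (2 * (?c - 1))"
      by (rule ennreal_mult'[symmetric]) simp
    finally have "?L = ennreal (2 * (?c - 1))" .
    moreover have "1 \<le> ?c"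
      using True cone_nonneg bessel_clifford_ge_1 by simp
    then have "ennreal (2 * (?c - 1)) + ennreal (4 * (1/2))
        = ennreal (4 * (?c / 2))"
      by (subst ennreal_plus[symmetric]) auto
    moreover have "4 * ennreal r = ennreal (4 * r)" for r by (simp add: ennreal_mult')
    moreover have "wave_kernel (t, x) = 1/2" "kg_kernel (t, x) = ?c / 2"
      using True by (simp_all add: wave_kernel_def kg_kernel_def)
    ultimately show ?thesis unfolding Pair by (simp only:)
  next
    case False
    then have "t - x < 0 \<or> t + x < 0" by auto
    then have "?L = 0"
      unfolding L by auto
    with False show ?thesis unfolding Pair by (simp add: wave_kernel_def kg_kernel_def)
  qed
qed

lemma nn_integral_bessel_clifford_0_minus_1:
  assumes "0 \<le> \<alpha>" "0 \<le> b"
  shows "(\<integral>\<^sup>+\<beta>. ennreal (bessel_clifford 0 (\<alpha> * \<beta> / 16) - 1) * indicator {0..b} \<beta> \<partial>lborel)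
    = ennreal (b * (bessel_clifford 1 (\<alpha> * b / 16) - 1))"
proof -
  have "(\<integral>\<^sup>+\<beta>. ennreal (bessel_clifford 0 (\<alpha> * \<beta> / 16) - 1) * indicator {0..b} \<beta> \<partial>lborel)
    = ennreal (b * (bessel_clifford 1 (\<alpha> * b / 16) - 1) - 0 * (bessel_clifford 1 (\<alpha> * 0 / 16) - 1))"
  proof (rule nn_integral_FTC_Icc)
    show "((\<lambda>\<beta>. \<beta> * (bessel_clifford 1 (\<alpha> * \<beta> / 16) - 1)) has_real_derivative bessel_clifford 0 (\<alpha> * \<beta> / 16) - 1) (at \<beta>)" for \<beta>
      by (auto intro!: derivative_eq_intros simp: bessel_clifford_recurrence numeral_2_eq_2 algebra_simps)
    show "0 \<le> bessel_clifford 0 (\<alpha> * \<beta> / 16) - 1" if "\<beta> \<in> {0..b}" for \<beta>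
      using assms that bessel_clifford_ge_1[of "\<alpha> * \<beta> / 16"] by auto
  qed (use assms in auto)
  then show ?thesis by simp
qed

text \<open>The time derivative of the preceding identity. The factor \<open>\<tau> = (\<alpha> + \<beta>) / 2\<close> in \<open>kg_kernel_dt\<close>
  splits the double integral into two parts \<open>h\<close>, mirror images of each other. Each has explicit
  antiderivatives if the variable that is not the prefactor is integrated first.\<close>

lemma st_conv_wave_kg_dt:
  "st_conv wave_K kg_dt_K p + ennreal (ramp_kernel p)
    = 4 * ennreal (kg_kernel_dt p)"
proof (cases p)
  case (Pair t x)
  let ?c = "bessel_clifford 1 ((t\<^sup>2 - x\<^sup>2) / 16)"
  define h where "h = (\<lambda>a b \<alpha> \<beta>::real. ennreal (1/8) * indicator {0..a} \<alpha> *
      (ennreal (\<alpha> / 16 * bessel_clifford 1 (\<alpha> * \<beta> / 16)) * indicator {0..b} \<beta>))"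
  have [measurable]: "(\<lambda>p. h a b (f p) (g p)) \<in> borel_measurable N"
    if [measurable]: "f \<in> borel_measurable N" "g \<in> borel_measurable N" for a b f g and N :: "'x measure"
    unfolding h_def by measurable
  have H: "(\<integral>\<^sup>+\<alpha>. \<integral>\<^sup>+\<beta>. h a b \<alpha> \<beta> \<partial>lborel \<partial>lborel) = ennreal (1/8 * (a * (bessel_clifford 1 (a * b / 16) - 1)))"
    if "0 \<le> a" "0 \<le> b" for a b
  proof -
    have "(\<integral>\<^sup>+\<alpha>. \<integral>\<^sup>+\<beta>. h a b \<alpha> \<beta> \<partial>lborel \<partial>lborel) =
      (\<integral>\<^sup>+\<alpha>. ennreal (1/8) * (ennreal (bessel_clifford 0 (b * \<alpha> / 16) - 1) * indicator {0..a} \<alpha>) \<partial>lborel)"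
      unfolding h_def using that
      by (intro nn_integral_cong)
         (auto simp: nn_integral_cmult nn_integral_bessel_clifford_1 mult.commute[of b] simp del: One_nat_def times_divide_eq_left split: split_indicator)
    also have "\<dots> = ennreal (1/8) * ennreal (a * (bessel_clifford 1 (b * a / 16) - 1))"
      using that by (simp add: nn_integral_cmult nn_integral_bessel_clifford_0_minus_1)
    also have "\<dots> = ennreal (1/8 * (a * (bessel_clifford 1 (a * b / 16) - 1)))"
      by (simp add: ennreal_mult'[symmetric] mult.commute[of b])
    finally show ?thesis .
  qed
  have "st_conv wave_K kg_dt_K (t, x) =
     (\<integral>\<^sup>+\<alpha>. \<integral>\<^sup>+\<beta>. ennreal (1/2) * (ennreal (wave_kernel (t - (\<alpha> + \<beta>) / 2, x - (\<beta> - \<alpha>) / 2)) *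
        ennreal (kg_kernel_dt ((\<alpha> + \<beta>) / 2, (\<beta> - \<alpha>) / 2))) \<partial>lborel \<partial>lborel)" (is "?L = _")
    unfolding st_conv_def
    by (simp add: nn_integral_light_cone[of "\<lambda>p. ennreal (wave_kernel (t - fst p, x - snd p)) * ennreal (kg_kernel_dt p)", simplified])
  also have "\<dots> = (\<integral>\<^sup>+\<alpha>. \<integral>\<^sup>+\<beta>. h (t - x) (t + x) \<alpha> \<beta> + h (t + x) (t - x) \<beta> \<alpha> \<partial>lborel \<partial>lborel)"
  proof (intro nn_integral_cong)
    fix \<alpha> \<beta> :: real
    show "ennreal (1/2) * (ennreal (wave_kernel (t - (\<alpha> + \<beta>) / 2, x - (\<beta> - \<alpha>) / 2)) *
        ennreal (kg_kernel_dt ((\<alpha> + \<beta>) / 2, (\<beta> - \<alpha>) / 2))) = h (t - x) (t + x) \<alpha> \<beta> + h (t + x) (t - x) \<beta> \<alpha>"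
    proof (cases "\<alpha> \<in> {0..t - x} \<and> \<beta> \<in> {0..t + x}")
      case True
      then have "0 \<le> bessel_clifford 1 (\<alpha> * \<beta> / 16)" by (intro bessel_clifford_nonneg) auto
      then have "ennreal (1/2) * (ennreal (1/2) * ennreal ((\<alpha> + \<beta>) / 2 / 16 * bessel_clifford 1 (\<alpha> * \<beta> / 16))) =
          ennreal (1/8) * ennreal (\<alpha> / 16 * bessel_clifford 1 (\<alpha> * \<beta> / 16)) +
          ennreal (1/8) * ennreal (\<beta> / 16 * bessel_clifford 1 (\<alpha> * \<beta> / 16))"
        using True by (simp add: ennreal_mult'[symmetric] ennreal_plus[symmetric] field_simps del: ennreal_plus)
      with True show ?thesis
        unfolding h_def wave_kernel_def kg_kernel_dt_def prod.case cone_coordinates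
        by (simp add: mult.commute[of \<beta> \<alpha>])
    next
      case False
      then show ?thesis
        by (auto simp: h_def wave_kernel_def kg_kernel_dt_def cone_coordinates)
    qed
  qed
  also have "\<dots> = (\<integral>\<^sup>+\<alpha>. \<integral>\<^sup>+\<beta>. h (t - x) (t + x) \<alpha> \<beta> \<partial>lborel \<partial>lborel) + (\<integral>\<^sup>+\<alpha>. \<integral>\<^sup>+\<beta>. h (t + x) (t - x) \<beta> \<alpha> \<partial>lborel \<partial>lborel)"
    by (simp add: nn_integral_add)
  also have "(\<integral>\<^sup>+\<alpha>. \<integral>\<^sup>+\<beta>. h (t + x) (t - x) \<beta> \<alpha> \<partial>lborel \<partial>lborel) = (\<integral>\<^sup>+\<beta>. \<integral>\<^sup>+\<alpha>. h (t + x) (t - x) \<beta> \<alpha> \<partial>lborel \<partial>lborel)"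
    by (intro nn_integral_swap) (unfold borel_prod[symmetric], measurable)
  finally have L: "?L = (\<integral>\<^sup>+\<alpha>. \<integral>\<^sup>+\<beta>. h (t - x) (t + x) \<alpha> \<beta> \<partial>lborel \<partial>lborel) + (\<integral>\<^sup>+\<beta>. \<integral>\<^sup>+\<alpha>. h (t + x) (t - x) \<beta> \<alpha> \<partial>lborel \<partial>lborel)" .
  show ?thesis
  proof (cases "\<bar>x\<bar> \<le> t")
    case True
    then have ab: "0 \<le> t - x" "0 \<le> t + x" "(t + x) * (t - x) = t\<^sup>2 - x\<^sup>2" "(t - x) * (t + x) = t\<^sup>2 - x\<^sup>2"
      by (auto simp: power2_eq_square algebra_simps)
    have C: "1 \<le> ?c"
      using True cone_nonneg bessel_clifford_mono[of 0 "(t\<^sup>2 - x\<^sup>2) / 16" 1] by simp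
    have "?L = ennreal (t / 4 * (?c - 1))"
    proof -
      have "?L = ennreal (1/8 * ((t - x) * (?c - 1))) + ennreal (1/8 * ((t + x) * (?c - 1)))"
        unfolding L H[OF ab(1,2)] H[OF ab(2,1)] ab ..
      also have "\<dots> = ennreal (1/8 * ((t - x) * (?c - 1)) + 1/8 * ((t + x) * (?c - 1)))"
        using ab C by (intro ennreal_plus[symmetric] mult_nonneg_nonneg) auto
      also have "1/8 * ((t - x) * (?c - 1)) + 1/8 * ((t + x) * (?c - 1)) = t / 4 * (?c - 1)"
        by (simp add: field_simps)
      finally show ?thesis .
    qed
    moreover have "ennreal (t / 4 * (?c - 1)) + ennreal (t / 4)
        = ennreal (4 * (t / 16 * ?c))"
      using True C mult_left_mono[OF C, of t] by (subst ennreal_plus[symmetric]) (auto simp: right_diff_distrib)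
    moreover have "4 * ennreal r = ennreal (4 * r)" for r by (simp add: ennreal_mult')
    moreover have "ramp_kernel (t, x) = t / 4" "kg_kernel_dt (t, x) = t / 16 * ?c"
      using True by (simp_all add: ramp_kernel_def kg_kernel_dt_def)
    ultimately show ?thesis unfolding Pair by (simp only:)
  next
    case False
    then have "t - x < 0 \<or> t + x < 0" by auto
    then have "?L = 0"
      unfolding L h_def by auto
    with False show ?thesis unfolding Pair by (simp add: ramp_kernel_def kg_kernel_dt_def)
  qed
qed

text \<open>Half the time that a light ray emitted at time 0 spends in a backward light cone.\<close>

lemma nn_integral_wave_kernel_ray:
  assumes "\<bar>c\<bar> = 1"
  shows "(\<integral>\<^sup>+\<tau>. indicator {0..} \<tau> * ennreal (wave_kernel (t - \<tau>, x + c * \<tau>)) \<partial>lborel) =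
    (if \<bar>x\<bar> \<le> t then ennreal ((t - c * x) / 4) else 0)"
proof -
  have c: "c = 1 \<or> c = -1" using assms by auto
  have *: "indicator {0..} \<tau> * ennreal (wave_kernel (t - \<tau>, x + c * \<tau>)) =
     (if \<bar>x\<bar> \<le> t then ennreal (1/2) * indicator {0..(t - c * x) / 2} \<tau> else 0)" for \<tau>
    using c by (elim disjE) (auto simp: wave_kernel_def abs_le_iff field_simps split: split_indicator)
  show ?thesis
  proof (cases "\<bar>x\<bar> \<le> t")
    case True
    then have "0 \<le> (t - c * x) / 2" using c by auto
    then show ?thesis unfolding * using True
      by (simp add: nn_integral_cmult ennreal_mult'[symmetric])
  qed (simp add: *)
qed

lemma st_conv_wave_sphere_mean:
  assumes [measurable]: "f \<in> borel_measurable borel"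
  shows "st_conv wave_K (sphere_mean f) = sp_conv (\<lambda>p. ennreal (ramp_kernel p)) f"
proof (rule ext, clarify)
  fix t x
  let ?w = "\<lambda>t x. ennreal (wave_kernel (t, x))"
  let ?g = "\<lambda>\<tau> z. ennreal (1/2) * indicator {0..} \<tau> * (?w (t - \<tau>) (x - z + 1 * \<tau>) + ?w (t - \<tau>) (x - z + (-1) * \<tau>)) * f z"
  have "st_conv wave_K (sphere_mean f) (t, x) =
    (\<integral>\<^sup>+\<tau>. \<integral>\<^sup>+z. ?g \<tau> z \<partial>lborel \<partial>lborel)"
    unfolding st_conv_def prod.case
  proof (rule nn_integral_cong)
    fix \<tau> :: real
    have "(\<integral>\<^sup>+y. ?w (t - \<tau>) (x - y) * sphere_mean f (\<tau>, y) \<partial>lborel) =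
       (\<integral>\<^sup>+y. ennreal (1/2) * indicator {0..} \<tau> * (?w (t - \<tau>) (x - y) * f (y + \<tau>)) +
           ennreal (1/2) * indicator {0..} \<tau> * (?w (t - \<tau>) (x - y) * f (y - \<tau>)) \<partial>lborel)"
      by (intro nn_integral_cong) (auto simp: sphere_mean_def algebra_simps)
    also have "\<dots> = ennreal (1/2) * indicator {0..} \<tau> * (\<integral>\<^sup>+y. ?w (t - \<tau>) (x - y) * f (y + \<tau>) \<partial>lborel) +
           ennreal (1/2) * indicator {0..} \<tau> * (\<integral>\<^sup>+y. ?w (t - \<tau>) (x - y) * f (y - \<tau>) \<partial>lborel)"
      by (simp add: nn_integral_add nn_integral_cmult)
    also have "(\<integral>\<^sup>+y. ?w (t - \<tau>) (x - y) * f (y + \<tau>) \<partial>lborel) = (\<integral>\<^sup>+z. ?w (t - \<tau>) (x - z + \<tau>) * f z \<partial>lborel)"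
      using nn_integral_shift[of "\<lambda>z. ?w (t - \<tau>) (x - z + \<tau>) * f z" "- \<tau>"] by simp
    also have "(\<integral>\<^sup>+y. ?w (t - \<tau>) (x - y) * f (y - \<tau>) \<partial>lborel) = (\<integral>\<^sup>+z. ?w (t - \<tau>) (x - z - \<tau>) * f z \<partial>lborel)"
      using nn_integral_shift[of "\<lambda>z. ?w (t - \<tau>) (x - z - \<tau>) * f z" "\<tau>"] by simp
    finally show "(\<integral>\<^sup>+y. ?w (t - \<tau>) (x - y) * sphere_mean f (\<tau>, y) \<partial>lborel) =
      (\<integral>\<^sup>+z. ?g \<tau> z \<partial>lborel)"
      by (simp add: nn_integral_add nn_integral_cmult distrib_left distrib_right mult.assoc)
  qed
  also have "\<dots> = (\<integral>\<^sup>+z. \<integral>\<^sup>+\<tau>. ?g \<tau> z \<partial>lborel \<partial>lborel)"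
    by (intro nn_integral_swap) (unfold borel_prod[symmetric], measurable)
  also have "\<dots> = (\<integral>\<^sup>+z. ennreal (ramp_kernel (t, x - z)) * f z \<partial>lborel)"
  proof (rule nn_integral_cong)
    fix z :: real
    have "(\<integral>\<^sup>+\<tau>. ?g \<tau> z \<partial>lborel)
      = ennreal (1/2) * ((\<integral>\<^sup>+\<tau>. indicator {0..} \<tau> * ?w (t - \<tau>) (x - z + 1 * \<tau>) \<partial>lborel) +
          (\<integral>\<^sup>+\<tau>. indicator {0..} \<tau> * ?w (t - \<tau>) (x - z + (-1) * \<tau>) \<partial>lborel)) * f z"
      by (simp add: nn_integral_add[symmetric] nn_integral_cmult[symmetric] nn_integral_multc[symmetric] distrib_left mult.assoc
            del: mult_1_left mult_minus_left)
    also have "ennreal (1/2) * ((\<integral>\<^sup>+\<tau>. indicator {0..} \<tau> * ?w (t - \<tau>) (x - z + 1 * \<tau>) \<partial>lborel) +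
          (\<integral>\<^sup>+\<tau>. indicator {0..} \<tau> * ?w (t - \<tau>) (x - z + (-1) * \<tau>) \<partial>lborel)) = ennreal (ramp_kernel (t, x - z))"
    proof (cases "\<bar>x - z\<bar> \<le> t")
      case True
      then have "ennreal ((t - 1 * (x - z)) / 4) + ennreal ((t - (-1) * (x - z)) / 4) = ennreal (t / 2)"
        by (subst ennreal_plus[symmetric]) (auto simp: field_simps)
      then show ?thesis
        using True nn_integral_wave_kernel_ray[of 1 t "x - z"] nn_integral_wave_kernel_ray[of "-1" t "x - z"]
        by (simp add: ramp_kernel_def ennreal_mult'[symmetric])
    next
      case False
      then show ?thesis
        using nn_integral_wave_kernel_ray[of 1 t "x - z"] nn_integral_wave_kernel_ray[of "-1" t "x - z"]
        by (simp add: ramp_kernel_def)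
    qed
    finally show "(\<integral>\<^sup>+\<tau>. ?g \<tau> z \<partial>lborel)
      = ennreal (ramp_kernel (t, x - z)) * f z" .
  qed
  finally show "st_conv wave_K (sphere_mean f) (t, x) = sp_conv (\<lambda>p. ennreal (ramp_kernel p)) f (t, x)"
    by (simp add: sp_conv_def)
qed

section \<open>From the Bessel kernel to the d'Alembert kernel\<close>

lemma st_conv_add_right:
  assumes [measurable]: "K \<in> borel_measurable borel" "g \<in> borel_measurable borel" "h \<in> borel_measurable borel"
  shows "st_conv K (\<lambda>p. g p + h p) p = st_conv K g p + st_conv K h p"
  unfolding st_conv_def by (cases p) (simp add: distrib_left nn_integral_add)

lemma st_conv_add_left:
  assumes [measurable]: "K \<in> borel_measurable borel" "g \<in> borel_measurable borel" "L \<in> borel_measurable borel"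
  shows "st_conv (\<lambda>p. K p + L p) g p = st_conv K g p + st_conv L g p"
  unfolding st_conv_def by (cases p) (simp add: distrib_right nn_integral_add)

lemma st_conv_cmult_left:
  assumes [measurable]: "K \<in> borel_measurable borel" "g \<in> borel_measurable borel"
  shows "st_conv (\<lambda>p. c * K p) g p = c * st_conv K g p"
  unfolding st_conv_def by (cases p) (simp add: mult.assoc nn_integral_cmult)

lemma sp_conv_add_left:
  assumes [measurable]: "K \<in> borel_measurable borel" "f \<in> borel_measurable borel" "L \<in> borel_measurable borel"
  shows "sp_conv (\<lambda>p. K p + L p) f p = sp_conv K f p + sp_conv L f p"
  unfolding sp_conv_def by (cases p) (simp add: distrib_right nn_integral_add)

lemma sp_conv_cmult_left:
  assumes [measurable]: "K \<in> borel_measurable borel" "f \<in> borel_measurable borel"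
  shows "sp_conv (\<lambda>p. c * K p) f p = c * sp_conv K f p"
  unfolding sp_conv_def by (cases p) (simp add: mult.assoc nn_integral_cmult)

lemma st_conv_cong_AE:
  assumes "AE \<tau> in lborel. AE y in lborel. g (\<tau>, y) = h (\<tau>, y)"
  shows "st_conv K g p = st_conv K h p"
proof -
  have "(\<integral>\<^sup>+\<tau>. \<integral>\<^sup>+y. K (t - \<tau>, x - y) * g (\<tau>, y) \<partial>lborel \<partial>lborel) =
      (\<integral>\<^sup>+\<tau>. \<integral>\<^sup>+y. K (t - \<tau>, x - y) * h (\<tau>, y) \<partial>lborel \<partial>lborel)" for t x
  proof (rule nn_integral_cong_AE)
    show "AE \<tau> in lborel. (\<integral>\<^sup>+y. K (t - \<tau>, x - y) * g (\<tau>, y) \<partial>lborel) = (\<integral>\<^sup>+y. K (t - \<tau>, x - y) * h (\<tau>, y) \<partial>lborel)"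
      using assms
    proof eventually_elim
      case (elim \<tau>)
      then show ?case by (intro nn_integral_cong_AE) (auto elim: eventually_mono)
    qed
  qed
  then show ?thesis unfolding st_conv_def by (cases p) simp
qed

lemma st_conv_mono_AE:
  assumes "AE \<tau> in lborel. AE y in lborel. g (\<tau>, y) \<le> h (\<tau>, y)"
  shows "st_conv K g p \<le> st_conv K h p"
proof -
  have "(\<integral>\<^sup>+\<tau>. \<integral>\<^sup>+y. K (t - \<tau>, x - y) * g (\<tau>, y) \<partial>lborel \<partial>lborel) \<le>
      (\<integral>\<^sup>+\<tau>. \<integral>\<^sup>+y. K (t - \<tau>, x - y) * h (\<tau>, y) \<partial>lborel \<partial>lborel)" for t x
  proof (rule nn_integral_mono_AE)
    show "AE \<tau> in lborel. (\<integral>\<^sup>+y. K (t - \<tau>, x - y) * g (\<tau>, y) \<partial>lborel) \<le> (\<integral>\<^sup>+y. K (t - \<tau>, x - y) * h (\<tau>, y) \<partial>lborel)"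
      using assms
    proof eventually_elim
      case (elim \<tau>)
      then show ?case by (intro nn_integral_mono_AE) (auto elim!: eventually_mono intro: mult_left_mono)
    qed
  qed
  then show ?thesis unfolding st_conv_def by (cases p) simp
qed

text \<open>The linear algebra of \<open>wave_form_of_kg_form\<close>. The three terms that are finite by assumption force all
  others to be finite, so the subtraction can be done in the reals.\<close>

lemma ennreal_cancel_resolvent:
  fixes w A KKM KM WM WKV WV KV WQ R Q D :: ennreal
  assumes "A + KKM = WKV + WQ + R" "KKM + 4 * WM = 4 * KM" "WKV + 4 * WV = 4 * KV" "WQ + R = 4 * Q"
    "w + KM = KV + Q + D" and fin: "KV < \<infinity>" "Q < \<infinity>" "D < \<infinity>"
  shows "4 * w + 4 * WM = A + 4 * WV + 4 * D"
proof -
  have real: "\<exists>r. x = ennreal r \<and> 0 \<le> r" if "x \<noteq> \<infinity>" for x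
    using that by (cases x) auto
  have "KV \<noteq> \<infinity>" "Q \<noteq> \<infinity>" "D \<noteq> \<infinity>" using fin by auto
  from this[THEN real] obtain kv q d where kv: "KV = ennreal kv" "0 \<le> kv"
    and q: "Q = ennreal q" "0 \<le> q" and d: "D = ennreal d" "0 \<le> d" by blast
  note r1 = kv q d
  have "w + KM \<noteq> \<infinity>" "WKV + 4 * WV \<noteq> \<infinity>" "WQ + R \<noteq> \<infinity>"
    using assms r1 by (auto simp: ennreal_mult_eq_top_iff)
  then have "w \<noteq> \<infinity>" "KM \<noteq> \<infinity>" "WKV \<noteq> \<infinity>" "4 * WV \<noteq> \<infinity>" "WQ \<noteq> \<infinity>" "R \<noteq> \<infinity>"
    by auto
  moreover from this have "KKM + 4 * WM \<noteq> \<infinity>" "A + KKM \<noteq> \<infinity>" "WV \<noteq> \<infinity>"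
    using assms by (auto simp: ennreal_mult_eq_top_iff)
  moreover from this have "KKM \<noteq> \<infinity>" "WM \<noteq> \<infinity>" "A \<noteq> \<infinity>"
    by (auto simp: ennreal_mult_eq_top_iff)
  ultimately have ne: "w \<noteq> \<infinity>" "KM \<noteq> \<infinity>" "WKV \<noteq> \<infinity>" "WV \<noteq> \<infinity>" "WQ \<noteq> \<infinity>" "R \<noteq> \<infinity>" "KKM \<noteq> \<infinity>" "WM \<noteq> \<infinity>" "A \<noteq> \<infinity>"
    by blast+
  obtain w' where w': "w = ennreal w'" "0 \<le> w'" using real[OF ne(1)] by blast
  obtain km where km: "KM = ennreal km" "0 \<le> km" using real[OF ne(2)] by blast
  obtain wkv where wkv: "WKV = ennreal wkv" "0 \<le> wkv" using real[OF ne(3)] by blast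
  obtain wv where wv: "WV = ennreal wv" "0 \<le> wv" using real[OF ne(4)] by blast
  obtain wq where wq: "WQ = ennreal wq" "0 \<le> wq" using real[OF ne(5)] by blast
  obtain r where r: "R = ennreal r" "0 \<le> r" using real[OF ne(6)] by blast
  obtain kkm where kkm: "KKM = ennreal kkm" "0 \<le> kkm" using real[OF ne(7)] by blast
  obtain wm where wm: "WM = ennreal wm" "0 \<le> wm" using real[OF ne(8)] by blast
  obtain a where a: "A = ennreal a" "0 \<le> a" using real[OF ne(9)] by blast
  note r2 = w' km wkv wv wq r kkm wm a
  have f: "4 * ennreal x = ennreal (4 * x)" for x by (simp add: ennreal_mult')
  have "a + kkm = wkv + wq + r" "kkm + 4 * wm = 4 * km" "wkv + 4 * wv = 4 * kv" "wq + r = 4 * q" "w' + km = kv + q + d"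
    using assms(1-5) unfolding r1 r2 f using r1 r2
    by (simp_all add: ennreal_plus[symmetric] del: ennreal_plus)
  then have "4 * w' + 4 * wm = a + 4 * wv + 4 * d" by linarith
  then show ?thesis
    unfolding r1 r2 f using r1 r2 by (simp add: ennreal_plus[symmetric] del: ennreal_plus)
qed

text \<open>The linear equation \<open>v\<^sub>t\<^sub>t - v\<^sub>x\<^sub>x = v / 4 - M\<close> with initial position \<open>f\<close> and initial velocity \<open>V\<close> can
  be solved by Duhamel's formula with either \<open>- M\<close> or \<open>v / 4 - M\<close> as source. The first formula is the
  hypothesis, the second one the conclusion. The proof applies the convolution with \<open>wave_kernel\<close> to
  the first formula and rewrites every term by the kernel identities.\<close>

lemma wave_form_of_kg_form:
  fixes v M :: "real \<times> real \<Rightarrow> ennreal" and V f :: "real \<Rightarrow> ennreal" and p :: "real \<times> real"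
  assumes [measurable]: "v \<in> borel_measurable borel" "M \<in> borel_measurable borel"
      "V \<in> borel_measurable borel" "f \<in> borel_measurable borel"
    and eq: "AE \<tau> in lborel. AE y in lborel. v (\<tau>, y) + st_conv kg_K M (\<tau>, y) =
        sp_conv kg_K V (\<tau>, y) + sp_conv kg_dt_K f (\<tau>, y) + sphere_mean f (\<tau>, y)"
    and eqp: "w + st_conv kg_K M p = sp_conv kg_K V p + sp_conv kg_dt_K f p + sphere_mean f p"
    and fin: "sp_conv kg_K V p < \<infinity>" "sp_conv kg_dt_K f p < \<infinity>" "sphere_mean f p < \<infinity>"
  shows "4 * w + 4 * st_conv wave_K M p = st_conv wave_K v p + 4 * sp_conv wave_K V p + 4 * sphere_mean f p"
proof (rule ennreal_cancel_resolvent[OF _ _ _ _ eqp fin])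
  have "st_conv wave_K (\<lambda>p. v p + st_conv kg_K M p) p =
     st_conv wave_K (\<lambda>p. sp_conv kg_K V p + sp_conv kg_dt_K f p + sphere_mean f p) p"
    by (rule st_conv_cong_AE) (use eq in simp)
  then show "st_conv wave_K v p + st_conv wave_K (st_conv kg_K M) p =
    st_conv wave_K (sp_conv kg_K V) p + st_conv wave_K (sp_conv kg_dt_K f) p + sp_conv (\<lambda>p. ennreal (ramp_kernel p)) f p"
    by (simp add: st_conv_add_right st_conv_wave_sphere_mean)
  show "st_conv wave_K (st_conv kg_K M) p + 4 * st_conv wave_K M p = 4 * st_conv kg_K M p"
    by (simp add: st_conv_assoc st_conv_add_left[symmetric] st_conv_cmult_left[symmetric] st_conv_wave_kg)
  show "st_conv wave_K (sp_conv kg_K V) p + 4 * sp_conv wave_K V p = 4 * sp_conv kg_K V p"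
    by (simp add: st_conv_sp_conv sp_conv_add_left[symmetric] sp_conv_cmult_left[symmetric] st_conv_wave_kg)
  show "st_conv wave_K (sp_conv kg_dt_K f) p + sp_conv (\<lambda>p. ennreal (ramp_kernel p)) f p = 4 * sp_conv kg_dt_K f p"
    by (simp add: st_conv_sp_conv sp_conv_add_left[symmetric] sp_conv_cmult_left[symmetric] st_conv_wave_kg_dt)
qed

section \<open>The time derivative of the linear evolution\<close>

lemma AE_affine:
  fixes P :: "real \<Rightarrow> bool"
  assumes "AE x in lborel. P x" "c \<noteq> 0"
  shows "AE x in lborel. P (t + c * x)"
proof -
  obtain N where N: "{x \<in> space lborel. \<not> P x} \<subseteq> N" "N \<in> null_sets lborel"
    using assms(1) by (auto simp: eventually_ae_filter)
  then have [measurable]: "N \<in> sets borel" by auto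
  have "AE x in lborel. x \<notin> N" using N(2) by (rule AE_not_in)
  then have "AE x in lborel. t + c * x \<notin> N"
    by (intro AE_borel_affine[where P = "\<lambda>x. x \<notin> N"] assms) auto
  then show ?thesis by eventually_elim (use N in auto)
qed

lemma sp_conv_reflect:
  assumes [measurable]: "K \<in> borel_measurable borel" "f \<in> borel_measurable borel"
  shows "sp_conv K f (t, x) = (\<integral>\<^sup>+y. K (t, y) * f (x - y) \<partial>lborel)"
  unfolding sp_conv_def
  using nn_integral_real_affine[of "\<lambda>y. K (t, x - y) * f y" "-1" x] by simp

text \<open>The identity includes the case of a divergent integral, where the default value 0 of the Bochner
  integral meets \<open>enn2real \<infinity> = 0\<close>.\<close>

lemma S_eq_sp_conv:
  assumes [measurable]: "f \<in> borel_measurable borel" and f: "\<And>x. 0 \<le> f x"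
    and g: "AE x in lborel. g x = f x"
  shows "S t g x = exp (- t / 2) * enn2real (sp_conv kg_K (enn f) (t, x))"
proof -
  have "(LINT y:{-t..t}|lebesgue. bessel_I0 (sqrt (t\<^sup>2 - y\<^sup>2) / 2) * g (x - y)) =
      (LINT y|lebesgue. 2 * (kg_kernel (t, y) * f (x - y)))"
    unfolding set_lebesgue_integral_def
  proof -
    have "AE y in lborel. g (x - y) = f (x - y)"
      using AE_affine[OF g, of "-1" x] by simp
    then have eq: "AE y in lebesgue. indicator {-t..t} y *\<^sub>R (bessel_I0 (sqrt (t\<^sup>2 - y\<^sup>2) / 2) * g (x - y)) =
        2 * (kg_kernel (t, y) * f (x - y))"
      unfolding AE_completion_iff
      by eventually_elim (auto simp: kg_kernel_def bessel_I0_eq_clifford abs_le_iff split: split_indicator)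
    have m: "(\<lambda>y. 2 * (kg_kernel (t, y) * f (x - y))) \<in> borel_measurable lebesgue"
      by (rule measurable_completion) measurable
    show "(LINT y|lebesgue. indicator {-t..t} y *\<^sub>R (bessel_I0 (sqrt (t\<^sup>2 - y\<^sup>2) / 2) * g (x - y))) =
        (LINT y|lebesgue. 2 * (kg_kernel (t, y) * f (x - y)))"
      by (intro Bochner_Integration.integral_cong_AE[OF borel_measurable_AE[OF m] m eq])
         (use eq in eventually_elim, simp)
  qed
  also have "\<dots> = (LINT y|lborel. 2 * (kg_kernel (t, y) * f (x - y)))"
    by (rule integral_completion) simp
  also have "\<dots> = 2 * enn2real (\<integral>\<^sup>+y. ennreal (kg_kernel (t, y) * f (x - y)) \<partial>lborel)"
    using f by (simp add: integral_eq_nn_integral)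
  also have "(\<integral>\<^sup>+y. ennreal (kg_kernel (t, y) * f (x - y)) \<partial>lborel) = sp_conv kg_K (enn f) (t, x)"
    using f by (simp add: sp_conv_reflect ennreal_mult')
  finally show ?thesis unfolding S_def by simp
qed

lemma kernel_le:
  "kg_kernel (t, x) \<le> bessel_clifford 0 (t\<^sup>2 / 16) / 2 * indicator {-t..t} x"
  "0 \<le> t \<Longrightarrow> kg_kernel_dt (t, x) \<le> t / 16 * bessel_clifford 1 (t\<^sup>2 / 16) * indicator {-t..t} x"
  using cone_nonneg[of x t]
  by (auto simp: kg_kernel_def kg_kernel_dt_def abs_le_iff intro!: bessel_clifford_mono mult_left_mono split: split_indicator)

lemma sp_conv_le:
  assumes K: "\<And>y. K (t, y) \<le> c * indicator {-t..t} y" "0 \<le> c"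
    and f: "\<And>x. f x \<le> M" "0 \<le> M" and t: "0 \<le> t"
  shows "sp_conv (\<lambda>p. ennreal (K p)) (enn f) (t, x) \<le> ennreal (2 * t * c * M)"
proof -
  have "sp_conv (\<lambda>p. ennreal (K p)) (enn f) (t, x) \<le> (\<integral>\<^sup>+y. ennreal (c * M) * indicator {x - t..x + t} y \<partial>lborel)"
    unfolding sp_conv_def prod.case
  proof (rule nn_integral_mono)
    fix y
    have "ennreal (K (t, x - y)) * ennreal (f y) \<le> ennreal (c * indicator {-t..t} (x - y)) * ennreal M"
      using K f by (intro mult_mono ennreal_leI) auto
    then show "ennreal (K (t, x - y)) * ennreal (f y) \<le> ennreal (c * M) * indicator {x - t..x + t} y"
      using K f by (auto simp: ennreal_mult' split: split_indicator_asm split_indicator)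
  qed
  also have "\<dots> = ennreal (2 * t * c * M)"
    using t K f by (simp add: nn_integral_cmult ennreal_mult'[symmetric] mult_ac)
  finally show ?thesis .
qed

lemma sp_conv_kg_finite:
  assumes "\<And>x. f x \<le> M" "0 \<le> M" "0 \<le> t"
  shows "sp_conv kg_K (enn f) (t, x) < \<infinity>"
    and "sp_conv kg_dt_K (enn f) (t, x) < \<infinity>"
proof -
  have "sp_conv kg_K (enn f) (t, x) \<le> ennreal (2 * t * (bessel_clifford 0 (t\<^sup>2 / 16) / 2) * M)"
    using assms by (intro sp_conv_le kernel_le) (auto intro!: bessel_clifford_nonneg)
  then show "sp_conv kg_K (enn f) (t, x) < \<infinity>"
    using ennreal_less_top le_less_trans by (metis infinity_ennreal_def)
  have "sp_conv kg_dt_K (enn f) (t, x) \<le> ennreal (2 * t * (t / 16 * bessel_clifford 1 (t\<^sup>2 / 16)) * M)"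
    using assms by (intro sp_conv_le kernel_le) (auto intro!: mult_nonneg_nonneg bessel_clifford_nonneg)
  then show "sp_conv kg_dt_K (enn f) (t, x) < \<infinity>"
    using ennreal_less_top le_less_trans by (metis infinity_ennreal_def)
qed

text \<open>The kernel jumps across the boundary of the light cone, but for fixed \<open>x\<close> and \<open>s\<close> that boundary
  consists of two points, so dominated convergence applies.\<close>

lemma continuous_on_sp_conv_kg_dt:
  assumes [measurable]: "f \<in> borel_measurable borel" and f: "\<And>x. 0 \<le> f x" "\<And>x. f x \<le> M"
  shows "continuous_on {0..} (\<lambda>s. enn2real (sp_conv kg_dt_K (enn f) (s, x)))"
proof -
  have M: "0 \<le> M" using f[of 0] by linarith
  have eq: "enn2real (sp_conv kg_dt_K (enn f) (s, x)) =
     (LINT y|lborel. kg_kernel_dt (s, x - y) * f y)" for s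
    unfolding sp_conv_def using f by (simp add: integral_eq_nn_integral ennreal_mult')
  show ?thesis
    unfolding eq continuous_on_sequentially comp_def
  proof (intro allI ballI impI, elim conjE)
    fix s :: "nat \<Rightarrow> real" and s0 assume s0: "s0 \<in> {0..}" and s: "\<forall>n. s n \<in> {0..}" "s \<longlonglongrightarrow> s0"
    obtain T where T: "T \<ge> 0" "\<And>n. s n \<le> T"
    proof -
      obtain B where "\<And>n. \<bar>s n\<bar> \<le> B"
        using convergent_imp_Bseq[of s] s by (auto simp: convergent_def Bseq_def)
      then show ?thesis using that[of B] by (meson abs_ge_self abs_ge_zero order_trans)
    qed
    define c where "c = T / 16 * bessel_clifford 1 (T\<^sup>2 / 16)"
    show "(\<lambda>n. LINT y|lborel. kg_kernel_dt (s n, x - y) * f y) \<longlonglongrightarrow> (LINT y|lborel. kg_kernel_dt (s0, x - y) * f y)"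
    proof (rule integral_dominated_convergence[where w = "\<lambda>y. c * M * indicator {x - T..x + T} y"])
      show "integrable lborel (\<lambda>y. c * M * indicator {x - T..x + T} y)"
        by (intro integrable_mult_right integrable_real_indicator) (auto simp: emeasure_lborel_Icc_eq)
      have "AE y in lborel. y \<notin> {x - s0, x + s0}"
        by (intro AE_not_in finite_imp_null_set_lborel) simp
      then show "AE y in lborel. (\<lambda>n. kg_kernel_dt (s n, x - y) * f y) \<longlonglongrightarrow> kg_kernel_dt (s0, x - y) * f y"
      proof eventually_elim
        case (elim y)
        then have ne: "\<bar>x - y\<bar> \<noteq> s0" by auto
        have "(\<lambda>n. kg_kernel_dt (s n, x - y)) \<longlonglongrightarrow> kg_kernel_dt (s0, x - y)"
        proof (cases "\<bar>x - y\<bar> < s0")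
          case True
          then have "\<forall>\<^sub>F n in sequentially. \<bar>x - y\<bar> < s n" using s(2) by (rule order_tendstoD(1)[rotated])
          then have ev: "\<forall>\<^sub>F n in sequentially. s n / 16 * bessel_clifford 1 (((s n)\<^sup>2 - (x - y)\<^sup>2) / 16) = kg_kernel_dt (s n, x - y)"
            by eventually_elim (simp add: kg_kernel_dt_def)
          have "isCont (\<lambda>r. r / 16 * bessel_clifford 1 ((r\<^sup>2 - (x - y)\<^sup>2) / 16)) s0"
            by (intro continuous_on_interior[of UNIV] continuous_intros) auto
          from isCont_tendsto_compose[OF this s(2)]
          have "(\<lambda>n. s n / 16 * bessel_clifford 1 (((s n)\<^sup>2 - (x - y)\<^sup>2) / 16)) \<longlonglongrightarrow> kg_kernel_dt (s0, x - y)"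
            using True by (simp add: kg_kernel_dt_def)
          then show ?thesis using ev by (rule Lim_transform_eventually)
        next
          case False
          with ne have "s0 < \<bar>x - y\<bar>" by simp
          then have "\<forall>\<^sub>F n in sequentially. s n < \<bar>x - y\<bar>" using s(2) by (rule order_tendstoD(2)[rotated])
          then have "\<forall>\<^sub>F n in sequentially. kg_kernel_dt (s n, x - y) = kg_kernel_dt (s0, x - y)"
            by eventually_elim (use False ne in \<open>auto simp: kg_kernel_dt_def\<close>)
          then show ?thesis by (rule tendsto_eventually)
        qed
        then show ?case by (intro tendsto_mult_right)
      qed
      fix n
      have "kg_kernel_dt (s n, x - y) * f y \<le> c * M * indicator {x - T..x + T} y" for y
      proof -
        have "kg_kernel_dt (s n, x - y) \<le> s n / 16 * bessel_clifford 1 ((s n)\<^sup>2 / 16) * indicator {- s n..s n} (x - y)"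
          using s by (intro kernel_le) auto
        also have "\<dots> \<le> c * indicator {x - T..x + T} y"
          unfolding c_def using s T(1) T(2)[of n] by (intro mult_mono bessel_clifford_mono bessel_clifford_nonneg)
            (auto split: split_indicator intro!: power_mono bessel_clifford_nonneg mult_nonneg_nonneg)
        finally have "kg_kernel_dt (s n, x - y) * f y \<le> c * indicator {x - T..x + T} y * M"
          using f T by (intro mult_mono) (auto simp: c_def intro!: mult_nonneg_nonneg bessel_clifford_nonneg)
        then show ?thesis by (simp add: mult_ac)
      qed
      then show "AE y in lborel. norm (kg_kernel_dt (s n, x - y) * f y) \<le> c * M * indicator {x - T..x + T} y"
        using f by (auto simp: abs_mult)
    qed simp_all
  qed
qed

text \<open>The kernel \<open>kg_kernel\<close> starts with the value 1/2 when the light cone reaches \<open>y\<close>; this jump is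
  what \<open>wave_kernel\<close> contributes.\<close>

lemma nn_integral_kg_kernel_dt_time:
  "ennreal (wave_kernel (s, y)) + (\<integral>\<^sup>+\<tau>. ennreal (kg_kernel_dt (\<tau>, y)) * indicator {0..s} \<tau> \<partial>lborel) = ennreal (kg_kernel (s, y))"
proof (cases "\<bar>y\<bar> \<le> s")
  case True
  have "(\<integral>\<^sup>+\<tau>. ennreal (kg_kernel_dt (\<tau>, y)) * indicator {0..s} \<tau> \<partial>lborel) =
     (\<integral>\<^sup>+\<tau>. ennreal (\<tau> / 16 * bessel_clifford 1 ((\<tau>\<^sup>2 - y\<^sup>2) / 16)) * indicator {\<bar>y\<bar>..s} \<tau> \<partial>lborel)"
    by (intro nn_integral_cong) (auto simp: kg_kernel_dt_def split: split_indicator)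
  also have "\<dots> = ennreal (bessel_clifford 0 ((s\<^sup>2 - y\<^sup>2) / 16) / 2 - bessel_clifford 0 ((\<bar>y\<bar>\<^sup>2 - y\<^sup>2) / 16) / 2)"
  proof (rule nn_integral_FTC_Icc[OF _ _ _ True])
    show "((\<lambda>\<tau>. bessel_clifford 0 ((\<tau>\<^sup>2 - y\<^sup>2) / 16) / 2) has_real_derivative \<tau> / 16 * bessel_clifford 1 ((\<tau>\<^sup>2 - y\<^sup>2) / 16)) (at \<tau>)" for \<tau>
      by (auto intro!: derivative_eq_intros)
    show "0 \<le> \<tau> / 16 * bessel_clifford 1 ((\<tau>\<^sup>2 - y\<^sup>2) / 16)" if "\<tau> \<in> {\<bar>y\<bar>..s}" for \<tau>
      using that cone_nonneg[of y \<tau>] by (intro mult_nonneg_nonneg bessel_clifford_nonneg) auto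
  qed auto
  finally show ?thesis
    using True cone_nonneg[OF True] bessel_clifford_ge_1[of "(s\<^sup>2 - y\<^sup>2) / 16"]
    by (simp add: wave_kernel_def kg_kernel_def ennreal_plus[symmetric] diff_divide_distrib del: ennreal_plus)
next
  case False
  then have "(\<integral>\<^sup>+\<tau>. ennreal (kg_kernel_dt (\<tau>, y)) * indicator {0..s} \<tau> \<partial>lborel) = (\<integral>\<^sup>+\<tau>. 0 \<partial>(lborel :: real measure))"
    by (intro nn_integral_cong) (auto simp: kg_kernel_dt_def split: split_indicator)
  then show ?thesis using False by (simp add: wave_kernel_def kg_kernel_def)
qed

text \<open>This separates the moving end points, which remain only in the term with the constant kernel, from
  a term that is differentiable in time by the fundamental theorem of calculus.\<close>

lemma sp_conv_kg_eq_time_integral: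
  assumes [measurable]: "f \<in> borel_measurable borel"
  shows "sp_conv kg_K f (s, x) = sp_conv wave_K f (s, x) +
    (\<integral>\<^sup>+\<tau>. sp_conv kg_dt_K f (\<tau>, x) * indicator {0..s} \<tau> \<partial>lborel)"
proof -
  have "(\<integral>\<^sup>+\<tau>. sp_conv kg_dt_K f (\<tau>, x) * indicator {0..s} \<tau> \<partial>lborel) =
     (\<integral>\<^sup>+\<tau>. \<integral>\<^sup>+y. ennreal (kg_kernel_dt (\<tau>, x - y)) * indicator {0..s} \<tau> * f y \<partial>lborel \<partial>lborel)"
    unfolding sp_conv_def prod.case by (intro nn_integral_cong) (simp split: split_indicator)
  also have "\<dots> = (\<integral>\<^sup>+y. \<integral>\<^sup>+\<tau>. ennreal (kg_kernel_dt (\<tau>, x - y)) * indicator {0..s} \<tau> * f y \<partial>lborel \<partial>lborel)"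
    by (intro nn_integral_swap) (unfold borel_prod[symmetric], measurable)
  also have "\<dots> = (\<integral>\<^sup>+y. (\<integral>\<^sup>+\<tau>. ennreal (kg_kernel_dt (\<tau>, x - y)) * indicator {0..s} \<tau> \<partial>lborel) * f y \<partial>lborel)"
    by (simp add: nn_integral_multc)
  finally show ?thesis
    unfolding sp_conv_def prod.case
    by (simp add: nn_integral_add[symmetric] distrib_right[symmetric] nn_integral_kg_kernel_dt_time)
qed

lemma sp_conv_wave_eq_integral:
  assumes [measurable]: "f \<in> borel_measurable borel" and f: "\<And>x. 0 \<le> f x" "\<And>x. f x \<le> M"
    and "0 \<le> s" "a \<le> x - s"
  shows "enn2real (sp_conv wave_K (enn f) (s, x))
    = (integral {a..x + s} f - integral {a..x - s} f) / 2"
proof -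
  have int: "set_integrable lborel {b..c} f" for b c
    unfolding set_integrable_def using f
    by (intro integrableI_bounded_set_indicator[where B = M]) (auto simp: emeasure_lborel_Icc_eq)
  then have hk: "f integrable_on {b..c}" for b c
    by (rule set_borel_integral_eq_integral(1))
  have "sp_conv wave_K (enn f) (s, x) =
      (\<integral>\<^sup>+y. ennreal (1/2 * (indicator {x - s..x + s} y *\<^sub>R f y)) \<partial>lborel)"
    unfolding sp_conv_def prod.case
    by (intro nn_integral_cong) (use f in \<open>auto simp: wave_kernel_def ennreal_mult'[symmetric] split: split_indicator\<close>)
  also have "\<dots> = ennreal (LINT y|lborel. 1/2 * (indicator {x - s..x + s} y *\<^sub>R f y))"
    using int[of "x - s" "x + s", unfolded set_integrable_def] f
    by (intro nn_integral_eq_integral integrable_mult_right) auto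
  also have "(LINT y|lborel. 1/2 * (indicator {x - s..x + s} y *\<^sub>R f y)) = 1/2 * (LINT y:{x - s..x + s}|lborel. f y)"
    unfolding set_lebesgue_integral_def by (rule integral_mult_right_zero)
  also have "(LINT y:{x - s..x + s}|lborel. f y) = integral {x - s..x + s} f"
    by (rule set_borel_integral_eq_integral(2)[OF int])
  also have "\<dots> = integral {a..x + s} f - integral {a..x - s} f"
    using Henstock_Kurzweil_Integration.integral_combine[of a "x - s" "x + s" f, OF _ _ hk] assms by simp
  finally have *: "sp_conv wave_K (enn f) (s, x) =
      ennreal (1/2 * (integral {a..x + s} f - integral {a..x - s} f))" .
  have "integral {a..x - s} f \<le> integral {a..x + s} f"
    using assms by (intro integral_subset_le hk) auto
  then show ?thesis unfolding * by simp
qed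

lemma has_vector_derivative_sp_conv_kg:
  assumes [measurable]: "f \<in> borel_measurable borel" and f: "\<And>x. 0 \<le> f x" "\<And>x. f x \<le> M"
    and t: "0 \<le> t" and a: "a < x - t"
    and D1: "((\<lambda>u. integral {a..u} f) has_vector_derivative f (x + t)) (at (x + t))"
    and D2: "((\<lambda>u. integral {a..u} f) has_vector_derivative f (x - t)) (at (x - t))"
  shows "((\<lambda>s. enn2real (sp_conv kg_K (enn f) (s, x))) has_vector_derivative
    (f (x + t) + f (x - t)) / 2 + enn2real (sp_conv kg_dt_K (enn f) (t, x))) (at t within {0..})"
proof -
  define G where "G = (\<lambda>s. enn2real (sp_conv kg_dt_K (enn f) (s, x)))"
  define T where "T = x - a"
  have T: "t < T" using a by (simp add: T_def)
  have M: "0 \<le> M" using f[of 0] by linarith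
  have G: "continuous_on {0..} G"
    unfolding G_def by (rule continuous_on_sp_conv_kg_dt) (use f in auto)
  have Gi: "G integrable_on {0..s}" for s
    by (rule integrable_continuous_real) (use G in \<open>auto intro: continuous_on_subset\<close>)
  have eq: "enn2real (sp_conv kg_K (enn f) (s, x)) =
      (integral {a..x + s} f - integral {a..x - s} f) / 2 + integral {0..s} G" if s: "0 \<le> s" "s < T" for s
  proof -
    have "(\<integral>\<^sup>+\<tau>. sp_conv kg_dt_K (enn f) (\<tau>, x) * indicator {0..s} \<tau> \<partial>lborel) =
        (\<integral>\<^sup>+\<tau>. ennreal (G \<tau>) * indicator {0..s} \<tau> \<partial>lborel)"
      unfolding G_def
      by (intro nn_integral_cong) (use sp_conv_kg_finite(2)[of f M] f M in \<open>auto split: split_indicator simp: ennreal_enn2real\<close>)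
    also have "\<dots> = ennreal (integral {0..s} G)"
      by (rule nn_integral_has_integral_lebesgue'[OF _ integrable_integral[OF Gi]]) (simp add: G_def)
    finally have I: "(\<integral>\<^sup>+\<tau>. sp_conv kg_dt_K (enn f) (\<tau>, x) * indicator {0..s} \<tau> \<partial>lborel)
        = ennreal (integral {0..s} G)" .
    have I0: "0 \<le> integral {0..s} G"
      by (intro Henstock_Kurzweil_Integration.integral_nonneg Gi) (simp add: G_def)
    have E: "sp_conv kg_K (enn f) (s, x) =
        sp_conv wave_K (enn f) (s, x) + ennreal (integral {0..s} G)"
      by (subst sp_conv_kg_eq_time_integral) (simp_all add: I)
    moreover have "sp_conv kg_K (enn f) (s, x) < \<infinity>"
      using sp_conv_kg_finite(1)[of f M] f M s by auto
    ultimately have "sp_conv wave_K (enn f) (s, x) < top"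
      by (simp add: ennreal_add_less_top)
    then have "enn2real (sp_conv kg_K (enn f) (s, x)) =
       enn2real (sp_conv wave_K (enn f) (s, x)) + integral {0..s} G"
      unfolding E using I0 by (subst enn2real_plus) auto
    also have "enn2real (sp_conv wave_K (enn f) (s, x))
        = (integral {a..x + s} f - integral {a..x - s} f) / 2"
      by (rule sp_conv_wave_eq_integral[where M = M]) (use f s T_def in auto)
    finally show ?thesis .
  qed
  have "((\<lambda>s. integral {0..s} G) has_vector_derivative G t) (at t within {0..T})"
    by (rule integral_has_vector_derivative) (use G t T in \<open>auto intro: continuous_on_subset\<close>)
  then have dG: "((\<lambda>s. integral {0..s} G) has_vector_derivative G t) (at t within {0..<T})"
    by (rule has_vector_derivative_within_subset) auto
  have "((\<lambda>s. integral {a..x + s} f) has_vector_derivative 1 *\<^sub>R f (x + t)) (at t within {0..<T})"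
    using D1 by (intro vector_diff_chain_within[of "\<lambda>s. x + s" 1 t _ "\<lambda>u. integral {a..u} f", unfolded comp_def])
      (auto intro!: derivative_eq_intros intro: has_vector_derivative_at_within)
  moreover have "((\<lambda>s. integral {a..x - s} f) has_vector_derivative (-1) *\<^sub>R f (x - t)) (at t within {0..<T})"
    using D2 by (intro vector_diff_chain_within[of "\<lambda>s. x - s" "-1" t _ "\<lambda>u. integral {a..u} f", unfolded comp_def])
      (auto intro!: derivative_eq_intros intro: has_vector_derivative_at_within)
  ultimately have "((\<lambda>s. (integral {a..x + s} f - integral {a..x - s} f) / 2 + integral {0..s} G) has_vector_derivative
      (1 *\<^sub>R f (x + t) - (-1) *\<^sub>R f (x - t)) / 2 + G t) (at t within {0..<T})"
    by (intro has_vector_derivative_add has_vector_derivative_divide has_vector_derivative_diff dG)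
  then have "((\<lambda>s. enn2real (sp_conv kg_K (enn f) (s, x))) has_vector_derivative
      (1 *\<^sub>R f (x + t) - (-1) *\<^sub>R f (x - t)) / 2 + G t) (at t within {0..<T})"
    by (rule has_vector_derivative_transform[rotated 2]) (use eq t T in auto)
  moreover have "at t within {0..<T} = at t within {0..}"
    by (rule at_within_nhd[of t "{..<T}"]) (use T in auto)
  ultimately show ?thesis by (simp add: G_def)
qed

text \<open>Lebesgue's differentiation theorem is applied on all intervals \<open>{- n..n}\<close> and then transported to
  the end points \<open>x + t\<close> and \<open>x - t\<close>.\<close>

lemma AE_dt_S:
  assumes [measurable]: "f \<in> borel_measurable borel" and f: "\<And>x. 0 \<le> f x" "\<And>x. f x \<le> M"
    and g: "AE x in lborel. g x = f x" and t: "0 \<le> t"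
  shows "AE x in lborel. dt_S t g x = exp (- t / 2) * ((f (x + t) + f (x - t)) / 2 +
     enn2real (sp_conv kg_dt_K (enn f) (t, x))) - S t g x / 2"
proof -
  let ?D = "\<lambda>n u. ((\<lambda>u. integral {- real n..u} f) has_vector_derivative f u) (at u)"
  have hk: "f integrable_on {b..c}" for b c
    using f by (intro set_borel_integral_eq_integral(1), unfold set_integrable_def)
      (intro integrableI_bounded_set_indicator[where B = M], auto simp: emeasure_lborel_Icc_eq)
  have "AE u in lborel. \<forall>n::nat. u \<in> {- real n<..<real n} \<longrightarrow>
      ?D n u"
    unfolding AE_all_countable
  proof
    fix n :: nat
    have "negligible {u \<in> {- real n<..<real n}. \<not> ?D n u}"
      by (rule Lebesgue_differentiation[OF hk])
    then have "AE u in lebesgue. u \<notin> {u \<in> {- real n<..<real n}. \<not> ?D n u}"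
      by (intro AE_not_in) (simp only: negligible_iff_null_sets)
    then show "AE u in lborel. u \<in> {- real n<..<real n} \<longrightarrow>
      ?D n u"
      unfolding AE_completion_iff by eventually_elim auto
  qed
  note D = this
  show ?thesis
    using AE_affine[OF D one_neq_zero, of t] AE_affine[OF D one_neq_zero, of "- t"]
  proof eventually_elim
    case (elim x)
    obtain n :: nat where n: "\<bar>x\<bar> + t < real n" using reals_Archimedean2 by blast
    have b: "- real n < t + x" "t + x < real n" "- real n < x - t" "x - t < real n"
      using n t by linarith+
    have D1: "?D n (x + t)"
      using elim(1)[rule_format, of n] b by (simp add: add.commute)
    have D2: "?D n (x - t)"
      using elim(2)[rule_format, of n] b by simp
    let ?k = "\<lambda>s. enn2real (sp_conv kg_K (enn f) (s, x))"
    let ?d = "(f (x + t) + f (x - t)) / 2 +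
     enn2real (sp_conv kg_dt_K (enn f) (t, x))"
    have dk: "(?k has_vector_derivative ?d) (at t within {0..})"
      by (rule has_vector_derivative_sp_conv_kg[where M = M and a = "- real n", OF _ f t _ D1 D2]) (use n in auto)
    have de: "((\<lambda>s. exp (- s / 2)) has_real_derivative - (1/2) * exp (- t / 2)) (at t within {0..})"
      by (auto intro!: derivative_eq_intros)
    have Sk: "S s g x = exp (- s / 2) * ?k s" for s
      using S_eq_sp_conv[OF _ f(1) g] by simp
    have "((\<lambda>s. exp (- s / 2) * ?k s) has_real_derivative - (1/2) * exp (- t / 2) * ?k t + ?d * exp (- t / 2)) (at t within {0..})"
      using dk de by (intro DERIV_mult) (simp_all add: has_real_derivative_iff_has_vector_derivative)
    then have "((\<lambda>s. S s g x) has_vector_derivative exp (- t / 2) * ?d - S t g x / 2) (at t within {0..})"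
      unfolding Sk by (simp add: has_real_derivative_iff_has_vector_derivative mult.commute)
    moreover have "at_right t \<le> at t within {0..}"
      using t by (intro at_le) auto
    then have "at t within {0..} \<noteq> bot"
      using trivial_limit_at_right_real[of t] by (metis bot_unique)
    ultimately show ?case
      unfolding dt_S_def by (intro vector_derivative_within)
  qed
qed

section \<open>Mild solutions as integral equations for Borel functions\<close>

lemma ex_borel_representative:
  assumes "g \<in> borel_measurable lebesgue" and b: "AE x in lborel. 0 \<le> g x \<and> g x \<le> M" and M: "0 \<le> M"
  obtains f :: "real \<Rightarrow> real" where "f \<in> borel_measurable borel" "\<And>x. 0 \<le> f x" "\<And>x. f x \<le> M" "AE x in lborel. g x = f x"
proof -
  obtain g' where [measurable]: "g' \<in> borel_measurable lborel" and g': "AE x in lborel. g x = g' x"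
    using completion_ex_borel_measurable_real[OF assms(1)] by auto
  show ?thesis
  proof (rule that[of "\<lambda>x. max 0 (min M (g' x))"])
    show "AE x in lborel. g x = max 0 (min M (g' x))"
      using g' b by eventually_elim auto
  qed (use M in auto)
qed

lemma sp_conv_mono:
  assumes "\<And>y. K (t, y) \<le> L (s, y)" and "AE y in lborel. f y \<le> g y"
  shows "sp_conv K f (t, x) \<le> sp_conv L g (s, x)"
  unfolding sp_conv_def prod.case
  by (intro nn_integral_mono_AE) (use assms(2) in eventually_elim, auto intro: mult_mono assms)

lemma sp_conv_cmult_right:
  assumes [measurable]: "K \<in> borel_measurable borel" "f \<in> borel_measurable borel"
  shows "sp_conv K (\<lambda>y. c * f y) p = c * sp_conv K f p"
  unfolding sp_conv_def by (cases p) (simp add: mult.left_commute[of _ c] nn_integral_cmult)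

lemma sp_conv_add_right:
  assumes [measurable]: "K \<in> borel_measurable borel" "f \<in> borel_measurable borel" "g \<in> borel_measurable borel"
  shows "sp_conv K (\<lambda>y. f y + g y) p = sp_conv K f p + sp_conv K g p"
  unfolding sp_conv_def by (cases p) (simp add: distrib_left nn_integral_add)

lemma sp_conv_kg_locally_integrable_finite:
  assumes "locally_integrable g" and [measurable]: "f \<in> borel_measurable borel" and f: "\<And>x. 0 \<le> f x"
    and g: "AE x in lborel. g x = f x"
  shows "sp_conv kg_K (enn f) (t, x) < \<infinity>"
proof -
  let ?I = "{x - t..x + t}"
  have "set_integrable lebesgue ?I g"
    using assms(1) by (auto simp: locally_integrable_def)
  then have "(\<integral>\<^sup>+y. ennreal (norm (indicator ?I y *\<^sub>R g y)) \<partial>lebesgue) < \<infinity>"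
    by (simp add: set_integrable_def integrable_iff_bounded)
  also have "(\<integral>\<^sup>+y. ennreal (norm (indicator ?I y *\<^sub>R g y)) \<partial>lebesgue) = (\<integral>\<^sup>+y. ennreal (norm (indicator ?I y *\<^sub>R g y)) \<partial>lborel)"
    by (rule nn_integral_completion)
  also have "\<dots> = (\<integral>\<^sup>+y. indicator ?I y * ennreal (f y) \<partial>lborel)"
    by (intro nn_integral_cong_AE) (use g in eventually_elim, use f in \<open>auto split: split_indicator\<close>)
  finally have fin: "(\<integral>\<^sup>+y. indicator ?I y * ennreal (f y) \<partial>lborel) < \<infinity>" .
  have "sp_conv kg_K (enn f) (t, x) \<le>
     (\<integral>\<^sup>+y. ennreal (bessel_clifford 0 (t\<^sup>2 / 16) / 2) * (indicator ?I y * ennreal (f y)) \<partial>lborel)"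
    unfolding sp_conv_def prod.case
  proof (rule nn_integral_mono)
    fix y
    have "ennreal (kg_kernel (t, x - y)) \<le> ennreal (bessel_clifford 0 (t\<^sup>2 / 16) / 2 * indicator {-t..t} (x - y))"
      by (intro ennreal_leI kernel_le)
    also have "\<dots> = ennreal (bessel_clifford 0 (t\<^sup>2 / 16) / 2) * indicator ?I y"
      by (auto split: split_indicator)
    finally show "ennreal (kg_kernel (t, x - y)) * ennreal (f y) \<le>
        ennreal (bessel_clifford 0 (t\<^sup>2 / 16) / 2) * (indicator ?I y * ennreal (f y))"
      by (simp add: mult.assoc[symmetric] mult_right_mono)
  qed
  also have "\<dots> < \<infinity>"
    using fin by (simp add: nn_integral_cmult ennreal_mult_less_top)
  finally show ?thesis .
qed

lemma wave_kernel_le_kg_kernel: "wave_kernel p \<le> kg_kernel p"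
  using bessel_clifford_ge_1 cone_nonneg
  by (cases p) (auto simp: wave_kernel_def kg_kernel_def)

lemma st_conv_mono_left: "(\<And>p. K p \<le> L p) \<Longrightarrow> st_conv K g p \<le> st_conv L g p"
  unfolding st_conv_def by (cases p) (auto intro!: nn_integral_mono mult_right_mono)

text \<open>A function that is measurable for the completed measure on the plane has measurable sections only
  for almost every time. A Borel version makes Tonelli's theorem applicable.\<close>

lemma mild_solution_borel_version:
  assumes "mild_solution p u0 u1 u"
  obtains u' :: "real \<times> real \<Rightarrow> real" where "u' \<in> borel_measurable borel" "\<And>q. 0 \<le> u' q"
    "AE \<tau> in lborel. 0 \<le> \<tau> \<longrightarrow> (AE y in lborel. u \<tau> y = u' (\<tau>, y))"
proof -
  let ?g = "\<lambda>q. if q \<in> {0..} \<times> UNIV then case q of (t, x) \<Rightarrow> u t x else 0"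
  have "closed ({0..} \<times> (UNIV :: real set) :: (real \<times> real) set)"
    by (intro closed_Times) auto
  then have "{0..} \<times> (UNIV :: real set) \<in> sets (lebesgue :: (real \<times> real) measure)"
    by (rule borel_closed[THEN sets_completionI_sets[of _ lborel, simplified]])
  then have "?g \<in> borel_measurable lebesgue"
    using assms by (subst borel_measurable_if) (auto simp: mild_solution_def)
  then obtain g' where [measurable]: "g' \<in> borel_measurable (lborel :: (real \<times> real) measure)"
    and g': "AE q in lborel. ?g q = g' q"
    using completion_ex_borel_measurable_real by blast
  have "AE q in (lborel \<Otimes>\<^sub>M lborel). ?g q = g' q"
    unfolding lborel_prod by (rule g')
  from lborel_pair.AE_pair[OF this]
  have ae: "AE \<tau> in lborel. AE y in lborel. ?g (\<tau>, y) = g' (\<tau>, y)" .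
  show ?thesis
  proof (rule that[of "\<lambda>q. max 0 (g' q)"])
    show "AE \<tau> in lborel. 0 \<le> \<tau> \<longrightarrow> (AE y in lborel. u \<tau> y = max 0 (g' (\<tau>, y)))"
      using ae
    proof eventually_elim
      case (elim \<tau>)
      show ?case
      proof
        assume "0 \<le> \<tau>"
        then have "AE y in lborel. 0 \<le> u \<tau> y"
          using assms by (auto simp: mild_solution_def AE_completion_iff)
        with elim show "AE y in lborel. u \<tau> y = max 0 (g' (\<tau>, y))"
          by eventually_elim (use \<open>0 \<le> \<tau>\<close> in auto)
      qed
    qed
  qed auto
qed

text \<open>Extension by zero to negative times, the form in which sources enter \<open>st_conv\<close>.\<close>

definition future :: "(real \<times> real \<Rightarrow> real) \<Rightarrow> real \<times> real \<Rightarrow> ennreal" where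
  "future g = (\<lambda>(t, x). if 0 \<le> t then ennreal (g (t, x)) else 0)"

lemma borel_measurable_future [measurable]:
  assumes [measurable]: "g \<in> borel_measurable borel" shows "future g \<in> borel_measurable borel"
  unfolding future_def borel_prod[symmetric] by measurable

text \<open>Almost every time suffices to replace \<open>u\<close> by its Borel version inside the integral, and local
  integrability makes the inner integrals finite.\<close>

lemma Duhamel_term:
  assumes u': "u' \<in> borel_measurable borel" "\<And>q. 0 \<le> u' q"
    and ae: "AE \<tau> in lborel. 0 \<le> \<tau> \<longrightarrow> (AE y in lborel. u \<tau> y = u' (\<tau>, y))"
    and loc: "\<And>t. t \<ge> 0 \<Longrightarrow> locally_integrable (\<lambda>x. u t x powr p)"
    and int: "set_integrable lebesgue {0..t} (\<lambda>\<tau>. S (t - \<tau>) (\<lambda>y. u \<tau> y powr p) x)"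
    and t: "0 \<le> t"
  shows "ennreal (exp (t / 2) * (LINT \<tau>:{0..t}|lebesgue. S (t - \<tau>) (\<lambda>y. u \<tau> y powr p) x)) =
      st_conv kg_K (future (\<lambda>q. exp (fst q / 2) * u' q powr p)) (t, x)"
    and "0 \<le> (LINT \<tau>:{0..t}|lebesgue. S (t - \<tau>) (\<lambda>y. u \<tau> y powr p) x)"
proof -
  note [measurable] = u'(1)
  let ?M = "future (\<lambda>q. exp (fst q / 2) * u' q powr p)"
  let ?N = "\<lambda>\<tau> y. u' (\<tau>, y) powr p"
  let ?s = "\<lambda>\<tau>. S (t - \<tau>) (\<lambda>y. u \<tau> y powr p) x"
  have S: "AE \<tau> in lborel. 0 \<le> \<tau> \<longrightarrow> 0 \<le> ?s \<tau> \<and>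
     ennreal (?s \<tau>) = ennreal (exp (- (t - \<tau>) / 2)) * sp_conv kg_K (\<lambda>y. ennreal (?N \<tau> y)) (t - \<tau>, x)"
    using ae
  proof eventually_elim
    case (elim \<tau>)
    show ?case
    proof
      assume \<tau>: "0 \<le> \<tau>"
      with elim have "AE y in lborel. u \<tau> y = u' (\<tau>, y)" by simp
      then have ae': "AE y in lborel. u \<tau> y powr p = ?N \<tau> y" by eventually_elim simp
      have "?s \<tau> = exp (- (t - \<tau>) / 2) * enn2real (sp_conv kg_K (\<lambda>y. ennreal (?N \<tau> y)) (t - \<tau>, x))"
        by (rule S_eq_sp_conv[OF _ _ ae']) auto
      moreover have "sp_conv kg_K (\<lambda>y. ennreal (?N \<tau> y)) (t - \<tau>, x) < \<infinity>"
        by (rule sp_conv_kg_locally_integrable_finite[OF loc[OF \<tau>] _ _ ae']) auto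
      ultimately show "0 \<le> ?s \<tau> \<and>
        ennreal (?s \<tau>) = ennreal (exp (- (t - \<tau>) / 2)) * sp_conv kg_K (\<lambda>y. ennreal (?N \<tau> y)) (t - \<tau>, x)"
        by (simp add: ennreal_mult' ennreal_enn2real)
    qed
  qed
  have nn: "AE \<tau> in lebesgue. 0 \<le> indicator {0..t} \<tau> *\<^sub>R ?s \<tau>"
    unfolding AE_completion_iff using S by eventually_elim (auto split: split_indicator)
  then show "0 \<le> (LINT \<tau>:{0..t}|lebesgue. ?s \<tau>)"
    unfolding set_lebesgue_integral_def by (rule integral_nonneg_AE)
  have "ennreal (LINT \<tau>:{0..t}|lebesgue. ?s \<tau>) = (\<integral>\<^sup>+\<tau>. ennreal (indicator {0..t} \<tau> *\<^sub>R ?s \<tau>) \<partial>lebesgue)"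
    unfolding set_lebesgue_integral_def using int nn
    by (intro nn_integral_eq_integral[symmetric]) (auto simp: set_integrable_def)
  also have "\<dots> = (\<integral>\<^sup>+\<tau>. ennreal (indicator {0..t} \<tau> *\<^sub>R ?s \<tau>) \<partial>lborel)"
    by (rule nn_integral_completion)
  also have "\<dots> = (\<integral>\<^sup>+\<tau>. indicator {0..t} \<tau> * (ennreal (exp (- (t - \<tau>) / 2)) * sp_conv kg_K (\<lambda>y. ennreal (?N \<tau> y)) (t - \<tau>, x)) \<partial>lborel)"
    by (intro nn_integral_cong_AE) (use S in eventually_elim, auto split: split_indicator)
  finally have I: "ennreal (LINT \<tau>:{0..t}|lebesgue. ?s \<tau>) = \<dots>" .
  have m: "(\<lambda>\<tau>. indicator {0..t} \<tau> * (ennreal (exp (- (t - \<tau>) / 2)) * sp_conv kg_K (\<lambda>y. ennreal (?N \<tau> y)) (t - \<tau>, x)))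
      \<in> borel_measurable borel"
    unfolding sp_conv_def by measurable
  have "ennreal (exp (t / 2) * (LINT \<tau>:{0..t}|lebesgue. ?s \<tau>)) =
     (\<integral>\<^sup>+\<tau>. ennreal (exp (t / 2)) * (indicator {0..t} \<tau> * (ennreal (exp (- (t - \<tau>) / 2)) * sp_conv kg_K (\<lambda>y. ennreal (?N \<tau> y)) (t - \<tau>, x))) \<partial>lborel)"
    using m by (simp add: ennreal_mult' I nn_integral_cmult)
  also have "\<dots> = (\<integral>\<^sup>+\<tau>. \<integral>\<^sup>+y. ennreal (kg_kernel (t - \<tau>, x - y)) * ?M (\<tau>, y) \<partial>lborel \<partial>lborel)"
  proof (rule nn_integral_cong)
    fix \<tau>
    have e: "ennreal (exp (t / 2)) * ennreal (exp (- (t - \<tau>) / 2)) = ennreal (exp (\<tau> / 2))"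
      by (simp add: ennreal_mult'[symmetric] exp_add[symmetric] field_simps)
    show "ennreal (exp (t / 2)) * (indicator {0..t} \<tau> * (ennreal (exp (- (t - \<tau>) / 2)) * sp_conv kg_K (\<lambda>y. ennreal (?N \<tau> y)) (t - \<tau>, x)))
       = (\<integral>\<^sup>+y. ennreal (kg_kernel (t - \<tau>, x - y)) * ?M (\<tau>, y) \<partial>lborel)"
    proof (cases "\<tau> \<in> {0..t}")
      case True
      then have "(\<integral>\<^sup>+y. ennreal (kg_kernel (t - \<tau>, x - y)) * ?M (\<tau>, y) \<partial>lborel)
         = sp_conv kg_K (\<lambda>y. ennreal (exp (\<tau> / 2)) * ennreal (?N \<tau> y)) (t - \<tau>, x)"
        by (simp add: sp_conv_def future_def ennreal_mult')
      also have "\<dots> = ennreal (exp (\<tau> / 2)) * sp_conv kg_K (\<lambda>y. ennreal (?N \<tau> y)) (t - \<tau>, x)"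
        by (rule sp_conv_cmult_right) auto
      finally show ?thesis using True by (simp add: e[symmetric] mult.assoc)
    next
      case False
      then have "ennreal (kg_kernel (t - \<tau>, x - y)) * ?M (\<tau>, y) = 0" for y
        by (auto simp: future_def kg_kernel_def)
      then show ?thesis using False by (simp only:) auto
    qed
  qed
  finally show "ennreal (exp (t / 2) * (LINT \<tau>:{0..t}|lebesgue. ?s \<tau>)) =
      st_conv kg_K (?M) (t, x)"
    by (simp add: st_conv_def)
qed

text \<open>The damping enters \<open>dt_S\<close> through \<open>- S t u0 / 2\<close>, which is balanced by writing
  \<open>u0 + u1 = (u1 + u0 / 2) + u0 / 2\<close>. What is left are the non-negative functions \<open>u0\<close> and
  \<open>u1 + u0 / 2\<close> of the hypothesis.\<close>

lemma linear_evolution_eq: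
  assumes [measurable]: "f0 \<in> borel_measurable borel" "f1 \<in> borel_measurable borel"
    and f0: "\<And>x. 0 \<le> f0 x" "\<And>x. f0 x \<le> a" and f1: "\<And>x. 0 \<le> f1 x" "\<And>x. f1 x \<le> a"
    and g0: "AE x in lborel. u0 x = f0 x" and g1: "AE x in lborel. u1 x + 1/2 * u0 x = f1 x"
    and t: "0 \<le> t"
  shows "AE x in lborel. ennreal (exp (t / 2) * (S t (\<lambda>y. u0 y + u1 y) x + dt_S t u0 x)) =
     sp_conv kg_K (enn f1) (t, x) + sp_conv kg_dt_K (enn f0) (t, x) + sphere_mean (enn f0) (t, x)
     \<and> 0 \<le> S t (\<lambda>y. u0 y + u1 y) x + dt_S t u0 x"
  using AE_dt_S[OF assms(1) f0 g0 t]
proof eventually_elim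
  case (elim x)
  have a: "0 \<le> a" using f0[of 0] by linarith
  let ?k1 = "sp_conv kg_K (enn f1) (t, x)" and ?k0 = "sp_conv kg_K (enn f0) (t, x)"
  let ?d = "sp_conv kg_dt_K (enn f0) (t, x)"
  have fin: "?k1 < \<infinity>" "?k0 < \<infinity>" "?d < \<infinity>"
    using sp_conv_kg_finite[of f0 a] sp_conv_kg_finite[of f1 a] f0 f1 a t by auto
  have "AE x in lborel. u0 x + u1 x = f1 x + f0 x / 2"
    using g0 g1 by eventually_elim auto
  then have "S t (\<lambda>y. u0 y + u1 y) x = exp (- t / 2) * enn2real (sp_conv kg_K (\<lambda>y. ennreal (f1 y + f0 y / 2)) (t, x))"
    by (intro S_eq_sp_conv) (use f0 f1 in auto)
  also have "sp_conv kg_K (\<lambda>y. ennreal (f1 y + f0 y / 2)) (t, x) =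
      sp_conv kg_K (\<lambda>y. ennreal (f1 y) + ennreal (1/2) * ennreal (f0 y)) (t, x)"
    using f0 f1 by (simp add: ennreal_mult'[symmetric])
  also have "\<dots> = ?k1 + ennreal (1/2) * ?k0"
    by (simp add: sp_conv_add_right sp_conv_cmult_right)
  also have "enn2real \<dots> = enn2real ?k1 + enn2real ?k0 / 2"
    using fin by (subst enn2real_plus) (auto simp: enn2real_mult ennreal_mult_less_top)
  finally have S1: "S t (\<lambda>y. u0 y + u1 y) x = exp (- t / 2) * (enn2real ?k1 + enn2real ?k0 / 2)" .
  have S0: "S t u0 x = exp (- t / 2) * enn2real ?k0"
    by (intro S_eq_sp_conv g0) (use f0 in auto)
  have eq: "S t (\<lambda>y. u0 y + u1 y) x + dt_S t u0 x = exp (- t / 2) * (enn2real ?k1 + enn2real ?d + (f0 (x + t) + f0 (x - t)) / 2)"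
    unfolding S1 elim S0 by (simp add: algebra_simps)
  have sm: "sphere_mean (enn f0) (t, x) = ennreal ((f0 (x + t) + f0 (x - t)) / 2)"
    using t f0 by (simp add: sphere_mean_def ennreal_plus[symmetric] ennreal_mult'[symmetric] del: ennreal_plus)
  have "exp (t / 2) * (S t (\<lambda>y. u0 y + u1 y) x + dt_S t u0 x) = enn2real ?k1 + enn2real ?d + (f0 (x + t) + f0 (x - t)) / 2"
    unfolding eq by (simp add: mult.assoc[symmetric] exp_add[symmetric])
  moreover have "ennreal (enn2real ?k1 + enn2real ?d + (f0 (x + t) + f0 (x - t)) / 2) = ?k1 + ?d + sphere_mean (enn f0) (t, x)"
    using f0 fin unfolding sm by (subst ennreal_plus, auto)+
  ultimately have "ennreal (exp (t / 2) * (S t (\<lambda>y. u0 y + u1 y) x + dt_S t u0 x)) =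
      ?k1 + ?d + sphere_mean (enn f0) (t, x)" by (simp only:)
  moreover have "0 \<le> S t (\<lambda>y. u0 y + u1 y) x + dt_S t u0 x"
    unfolding eq using f0 by (auto intro!: mult_nonneg_nonneg add_nonneg_nonneg)
  ultimately show ?case by blast
qed

text \<open>The Duhamel term is moved to the side of \<open>u\<close>, so that all terms are non-negative.\<close>

lemma mild_solution_kg_form:
  assumes mild: "mild_solution p u0 u1 u"
    and u': "u' \<in> borel_measurable borel" "\<And>q. 0 \<le> u' q"
    and ae: "AE \<tau> in lborel. 0 \<le> \<tau> \<longrightarrow> (AE y in lborel. u \<tau> y = u' (\<tau>, y))"
    and f0: "f0 \<in> borel_measurable borel" "\<And>x. 0 \<le> f0 x" "\<And>x. f0 x \<le> a"
    and f1: "f1 \<in> borel_measurable borel" "\<And>x. 0 \<le> f1 x" "\<And>x. f1 x \<le> a"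
    and g0: "AE x in lborel. u0 x = f0 x" and g1: "AE x in lborel. u1 x + 1/2 * u0 x = f1 x"
    and t: "0 \<le> t"
  shows "AE x in lborel. ennreal (exp (t / 2) * u t x) + st_conv kg_K (future (\<lambda>q. exp (fst q / 2) * u' q powr p)) (t, x) =
     sp_conv kg_K (enn f1) (t, x) + sp_conv kg_dt_K (enn f0) (t, x) + sphere_mean (enn f0) (t, x)"
proof -
  have loc: "\<And>t. t \<ge> 0 \<Longrightarrow> locally_integrable (\<lambda>x. u t x powr p)" using mild by (auto simp: mild_solution_def)
  have pos: "AE x in lborel. 0 \<le> u t x" and
    eq: "AE x in lborel. set_integrable lebesgue {0..t} (\<lambda>\<tau>. S (t - \<tau>) (\<lambda>y. u \<tau> y powr p) x) \<and>
        u t x = S t (\<lambda>y. u0 y + u1 y) x + dt_S t u0 x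
          - (LINT \<tau>:{0..t}|lebesgue. S (t - \<tau>) (\<lambda>y. u \<tau> y powr p) x)"
    using mild t by (auto simp: mild_solution_def AE_completion_iff)
  show ?thesis
    using pos eq linear_evolution_eq[OF f0(1) f1(1) f0(2,3) f1(2,3) g0 g1 t]
  proof eventually_elim
    case (elim x)
    note D = Duhamel_term[OF u' ae loc conjunct1[OF elim(2)] t]
    let ?I = "LINT \<tau>:{0..t}|lebesgue. S (t - \<tau>) (\<lambda>y. u \<tau> y powr p) x"
    have "ennreal (exp (t / 2) * u t x) + ennreal (exp (t / 2) * ?I) = ennreal (exp (t / 2) * u t x + exp (t / 2) * ?I)"
      using elim(1) D(2) by (intro ennreal_plus[symmetric]) auto
    also have "exp (t / 2) * u t x + exp (t / 2) * ?I = exp (t / 2) * (S t (\<lambda>y. u0 y + u1 y) x + dt_S t u0 x)"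
      using elim(2) by (simp add: distrib_left[symmetric])
    finally show ?case using D(1) elim(3) by simp
  qed
qed

section \<open>A space-independent supersolution\<close>

lemma nn_integral_wave_kernel_space:
  "(\<integral>\<^sup>+y. ennreal (wave_kernel (s, x - y)) \<partial>lborel) = ennreal s"
proof (cases "0 \<le> s")
  case True
  have "(\<integral>\<^sup>+y. ennreal (wave_kernel (s, x - y)) \<partial>lborel) = (\<integral>\<^sup>+y. ennreal (1/2) * indicator {x - s..x + s} y \<partial>lborel)"
    by (intro nn_integral_cong) (auto simp: wave_kernel_def split: split_indicator)
  also have "\<dots> = ennreal s"
    using True by (simp add: nn_integral_cmult ennreal_mult'[symmetric])
  finally show ?thesis .
next
  case False
  then have "wave_kernel (s, x - y) = 0" for y by (auto simp: wave_kernel_def)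
  then show ?thesis using False by (simp add: ennreal_neg)
qed

lemma st_conv_wave_time_function:
  assumes h: "continuous_on {0..} h" "\<And>\<tau>. 0 \<le> \<tau> \<Longrightarrow> 0 \<le> h \<tau>"
  shows "st_conv wave_K (future (\<lambda>q. h (fst q))) (t, x) = ennreal (integral {0..t} (\<lambda>\<tau>. (t - \<tau>) * h \<tau>))"
proof -
  have "st_conv wave_K (future (\<lambda>q. h (fst q))) (t, x) = (\<integral>\<^sup>+\<tau>. ennreal ((t - \<tau>) * h \<tau>) * indicator {0..t} \<tau> \<partial>lborel)"
    unfolding st_conv_def prod.case
  proof (rule nn_integral_cong)
    fix \<tau>
    have "(\<integral>\<^sup>+y. ennreal (wave_kernel (t - \<tau>, x - y)) * future (\<lambda>q. h (fst q)) (\<tau>, y) \<partial>lborel) =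
        ennreal (t - \<tau>) * (if 0 \<le> \<tau> then ennreal (h \<tau>) else 0)"
      by (simp add: future_def nn_integral_multc nn_integral_wave_kernel_space)
    also have "\<dots> = ennreal ((t - \<tau>) * h \<tau>) * indicator {0..t} \<tau>"
      using h(2)[of \<tau>] by (auto simp: ennreal_mult' ennreal_mult'' ennreal_neg split: split_indicator)
    finally show "(\<integral>\<^sup>+y. ennreal (wave_kernel (t - \<tau>, x - y)) * future (\<lambda>q. h (fst q)) (\<tau>, y) \<partial>lborel) =
        ennreal ((t - \<tau>) * h \<tau>) * indicator {0..t} \<tau>" .
  qed
  also have "\<dots> = ennreal (integral {0..t} (\<lambda>\<tau>. (t - \<tau>) * h \<tau>))"
    by (rule nn_integral_has_integral_lebesgue'[OF _ integrable_integral])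
       (use h in \<open>auto intro!: integrable_continuous_real continuous_intros intro: continuous_on_subset\<close>)
  finally show ?thesis .
qed

lemma Taylor_integral_remainder:
  fixes y y' y'' :: "real \<Rightarrow> real"
  assumes "\<And>\<tau>. 0 \<le> \<tau> \<Longrightarrow> (y has_real_derivative y' \<tau>) (at \<tau>)"
    and "\<And>\<tau>. 0 \<le> \<tau> \<Longrightarrow> (y' has_real_derivative y'' \<tau>) (at \<tau>)" and t: "0 \<le> t"
  shows "((\<lambda>\<tau>. (t - \<tau>) * y'' \<tau>) has_integral (y t - y 0 - t * y' 0)) {0..t}"
proof -
  have "((\<lambda>\<tau>. (t - \<tau>) * y'' \<tau>) has_integral ((t - t) * y' t + y t - ((t - 0) * y' 0 + y 0))) {0..t}"
  proof (rule fundamental_theorem_of_calculus[OF t])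
    fix \<tau> assume "\<tau> \<in> {0..t}"
    then have "0 \<le> \<tau>" by simp
    note d = assms(1,2)[OF this, THEN DERIV_subset[OF _ subset_UNIV]]
    have "((\<lambda>\<tau>. (t - \<tau>) * y' \<tau> + y \<tau>) has_real_derivative (t - \<tau>) * y'' \<tau>) (at \<tau> within {0..t})"
      by (rule derivative_eq_intros d refl | simp)+
    then show "((\<lambda>\<tau>. (t - \<tau>) * y' \<tau> + y \<tau>) has_vector_derivative (t - \<tau>) * y'' \<tau>) (at \<tau> within {0..t})"
      by (simp add: has_real_derivative_iff_has_vector_derivative)
  qed
  then show ?thesis by (simp add: algebra_simps)
qed

text \<open>The one-sided Lipschitz property of \<open>g r = r - 4 * r powr p\<close> at \<open>W\<close>: it holds above \<open>W\<close> because
  \<open>powr p\<close> is monotone, and below \<open>W\<close> because \<open>g\<close> increases on \<open>{0..W}\<close>.\<close>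

lemma absorption_monotone:
  fixes W v :: real
  assumes p: "1 < p" and W: "0 < W" "4 * p * W powr (p - 1) \<le> 1" and v: "0 \<le> v" "v \<le> W + k" "0 \<le> k"
  shows "v + 4 * W powr p \<le> W + 4 * v powr p + k"
proof (cases "W \<le> v")
  case True
  then have "W powr p \<le> v powr p" using p W by (intro powr_mono2) auto
  then show ?thesis using v by linarith
next
  case False
  have "W powr p - v powr p \<le> p * W powr (p - 1) * (W - v)"
  proof (cases "v = 0")
    case True
    have "W powr p = W powr (p - 1) * W" using W by (simp add: powr_diff)
    also have "\<dots> \<le> p * (W powr (p - 1) * W)"
      using p W mult_right_mono[of 1 p "W powr (p - 1) * W"] by simp
    finally show ?thesis using True by (simp add: mult_ac)
  next
    case v0: False
    have "\<exists>z>v. z < W \<and> W powr p - v powr p = (W - v) * (p * z powr (p - 1))"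
      by (rule MVT2) (use False v v0 in \<open>auto intro!: derivative_eq_intros\<close>)
    then obtain z where z: "v < z" "z < W" "W powr p - v powr p = (W - v) * (p * z powr (p - 1))" by auto
    have "z powr (p - 1) \<le> W powr (p - 1)" using z v p by (intro powr_mono2) auto
    then have "p * z powr (p - 1) \<le> p * W powr (p - 1)" using p by simp
    then show ?thesis using False z(3) by (simp add: mult.commute mult_left_mono)
  qed
  then have "4 * (W powr p - v powr p) \<le> (4 * p * W powr (p - 1)) * (W - v)" by simp
  also have "\<dots> \<le> 1 * (W - v)" using False W by (intro mult_right_mono) auto
  finally have "4 * (W powr p - v powr p) \<le> W - v" by simp
  then show ?thesis using v(3) by (simp add: right_diff_distrib)
qed

text \<open>With \<open>m = 1 / (p - 1)\<close>, \<open>W'\<close> and \<open>W powr p\<close> are both multiples of \<open>(t + T) powr (- m - 1)\<close> and cancel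
  for this choice of \<open>A\<close>, so \<open>W'' + W' + W powr p = W'' \<ge> 0\<close>. The second statement is the resulting
  inequality for \<open>exp (t / 2) * W t\<close> in integrated form, as it meets the d'Alembert formula.\<close>

lemma supersolution:
  fixes p :: real
  assumes p: "1 < p" and A: "A powr (p - 1) = 1 / (p - 1)" "0 < A" and T: "4 * p / (p - 1) \<le> T"
  defines "W \<equiv> \<lambda>t. A * (t + T) powr (- (1 / (p - 1)))"
  assumes a: "a \<le> W 0 / 4" and t: "0 \<le> t"
  shows "4 * p * W t powr (p - 1) \<le> 1"
    and "a * (1 + t) + integral {0..t} (\<lambda>\<tau>. (t - \<tau>) * (exp (\<tau> / 2) * W \<tau>)) / 4
      \<le> exp (t / 2) * W t + integral {0..t} (\<lambda>\<tau>. (t - \<tau>) * (exp (\<tau> / 2) * W \<tau> powr p))"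
proof -
  define m where "m = 1 / (p - 1)"
  have m: "0 < m" "m * (p - 1) = 1" "m * p = m + 1" using p by (simp_all add: m_def field_simps)
  have T': "4 * p * m \<le> T" using T by (simp add: m_def)
  moreover have "4 * m \<le> 4 * p * m" using p m by simp
  ultimately have T4: "4 * m \<le> T" by linarith
  have T0: "0 < T" using T4 m by linarith
  have W: "W t = A * (t + T) powr (- m)" for t by (simp add: W_def m_def)
  have Wpos: "0 < W t" if "0 \<le> t" for t using A that T0 by (simp add: W)
  show "4 * p * W t powr (p - 1) \<le> 1"
  proof -
    have "W t powr (p - 1) = m * (t + T) powr (- 1)"
      using A t T0 m by (simp add: W powr_mult powr_powr m_def[symmetric])
    also have "\<dots> = m / (t + T)" using t T0 by (simp add: powr_minus_divide)
    finally have "4 * p * W t powr (p - 1) = 4 * p * m / (t + T)" by simp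
    also have "\<dots> \<le> 1" using t T' T0 by simp
    finally show ?thesis .
  qed
  define W' where "W' = (\<lambda>t. - m * A * (t + T) powr (- m - 1))"
  define W'' where "W'' = (\<lambda>t. m * (m + 1) * A * (t + T) powr (- m - 2))"
  have dW: "(W has_real_derivative W' \<tau>) (at \<tau>)" "(W' has_real_derivative W'' \<tau>) (at \<tau>)" if "0 \<le> \<tau>" for \<tau>
  proof -
    have "0 < \<tau> + T" using that T0 by simp
    then have d: "((\<lambda>t. (t + T) powr r) has_real_derivative r * (\<tau> + T) powr (r - 1)) (at \<tau>)" for r
      by (auto intro!: derivative_eq_intros)
    show "(W has_real_derivative W' \<tau>) (at \<tau>)"
      unfolding W_def W'_def m_def[symmetric] using DERIV_cmult[OF d[of "- m"], of A] by (simp add: mult_ac)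
    show "(W' has_real_derivative W'' \<tau>) (at \<tau>)"
      unfolding W'_def W''_def using DERIV_cmult[OF d[of "- m - 1"], of "- m * A"] by (simp add: algebra_simps)
  qed
  define y where "y = (\<lambda>\<tau>. exp (\<tau> / 2) * W \<tau>)"
  define y' where "y' = (\<lambda>\<tau>. exp (\<tau> / 2) * (W' \<tau> + W \<tau> / 2))"
  define y'' where "y'' = (\<lambda>\<tau>. exp (\<tau> / 2) * (W'' \<tau> + W' \<tau> + W \<tau> / 4))"
  have dy: "(y has_real_derivative y' \<tau>) (at \<tau>)" "(y' has_real_derivative y'' \<tau>) (at \<tau>)" if "0 \<le> \<tau>" for \<tau>
  proof -
    have e: "((\<lambda>\<tau>. exp (\<tau> / 2)) has_real_derivative exp (\<tau> / 2) / 2) (at \<tau>)"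
      by (auto intro!: derivative_eq_intros)
    show "(y has_real_derivative y' \<tau>) (at \<tau>)"
      unfolding y_def y'_def using DERIV_mult[OF e dW(1)[OF that]] by (simp add: algebra_simps)
    show "(y' has_real_derivative y'' \<tau>) (at \<tau>)"
      unfolding y'_def y''_def
      by (rule DERIV_cong[OF DERIV_mult[OF e DERIV_add[OF dW(2)[OF that] DERIV_cdivide[OF dW(1)[OF that], of 2]]]])
         (simp add: field_simps)
  qed
  have cW: "continuous_on {0..} W"
    using dW(1) by (intro continuous_at_imp_continuous_on) (auto intro: DERIV_isCont)
  have cW2: "continuous_on {0..} (\<lambda>\<tau>. W \<tau> powr p)"
    by (intro continuous_intros cW) (use Wpos in force)
  have I: "(\<lambda>\<tau>. (t - \<tau>) * (exp (\<tau> / 2) * h \<tau>)) integrable_on {0..t}" if "continuous_on {0..} h" for h :: "real \<Rightarrow> real"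
    by (intro integrable_continuous_real continuous_intros continuous_on_subset[OF that]) auto
  have "integral {0..t} (\<lambda>\<tau>. (t - \<tau>) * (exp (\<tau> / 2) * W \<tau>)) / 4 - integral {0..t} (\<lambda>\<tau>. (t - \<tau>) * (exp (\<tau> / 2) * W \<tau> powr p))
     = integral {0..t} (\<lambda>\<tau>. (t - \<tau>) * (exp (\<tau> / 2) * W \<tau>) / 4 - (t - \<tau>) * (exp (\<tau> / 2) * W \<tau> powr p))"
    using I[OF cW] I[OF cW2] by (subst Henstock_Kurzweil_Integration.integral_diff) auto
  also have "\<dots> \<le> y t - y 0 - t * y' 0"
  proof (rule has_integral_le[OF integrable_integral Taylor_integral_remainder[OF dy t]])
    show "(\<lambda>\<tau>. (t - \<tau>) * (exp (\<tau> / 2) * W \<tau>) / 4 - (t - \<tau>) * (exp (\<tau> / 2) * W \<tau> powr p)) integrable_on {0..t}"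
      using I[OF cW] I[OF cW2] by (intro integrable_diff) auto
    fix \<tau> assume \<tau>: "\<tau> \<in> {0..t}"
    then have s: "0 < \<tau> + T" using T0 by simp
    have "W \<tau> powr p = A powr p * (\<tau> + T) powr (- m - 1)"
      using A s m(3) by (simp add: W powr_mult powr_powr minus_mult_left[symmetric] del: minus_mult_left)
    also have "A powr p = A powr (p - 1) * A" using A(2) by (simp add: powr_diff)
    also have "\<dots> = m * A" using A by (simp add: m_def)
    finally have "W \<tau> powr p = - W' \<tau>" by (simp add: W'_def)
    moreover have "0 \<le> W'' \<tau>" using m A by (simp add: W''_def)
    ultimately have "W \<tau> / 4 - W \<tau> powr p \<le> W'' \<tau> + W' \<tau> + W \<tau> / 4" by simp
    then have "(t - \<tau>) * (exp (\<tau> / 2) * (W \<tau> / 4 - W \<tau> powr p)) \<le> (t - \<tau>) * y'' \<tau>"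
      unfolding y''_def using \<tau> by (intro mult_left_mono) auto
    then show "(t - \<tau>) * (exp (\<tau> / 2) * W \<tau>) / 4 - (t - \<tau>) * (exp (\<tau> / 2) * W \<tau> powr p) \<le> (t - \<tau>) * y'' \<tau>"
      by (simp add: algebra_simps)
  qed
  also have "\<dots> \<le> y t - a * (1 + t)"
  proof -
    have "a \<le> y 0" using a Wpos[of 0] by (simp add: y_def)
    moreover have "a \<le> y' 0"
    proof -
      have "W' 0 = - (m / T) * W 0"
        using T0 by (simp add: W'_def W powr_diff)
      moreover have "m / T \<le> 1 / 4" using T4 T0 by (simp add: field_simps)
      then have "m / T * W 0 \<le> 1 / 4 * W 0" using Wpos[of 0] by (intro mult_right_mono) auto
      ultimately show ?thesis using a by (simp add: y'_def)
    qed
    then have "t * a \<le> t * y' 0" using t by (rule mult_left_mono)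
    ultimately show ?thesis by (simp add: algebra_simps)
  qed
  finally show "a * (1 + t) + integral {0..t} (\<lambda>\<tau>. (t - \<tau>) * (exp (\<tau> / 2) * W \<tau>)) / 4
      \<le> exp (t / 2) * W t + integral {0..t} (\<lambda>\<tau>. (t - \<tau>) * (exp (\<tau> / 2) * W \<tau> powr p))"
    by (simp add: y_def)
qed

section \<open>Comparison with the supersolution\<close>

lemma st_conv_cmult_right:
  assumes [measurable]: "K \<in> borel_measurable borel" "g \<in> borel_measurable borel"
  shows "st_conv K (\<lambda>p. c * g p) p = c * st_conv K g p"
  unfolding st_conv_def by (cases p) (simp add: mult.left_commute[of _ c] nn_integral_cmult)

lemma bessel_clifford_le_exp:
  assumes "0 \<le> z" shows "bessel_clifford 0 (z\<^sup>2 / 4) \<le> exp z" "bessel_clifford 1 (z\<^sup>2 / 4) \<le> exp z"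
proof -
  have "pi * bessel_clifford 0 (z\<^sup>2 / 4) = integral {0..pi} (\<lambda>\<theta>. exp (z * cos \<theta>))"
    by (rule bessel_clifford_integral[symmetric])
  also have "\<dots> \<le> integral {0..pi} (\<lambda>\<theta>. exp z)"
    using assms by (intro integral_le integrable_continuous_real continuous_intros) (auto intro!: mult_left_le)
  finally show 0: "bessel_clifford 0 (z\<^sup>2 / 4) \<le> exp z" by simp
  have "0 \<le> z\<^sup>2 / 4 * bessel_clifford 2 (z\<^sup>2 / 4)" by (intro mult_nonneg_nonneg bessel_clifford_nonneg) auto
  then show "bessel_clifford 1 (z\<^sup>2 / 4) \<le> exp z"
    using 0 bessel_clifford_recurrence[of "z\<^sup>2 / 4"] by linarith
qed

lemma sphere_mean_le:
  assumes "\<And>x. 0 \<le> f x" "\<And>x. f x \<le> a"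
  shows "sphere_mean (enn f) p \<le> ennreal a"
proof -
  have "(f x + f y) / 2 \<le> a" for x y using assms(2)[of x] assms(2)[of y] by simp
  then show ?thesis
    using assms by (cases p)
      (auto simp: sphere_mean_def ennreal_plus[symmetric] ennreal_mult'[symmetric] intro!: ennreal_leI simp del: ennreal_plus)
qed

text \<open>Only a bound \<open>K * exp t\<close> with some constant \<open>K\<close> is needed, to start the iteration in
  \<open>mild_solution_le_supersolution\<close>.\<close>

lemma linear_evolution_crude_bound:
  assumes f0: "\<And>x. 0 \<le> f0 x" "\<And>x. f0 x \<le> a" and f1: "\<And>x. 0 \<le> f1 x" "\<And>x. f1 x \<le> a" and t: "0 \<le> t"
  shows "sp_conv kg_K (enn f1) (t, x) + sp_conv kg_dt_K (enn f0) (t, x) +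
     sphere_mean (enn f0) (t, x) \<le> ennreal (4 * a * exp t)"
proof -
  have a: "0 \<le> a" using f0[of 0] by linarith
  have e: "exp (t / 2) * exp (t / 2) = exp t" by (simp add: exp_add[symmetric])
  have C: "bessel_clifford 0 (t\<^sup>2 / 16) \<le> exp (t / 2)" "bessel_clifford 1 (t\<^sup>2 / 16) \<le> exp (t / 2)"
    using bessel_clifford_le_exp[of "t / 2"] t by (simp_all add: power_divide)
  have "sp_conv kg_K (enn f1) (t, x) \<le> ennreal (2 * t * (bessel_clifford 0 (t\<^sup>2 / 16) / 2) * a)"
    using a f1 t by (intro sp_conv_le kernel_le) (auto intro!: bessel_clifford_nonneg)
  also have "2 * t * (bessel_clifford 0 (t\<^sup>2 / 16) / 2) * a \<le> 2 * a * exp t"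
  proof -
    have "t \<le> 2 * exp (t / 2)"
      using exp_ge_add_one_self[of "t / 2"] by linarith
    then have "t * bessel_clifford 0 (t\<^sup>2 / 16) \<le> (2 * exp (t / 2)) * exp (t / 2)"
      using t C by (intro mult_mono bessel_clifford_nonneg) auto
    then have "t * bessel_clifford 0 (t\<^sup>2 / 16) \<le> 2 * exp t" using e by simp
    then have "t * bessel_clifford 0 (t\<^sup>2 / 16) * a \<le> 2 * exp t * a" using a by (rule mult_right_mono)
    then show ?thesis by (simp add: mult_ac)
  qed
  finally have 1: "sp_conv kg_K (enn f1) (t, x) \<le> ennreal (2 * a * exp t)" by (simp add: ennreal_leI)
  have "sp_conv kg_dt_K (enn f0) (t, x) \<le> ennreal (2 * t * (t / 16 * bessel_clifford 1 (t\<^sup>2 / 16)) * a)"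
    using a f0 t by (intro sp_conv_le kernel_le) (auto intro!: mult_nonneg_nonneg bessel_clifford_nonneg)
  also have "2 * t * (t / 16 * bessel_clifford 1 (t\<^sup>2 / 16)) * a \<le> a * exp t"
  proof -
    have "t\<^sup>2 / 8 \<le> exp (t / 2)"
      using exp_lower_Taylor_quadratic[of "t / 2"] t by (simp add: power_divide)
    then have "t\<^sup>2 / 8 * bessel_clifford 1 (t\<^sup>2 / 16) \<le> exp (t / 2) * exp (t / 2)"
      using C by (intro mult_mono bessel_clifford_nonneg) auto
    then have "t\<^sup>2 / 8 * bessel_clifford 1 (t\<^sup>2 / 16) * a \<le> exp t * a"
      unfolding e using a by (rule mult_right_mono)
    then show ?thesis by (simp add: power2_eq_square mult_ac)
  qed
  finally have 2: "sp_conv kg_dt_K (enn f0) (t, x) \<le> ennreal (a * exp t)" by (simp add: ennreal_leI)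
  have "a \<le> a * exp t" using a t by (simp add: mult_le_cancel_left1)
  then have 3: "sphere_mean (enn f0) (t, x) \<le> ennreal (a * exp t)"
    using sphere_mean_le[of f0 a "(t, x)", OF f0] by (meson ennreal_leI order_trans)
  have "ennreal (2 * a * exp t) + ennreal (a * exp t) + ennreal (a * exp t) = ennreal (4 * a * exp t)"
    using a by (simp add: ennreal_plus[symmetric] del: ennreal_plus)
  with add_mono[OF add_mono[OF 1 2] 3] show ?thesis by simp
qed

text \<open>The resolvent identity needs the integral equation at almost all points of the plane, while the
  definition of a mild solution provides it for each time \<open>t \<ge> 0\<close>. At negative times all terms vanish.\<close>

lemma mild_solution_wave_form:
  assumes mild: "mild_solution p u0 u1 u"
    and u': "u' \<in> borel_measurable borel" "\<And>q. 0 \<le> u' q"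
    and ae: "AE \<tau> in lborel. 0 \<le> \<tau> \<longrightarrow> (AE y in lborel. u \<tau> y = u' (\<tau>, y))"
    and f0: "f0 \<in> borel_measurable borel" "\<And>x. 0 \<le> f0 x" "\<And>x. f0 x \<le> a"
    and f1: "f1 \<in> borel_measurable borel" "\<And>x. 0 \<le> f1 x" "\<And>x. f1 x \<le> a"
    and g0: "AE x in lborel. u0 x = f0 x" and g1: "AE x in lborel. u1 x + 1/2 * u0 x = f1 x"
    and t: "0 \<le> t"
  defines "M \<equiv> future (\<lambda>q. exp (fst q / 2) * u' q powr p)" and "v \<equiv> future (\<lambda>q. exp (fst q / 2) * u' q)"
  shows "AE x in lborel. 4 * ennreal (exp (t / 2) * u t x) + 4 * st_conv wave_K M (t, x) =
     st_conv wave_K v (t, x) + 4 * sp_conv wave_K (enn f1) (t, x) + 4 * sphere_mean (enn f0) (t, x)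
     \<and> st_conv wave_K M (t, x) < \<infinity> \<and> ennreal (exp (t / 2) * u t x) \<le> ennreal (4 * a * exp t)"
proof -
  note [measurable] = u'(1) f0(1) f1(1)
  note kg = mild_solution_kg_form[OF mild u' ae f0 f1 g0 g1, folded M_def]
  have eq: "AE \<tau> in lborel. AE y in lborel. v (\<tau>, y) + st_conv kg_K M (\<tau>, y) =
        sp_conv kg_K (enn f1) (\<tau>, y) + sp_conv kg_dt_K (enn f0) (\<tau>, y) + sphere_mean (enn f0) (\<tau>, y)"
    using ae
  proof eventually_elim
    case (elim \<tau>)
    show ?case
    proof (cases "0 \<le> \<tau>")
      case True
      with elim have "AE y in lborel. u \<tau> y = u' (\<tau>, y)" by simp
      with kg[OF True] show ?thesis
        by eventually_elim (use True in \<open>simp add: v_def future_def\<close>)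
    next
      case False
      have "kg_K (\<tau> - s, y - z) * M (s, z) = 0" for s y z
        using False by (cases "s \<ge> 0") (auto simp: M_def future_def kg_kernel_def)
      then have "st_conv kg_K M (\<tau>, y) = 0" for y
        unfolding st_conv_def prod.case by (simp only: nn_integral_const) simp
      moreover have "kg_K (\<tau>, y) = 0" "kg_dt_K (\<tau>, y) = 0" for y
        using False by (auto simp: kg_kernel_def kg_kernel_dt_def)
      ultimately show ?thesis
        using False by (simp add: sp_conv_def sphere_mean_def v_def future_def)
    qed
  qed
  have a: "0 \<le> a" using f0(2,3)[of 0] by linarith
  show ?thesis
    using kg[OF t]
  proof eventually_elim
    case (elim x)
    have fin: "sp_conv kg_K (enn f1) (t, x) < \<infinity>" "sp_conv kg_dt_K (enn f0) (t, x) < \<infinity>"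
       "sphere_mean (enn f0) (t, x) < \<infinity>"
      using sp_conv_kg_finite[of f0 a] sp_conv_kg_finite[of f1 a] f0 f1 a t
        le_less_trans[OF sphere_mean_le[of f0 a] ennreal_less_top] by auto
    have bnd: "ennreal (exp (t / 2) * u t x) + st_conv kg_K M (t, x) \<le> ennreal (4 * a * exp t)"
      unfolding elim by (rule linear_evolution_crude_bound) (use f0 f1 t in auto)
    have "st_conv wave_K M (t, x) \<le> st_conv kg_K M (t, x)"
      by (intro st_conv_mono_left ennreal_leI wave_kernel_le_kg_kernel)
    also have "\<dots> \<le> ennreal (exp (t / 2) * u t x) + st_conv kg_K M (t, x)" by (rule add_increasing) auto
    also note bnd
    finally have "st_conv wave_K M (t, x) < \<infinity>"
      using ennreal_less_top le_less_trans by (metis infinity_ennreal_def)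
    moreover have "ennreal (exp (t / 2) * u t x) \<le> ennreal (4 * a * exp t)"
      using bnd by (rule order_trans[rotated]) simp
    moreover have "4 * ennreal (exp (t / 2) * u t x) + 4 * st_conv wave_K M (t, x) =
     st_conv wave_K v (t, x) + 4 * sp_conv wave_K (enn f1) (t, x) + 4 * sphere_mean (enn f0) (t, x)"
      by (rule wave_form_of_kg_form[OF _ _ _ _ eq elim fin]) (simp_all add: M_def v_def)
    ultimately show ?case by blast
  qed
qed

text \<open>The arithmetic of one iteration step: the source integral \<open>M\<close> is finite and cancels between the
  integrated pointwise inequality and the integral equation.\<close>

lemma ennreal_comparison_step:
  fixes V M s1 s2 :: ennreal
  assumes le: "V + 4 * ennreal IP \<le> ennreal IY + 4 * M + ennreal e" and M: "M < \<infinity>"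
    and eq: "4 * ennreal w + 4 * M = V + 4 * s1 + 4 * s2" and s: "s1 \<le> ennreal b1" "s2 \<le> ennreal b2"
    and nn: "0 \<le> IP" "0 \<le> IY" "0 \<le> e" "0 \<le> b1" "0 \<le> b2"
  shows "w + IP \<le> IY / 4 + e / 4 + b1 + b2"
proof -
  have four: "4 * ennreal r = ennreal (4 * r)" for r by (simp add: ennreal_mult')
  obtain m where m: "M = ennreal m" "0 \<le> m" using M by (cases M) auto
  obtain r1 where r1: "s1 = ennreal r1" "0 \<le> r1" using s(1) by (cases s1) (auto simp: top_unique)
  obtain r2 where r2: "s2 = ennreal r2" "0 \<le> r2" using s(2) by (cases s2) (auto simp: top_unique)
  have rb: "r1 \<le> b1" "r2 \<le> b2" using s nn unfolding r1 r2 by (simp_all add: ennreal_le_iff)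
  have le': "V + ennreal (4 * IP) \<le> ennreal (IY + 4 * m + e)"
    using le nn m(2) unfolding m(1) four by (simp add: ennreal_plus)
  obtain v where v: "V = ennreal v" "0 \<le> v" using le' by (cases V) (auto simp: top_unique)
  have "ennreal (v + 4 * IP) \<le> ennreal (IY + 4 * m + e)"
    using le' nn v(2) unfolding v(1) by (simp add: ennreal_plus)
  then have 1: "v + 4 * IP \<le> IY + 4 * m + e"
    using nn m v by (subst (asm) ennreal_le_iff) auto
  have w: "ennreal w = ennreal (max 0 w)" by (cases "0 \<le> w") (auto simp: ennreal_neg)
  have "ennreal (4 * max 0 w + 4 * m) = ennreal (v + 4 * r1 + 4 * r2)"
    using eq r1(2) r2(2) v(2) m(2) unfolding w m(1) r1(1) r2(1) v(1) four by (simp add: ennreal_plus)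
  then have "4 * max 0 w + 4 * m = v + 4 * r1 + 4 * r2"
    using r1 r2 v m by (subst (asm) ennreal_inj) auto
  then show ?thesis using 1 rb by linarith
qed

text \<open>By induction, \<open>exp (t / 2) * u\<close> exceeds \<open>exp (t / 2) * W t\<close> by at most \<open>4 * a / 4 ^ n * exp t\<close>. In
  the step, \<open>absorption_monotone\<close> turns the bound into one for the difference of the two sources, and
  integrating against the d'Alembert kernel gains the factor 4, because the weight \<open>exp t\<close> satisfies
  \<open>integral {0..t} (\<lambda>\<tau>. (t - \<tau>) * exp \<tau>) \<le> exp t\<close>, while the source contains \<open>v / 4\<close>.\<close>

lemma mild_solution_le_supersolution:
  fixes p :: real
  assumes p: "1 < p" and A: "A powr (p - 1) = 1 / (p - 1)" "0 < A" and T: "4 * p / (p - 1) \<le> T"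
  defines "W \<equiv> \<lambda>t. A * (t + T) powr (- (1 / (p - 1)))"
  assumes a: "a \<le> W 0 / 4"
    and mild: "mild_solution p u0 u1 u"
    and f0: "f0 \<in> borel_measurable borel" "\<And>x. 0 \<le> f0 x" "\<And>x. f0 x \<le> a"
    and f1: "f1 \<in> borel_measurable borel" "\<And>x. 0 \<le> f1 x" "\<And>x. f1 x \<le> a"
    and g0: "AE x in lborel. u0 x = f0 x" and g1: "AE x in lborel. u1 x + 1/2 * u0 x = f1 x"
    and t: "0 \<le> t"
  shows "AE x in lborel. u t x \<le> W t"
proof -
  obtain u' where u': "u' \<in> borel_measurable borel" "\<And>q. 0 \<le> u' q"
    and ae: "AE \<tau> in lborel. 0 \<le> \<tau> \<longrightarrow> (AE y in lborel. u \<tau> y = u' (\<tau>, y))"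
    using mild_solution_borel_version[OF mild] by blast
  note [measurable] = u'(1) f0(1) f1(1)
  have super: "\<And>t. 0 \<le> t \<Longrightarrow> 4 * p * W t powr (p - 1) \<le> 1"
    "\<And>t. 0 \<le> t \<Longrightarrow> a * (1 + t) + integral {0..t} (\<lambda>\<tau>. (t - \<tau>) * (exp (\<tau> / 2) * W \<tau>)) / 4
      \<le> exp (t / 2) * W t + integral {0..t} (\<lambda>\<tau>. (t - \<tau>) * (exp (\<tau> / 2) * W \<tau> powr p))"
    using supersolution[OF p A T a[unfolded W_def]] unfolding W_def by blast+
  have a0: "0 \<le> a" using f0(2,3)[of 0] by linarith
  have "0 < 4 * p / (p - 1)" using p by simp
  then have T0: "0 < T" using T by linarith
  have Wpos: "0 < W t" if "0 \<le> t" for t using A that T0 by (simp add: W_def)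
  have cW: "continuous_on {0..} W"
    unfolding W_def using T0 by (intro continuous_intros) auto
  have cW2: "continuous_on {0..} (\<lambda>\<tau>. W \<tau> powr p)"
    by (intro continuous_intros cW) (use Wpos in force)
  have [measurable]: "W \<in> borel_measurable borel" unfolding W_def by measurable
  let ?M = "future (\<lambda>q. exp (fst q / 2) * u' q powr p)" and ?v = "future (\<lambda>q. exp (fst q / 2) * u' q)"
  let ?Y = "future (\<lambda>q. exp (fst q / 2) * W (fst q))" and ?P = "future (\<lambda>q. exp (fst q / 2) * W (fst q) powr p)"
  let ?E = "future (\<lambda>q. exp (fst q))"
  note wf = mild_solution_wave_form[OF mild u' ae f0 f1 g0 g1]
  have claim: "\<forall>t\<ge>0. AE x in lborel. exp (t / 2) * u t x \<le> exp (t / 2) * W t + 4 * a / 4 ^ n * exp t" for n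
  proof (induction n)
    case 0
    show ?case
    proof (intro allI impI)
      fix t :: real assume t: "0 \<le> t"
      show "AE x in lborel. exp (t / 2) * u t x \<le> exp (t / 2) * W t + 4 * a / 4 ^ 0 * exp t"
        using wf[OF t]
      proof eventually_elim
        case (elim x)
        then have "exp (t / 2) * u t x \<le> 4 * a * exp t" using a0 by (simp add: ennreal_le_iff)
        moreover have "0 \<le> exp (t / 2) * W t" using Wpos[OF t] by simp
        ultimately show ?case by simp
      qed
    qed
  next
    case (Suc n)
    define \<kappa> where "\<kappa> = 4 * a / 4 ^ n"
    have \<kappa>: "0 \<le> \<kappa>" using a0 by (simp add: \<kappa>_def)
    have pw: "AE \<tau> in lborel. AE y in lborel. ?v (\<tau>, y) + 4 * ?P (\<tau>, y) \<le> ?Y (\<tau>, y) + 4 * ?M (\<tau>, y) + ennreal \<kappa> * ?E (\<tau>, y)"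
      using ae
    proof eventually_elim
      case (elim \<tau>)
      show ?case
      proof (cases "0 \<le> \<tau>")
        case True
        with elim have "AE y in lborel. u \<tau> y = u' (\<tau>, y)" by simp
        moreover have "AE y in lborel. exp (\<tau> / 2) * u \<tau> y \<le> exp (\<tau> / 2) * W \<tau> + \<kappa> * exp \<tau>"
          using Suc True by (simp add: \<kappa>_def)
        ultimately show ?thesis
        proof eventually_elim
          case (elim y)
          let ?e = "exp (\<tau> / 2)"
          have e: "?e * ?e = exp \<tau>" by (simp add: exp_add[symmetric])
          have "?e * u' (\<tau>, y) \<le> ?e * (W \<tau> + \<kappa> * ?e)"
            using elim e by (simp add: algebra_simps)
          then have "u' (\<tau>, y) \<le> W \<tau> + \<kappa> * ?e" by simp
          then have "u' (\<tau>, y) + 4 * W \<tau> powr p \<le> W \<tau> + 4 * u' (\<tau>, y) powr p + \<kappa> * ?e"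
            by (intro absorption_monotone[OF p Wpos[OF True] super(1)[OF True] u'(2)]) (use \<kappa> in auto)
          then have "?e * (u' (\<tau>, y) + 4 * W \<tau> powr p) \<le> ?e * (W \<tau> + 4 * u' (\<tau>, y) powr p + \<kappa> * ?e)"
            by (rule mult_left_mono) simp
          then have "?e * u' (\<tau>, y) + 4 * (?e * W \<tau> powr p) \<le> ?e * W \<tau> + 4 * (?e * u' (\<tau>, y) powr p) + \<kappa> * exp \<tau>"
            unfolding e[symmetric] by (simp add: algebra_simps)
          then have "ennreal (?e * u' (\<tau>, y) + 4 * (?e * W \<tau> powr p)) \<le> ennreal (?e * W \<tau> + 4 * (?e * u' (\<tau>, y) powr p) + \<kappa> * exp \<tau>)"
            by (rule ennreal_leI)
          moreover have "4 * ennreal r = ennreal (4 * r)" for r by (simp add: ennreal_mult')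
          moreover have "ennreal \<kappa> * ennreal r = ennreal (\<kappa> * r)" for r using \<kappa> by (simp add: ennreal_mult')
          ultimately show ?case
            using True u' Wpos[OF True] \<kappa> by (simp add: future_def)
        qed
      qed (simp add: future_def)
    qed
    show ?case
    proof (intro allI impI)
      fix t :: real assume t: "0 \<le> t"
      define IY where "IY = integral {0..t} (\<lambda>\<tau>. (t - \<tau>) * (exp (\<tau> / 2) * W \<tau>))"
      define IP where "IP = integral {0..t} (\<lambda>\<tau>. (t - \<tau>) * (exp (\<tau> / 2) * W \<tau> powr p))"
      have sub: "{0..t} \<subseteq> {0..}" by auto
      have W0: "0 \<le> W \<tau>" if "\<tau> \<in> {0..t}" for \<tau> using Wpos[of \<tau>] that by simp
      have I0: "0 \<le> IY" "0 \<le> IP"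
        unfolding IY_def IP_def
        by (intro Henstock_Kurzweil_Integration.integral_nonneg integrable_continuous_real continuous_on_mult
            continuous_on_diff continuous_on_const continuous_on_id continuous_on_subset[OF cW sub] continuous_on_subset[OF cW2 sub]
            continuous_on_exp continuous_on_divide mult_nonneg_nonneg W0; simp)+
      show "AE x in lborel. exp (t / 2) * u t x \<le> exp (t / 2) * W t + 4 * a / 4 ^ Suc n * exp t"
        using wf[OF t]
      proof eventually_elim
        case (elim x)
        have Y: "st_conv wave_K ?Y (t, x) = ennreal IY" unfolding IY_def
          by (rule st_conv_wave_time_function[where h = "\<lambda>\<tau>. exp (\<tau> / 2) * W \<tau>"])
            (auto intro!: continuous_intros cW mult_nonneg_nonneg less_imp_le[OF Wpos])
        have P: "st_conv wave_K ?P (t, x) = ennreal IP" unfolding IP_def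
          by (rule st_conv_wave_time_function[where h = "\<lambda>\<tau>. exp (\<tau> / 2) * W \<tau> powr p"])
            (auto intro!: continuous_intros cW2)
        have "integral {0..t} (\<lambda>\<tau>. (t - \<tau>) * exp \<tau>) = exp t - exp 0 - t * exp 0"
          by (intro integral_unique Taylor_integral_remainder t DERIV_exp)
        then have E: "st_conv wave_K ?E (t, x) = ennreal (exp t - 1 - t)"
          using st_conv_wave_time_function[of exp t x] continuous_on_exp[OF continuous_on_id] by auto
        have et: "0 \<le> exp t - 1 - t" using exp_ge_add_one_self[of t] by linarith
        have c1: "st_conv wave_K ?v (t, x) + 4 * ennreal IP \<le> ennreal IY + 4 * st_conv wave_K ?M (t, x) + ennreal \<kappa> * ennreal (exp t - 1 - t)"
          using st_conv_mono_AE[OF pw, of wave_K "(t, x)"]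
          by (simp add: st_conv_add_right st_conv_cmult_right Y P E)
        have f1b: "sp_conv wave_K (enn f1) (t, x) \<le> ennreal (2 * t * (1/2) * a)"
          using a0 f1 t by (intro sp_conv_le) (auto simp: wave_kernel_def split: split_indicator)
        have "exp (t / 2) * u t x + IP \<le> IY / 4 + \<kappa> * (exp t - 1 - t) / 4 + 2 * t * (1/2) * a + a"
        proof (rule ennreal_comparison_step)
          show "st_conv wave_K ?v (t, x) + 4 * ennreal IP \<le> ennreal IY + 4 * st_conv wave_K ?M (t, x) + ennreal (\<kappa> * (exp t - 1 - t))"
            using c1 \<kappa> by (simp only: ennreal_mult')
          show "sphere_mean (enn f0) (t, x) \<le> ennreal a"
            by (rule sphere_mean_le[OF f0(2,3)])
          show "0 \<le> \<kappa> * (exp t - 1 - t)" using \<kappa> et by (rule mult_nonneg_nonneg)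
          show "0 \<le> 2 * t * (1/2) * a" using a0 t by simp
        qed (use elim f1b I0 a0 in \<open>blast+\<close>)
        moreover have "\<kappa> * (exp t - 1 - t) \<le> \<kappa> * exp t" using \<kappa> t by (intro mult_left_mono) auto
        moreover have "a * (1 + t) + IY / 4 \<le> exp (t / 2) * W t + IP"
          unfolding IY_def IP_def by (rule super(2)[OF t])
        moreover have "a * (1 + t) = 2 * t * (1/2) * a + a" "\<kappa> / 4 * exp t = \<kappa> * exp t / 4"
          by (simp_all add: algebra_simps)
        ultimately have "exp (t / 2) * u t x \<le> exp (t / 2) * W t + \<kappa> / 4 * exp t"
          by linarith
        then show ?case by (simp add: \<kappa>_def)
      qed
    qed
  qed
  have "AE x in lborel. \<forall>n. exp (t / 2) * u t x \<le> exp (t / 2) * W t + 4 * a / 4 ^ n * exp t"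
    unfolding AE_all_countable using claim t by blast
  then show ?thesis
  proof eventually_elim
    case (elim x)
    have "(\<lambda>n. exp (t / 2) * W t + 4 * a * exp t * (1/4) ^ n) \<longlonglongrightarrow> exp (t / 2) * W t + 4 * a * exp t * 0"
      by (intro tendsto_intros LIMSEQ_power_zero) auto
    moreover have "exp (t / 2) * u t x \<le> exp (t / 2) * W t + 4 * a * exp t * (1/4) ^ n" for n
      using elim[rule_format, of n] by (simp add: power_divide)
    ultimately have "exp (t / 2) * u t x \<le> exp (t / 2) * W t"
      using LIMSEQ_le_const by fastforce
    then show ?case by simp
  qed
qed

section \<open>The linear bound and the main estimate\<close>

text \<open>A unit of time adds at least \<open>t / 8\<close> to the argument \<open>(t\<^sup>2 - y\<^sup>2) / 16\<close>, and the tangent estimate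
  turns this into a gain that dominates \<open>kg_kernel_dt\<close>.\<close>

lemma kg_kernel_later:
  "kg_kernel (t, y) \<le> kg_kernel (t + 1, y)" "kg_kernel_dt (t, y) \<le> kg_kernel (t + 1, y)"
proof -
  have "kg_kernel (t, y) \<le> kg_kernel (t + 1, y) \<and> kg_kernel_dt (t, y) \<le> kg_kernel (t + 1, y)" if y: "\<bar>y\<bar> \<le> t"
  proof -
    let ?w = "(t\<^sup>2 - y\<^sup>2) / 16"
    have t: "0 \<le> t" using y by linarith
    have w: "0 \<le> ?w" using cone_nonneg[OF y] by simp
    have "?w + t / 8 \<le> ((t + 1)\<^sup>2 - y\<^sup>2) / 16" by (simp add: power2_eq_square field_simps)
    then have "bessel_clifford 0 (?w + t / 8) \<le> bessel_clifford 0 (((t + 1)\<^sup>2 - y\<^sup>2) / 16)"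
      using w t by (intro bessel_clifford_mono) auto
    moreover have "bessel_clifford 0 ?w + t / 8 * bessel_clifford 1 ?w \<le> bessel_clifford 0 (?w + t / 8)"
      using w t by (intro bessel_clifford_tangent) auto
    moreover have "0 \<le> bessel_clifford 0 ?w" "0 \<le> t / 8 * bessel_clifford 1 ?w"
      using w t by (auto intro!: mult_nonneg_nonneg bessel_clifford_nonneg)
    ultimately show ?thesis using y by (auto simp: kg_kernel_def kg_kernel_dt_def)
  qed
  then show "kg_kernel (t, y) \<le> kg_kernel (t + 1, y)" "kg_kernel_dt (t, y) \<le> kg_kernel (t + 1, y)"
    using kernel_nonneg(2)[of "(t + 1, y)"] by (cases "\<bar>y\<bar> \<le> t"; simp add: kg_kernel_def kg_kernel_dt_def)+
qed

text \<open>In the Bessel variable \<open>z = sqrt (t\<^sup>2 - y\<^sup>2) / 2\<close>, the time \<open>2 * h\<close> advances \<open>z\<close> by at least \<open>h\<close>,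
  because \<open>z \<le> t / 2\<close>.\<close>

lemma kg_kernel_growth:
  assumes h: "1 \<le> h"
  shows "exp (h - 1/2) / (pi * sqrt h) * kg_kernel (t, y) \<le> kg_kernel (t + 2 * h, y)"
proof (cases "\<bar>y\<bar> \<le> t")
  case True
  have t: "0 \<le> t" using True by linarith
  define z where "z = sqrt (t\<^sup>2 - y\<^sup>2) / 2"
  have z: "0 \<le> z" "z\<^sup>2 = (t\<^sup>2 - y\<^sup>2) / 4" using cone_nonneg[OF True] by (simp_all add: z_def power_divide)
  have "z\<^sup>2 \<le> (t / 2)\<^sup>2" using z(2) by (simp add: power_divide)
  then have "z \<le> t / 2" by (rule power2_le_imp_le) (use t in simp)
  then have "2 * z * h \<le> t * h" using h by (intro mult_right_mono) auto
  then have "(z + h)\<^sup>2 / 4 \<le> ((t + 2 * h)\<^sup>2 - y\<^sup>2) / 16"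
    using z(2) by (simp add: power2_sum power_mult_distrib)
  then have "bessel_clifford 0 ((z + h)\<^sup>2 / 4) \<le> bessel_clifford 0 (((t + 2 * h)\<^sup>2 - y\<^sup>2) / 16)"
    by (intro bessel_clifford_mono) auto
  moreover have "exp (h - 1/2) / (pi * sqrt h) * bessel_clifford 0 (z\<^sup>2 / 4) \<le> bessel_clifford 0 ((z + h)\<^sup>2 / 4)"
    by (rule bessel_clifford_growth[OF z(1) h])
  ultimately show ?thesis
    using True h by (simp add: kg_kernel_def z(2))
next
  case False
  then have "kg_kernel (t, y) = 0" by (simp add: kg_kernel_def)
  then show ?thesis by simp
qed

text \<open>The one-sided intervals are kept apart, because the one to the right of \<open>x + t\<close> and the one to the
  left of \<open>x - t\<close> are disjoint for every \<open>t \<ge> 0\<close>.\<close>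

lemma local_average_bound:
  fixes f \<phi> :: "real \<Rightarrow> real"
  assumes [measurable]: "f \<in> borel_measurable borel" and \<phi>: "AE x in lborel. \<phi> x = f x" "\<And>x. 0 < \<phi> x"
    and C: "0 < C" "AE x in lborel. \<forall>y. \<bar>y - x\<bar> < 1 \<longrightarrow> \<phi> x \<le> C * \<phi> y"
  shows "AE x in lborel. ennreal (f x) \<le> ennreal C * (\<integral>\<^sup>+y. indicator {x<..<x + 1} y * ennreal (f y) \<partial>lborel)"
    and "AE x in lborel. ennreal (f x) \<le> ennreal C * (\<integral>\<^sup>+y. indicator {x - 1<..<x} y * ennreal (f y) \<partial>lborel)"
proof -
  have *: "ennreal (f x) \<le> ennreal C * (\<integral>\<^sup>+y. indicator I y * ennreal (f y) \<partial>lborel)"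
    if x: "\<phi> x = f x" "\<forall>y. \<bar>y - x\<bar> < 1 \<longrightarrow> \<phi> x \<le> C * \<phi> y" and I: "I \<subseteq> {x - 1<..<x + 1}" "I \<in> sets borel" "emeasure lborel I = 1" for x I
  proof -
    have "ennreal (f x) = (\<integral>\<^sup>+y. ennreal (f x) * indicator I y \<partial>lborel)"
      using I by (simp add: nn_integral_cmult)
    also have "\<dots> \<le> (\<integral>\<^sup>+y. ennreal C * (indicator I y * ennreal (f y)) \<partial>lborel)"
    proof (rule nn_integral_mono_AE)
      show "AE y in lborel. ennreal (f x) * indicator I y \<le> ennreal C * (indicator I y * ennreal (f y))"
        using \<phi>(1)
      proof eventually_elim
        case (elim y)
        show ?case
        proof (cases "y \<in> I")
          case True
          then have "y \<in> {x - 1<..<x + 1}" using I(1) by blast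
          then have "x - 1 < y" "y < x + 1" by auto
          then have "\<bar>y - x\<bar> < 1" by linarith
          then have "f x \<le> C * f y" using x elim by metis
          then have "ennreal (f x) \<le> ennreal C * ennreal (f y)" using C by (simp add: ennreal_mult'[symmetric] ennreal_leI)
          then show ?thesis using True by simp
        qed simp
      qed
    qed
    also have "\<dots> = ennreal C * (\<integral>\<^sup>+y. indicator I y * ennreal (f y) \<partial>lborel)"
      using I(2) by (intro nn_integral_cmult) auto
    finally show ?thesis .
  qed
  show "AE x in lborel. ennreal (f x) \<le> ennreal C * (\<integral>\<^sup>+y. indicator {x<..<x + 1} y * ennreal (f y) \<partial>lborel)"
    using \<phi>(1) C(2) by eventually_elim (rule *, auto)
  show "AE x in lborel. ennreal (f x) \<le> ennreal C * (\<integral>\<^sup>+y. indicator {x - 1<..<x} y * ennreal (f y) \<partial>lborel)"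
    using \<phi>(1) C(2) by eventually_elim (rule *, auto)
qed

text \<open>The unit intervals just outside \<open>x + t\<close> and \<open>x - t\<close> are disjoint and lie in the domain of dependence
  at time \<open>t + 1\<close>, where the kernel is at least 1/2.\<close>

lemma sphere_mean_le_sp_conv_kg:
  assumes [measurable]: "f \<in> borel_measurable borel" and \<phi>: "AE x in lborel. \<phi> x = f x" "\<And>x. 0 < \<phi> x"
    and C: "0 < C" "AE x in lborel. \<forall>y. \<bar>y - x\<bar> < 1 \<longrightarrow> \<phi> x \<le> C * \<phi> y" and t: "0 \<le> t"
  shows "AE x in lborel. sphere_mean (enn f) (t, x) \<le> ennreal C * sp_conv kg_K (enn f) (t + 1, x)"
  using AE_affine[OF local_average_bound(1)[OF assms(1) \<phi> C] one_neq_zero, of t]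
    AE_affine[OF local_average_bound(2)[OF assms(1) \<phi> C] one_neq_zero, of "- t"]
proof eventually_elim
  case (elim x)
  let ?i1 = "\<lambda>y. indicator {x + t<..<x + t + 1} y :: ennreal" and ?i2 = "\<lambda>y. indicator {x - t - 1<..<x - t} y :: ennreal"
  have 1: "ennreal (f (x + t)) \<le> ennreal C * (\<integral>\<^sup>+y. ?i1 y * ennreal (f y) \<partial>lborel)"
    using elim(1) by (simp add: add_ac)
  have 2: "ennreal (f (x - t)) \<le> ennreal C * (\<integral>\<^sup>+y. ?i2 y * ennreal (f y) \<partial>lborel)"
    using elim(2) by (simp add: algebra_simps)
  have "sphere_mean (enn f) (t, x) = ennreal (1/2) * (ennreal (f (x + t)) + ennreal (f (x - t)))"
    using t by (simp add: sphere_mean_def)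
  also have "\<dots> \<le> ennreal (1/2) * (ennreal C * (\<integral>\<^sup>+y. ?i1 y * ennreal (f y) \<partial>lborel) + ennreal C * (\<integral>\<^sup>+y. ?i2 y * ennreal (f y) \<partial>lborel))"
    by (intro mult_left_mono add_mono 1 2) auto
  also have "\<dots> = ennreal C * (\<integral>\<^sup>+y. ennreal (1/2) * ((?i1 y + ?i2 y) * ennreal (f y)) \<partial>lborel)"
    by (simp add: nn_integral_add nn_integral_cmult distrib_right) (simp add: distrib_left mult.left_commute)
  also have "\<dots> = ennreal C * (\<integral>\<^sup>+y. ennreal (1/2) * (?i1 y + ?i2 y) * ennreal (f y) \<partial>lborel)"
    by (simp only: mult.assoc)
  also have "\<dots> \<le> ennreal C * sp_conv kg_K (enn f) (t + 1, x)"
    unfolding sp_conv_def prod.case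
  proof (intro mult_left_mono nn_integral_mono mult_right_mono)
    fix y
    show "ennreal (1/2) * (?i1 y + ?i2 y) \<le> ennreal (kg_kernel (t + 1, x - y))"
    proof (cases "\<bar>x - y\<bar> \<le> t + 1")
      case True
      then have "1/2 \<le> kg_kernel (t + 1, x - y)"
        using wave_kernel_le_kg_kernel[of "(t + 1, x - y)"] by (simp add: wave_kernel_def)
      then have "ennreal (1/2) \<le> ennreal (kg_kernel (t + 1, x - y))" by (rule ennreal_leI)
      moreover have "?i1 y + ?i2 y \<le> 1" using t by (auto split: split_indicator)
      then have "ennreal (1/2) * (?i1 y + ?i2 y) \<le> ennreal (1/2) * 1" by (rule mult_left_mono) simp
      ultimately show ?thesis by (metis mult_1_right order_trans)
    next
      case False
      then have "?i1 y = 0" "?i2 y = 0" using t by (auto split: split_indicator)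
      then show ?thesis by simp
    qed
  qed auto
  finally show ?case .
qed

text \<open>All three parts of the linear evolution of the data are dominated by the convolution of \<open>f\<close> with
  \<open>kg_kernel\<close> at time \<open>t + 1\<close>, and \<open>kg_kernel_growth\<close> leads from there to time \<open>t + 1 + 2 * h\<close>.\<close>

lemma mild_solution_linear_bound:
  assumes mild: "mild_solution p u0 u1 u"
    and f0: "f0 \<in> borel_measurable borel" "\<And>x. 0 \<le> f0 x" "\<And>x. f0 x \<le> a"
    and f1: "f1 \<in> borel_measurable borel" "\<And>x. 0 \<le> f1 x" "\<And>x. f1 x \<le> a"
    and g0: "AE x in lborel. u0 x = f0 x" and g1: "AE x in lborel. u1 x + 1/2 * u0 x = f1 x"
    and f: "f \<in> borel_measurable borel" "\<And>x. 0 \<le> f x" "\<And>x. f x \<le> B"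
    and \<phi>: "AE x in lborel. \<phi> x = f x" "\<And>x. 0 < \<phi> x"
    and C: "0 < C" "AE x in lborel. \<forall>y. \<bar>y - x\<bar> < 1 \<longrightarrow> \<phi> x \<le> C * \<phi> y"
    and \<eta>: "0 \<le> \<eta>" "AE x in lborel. f0 x \<le> \<eta> * f x" "AE x in lborel. f1 x \<le> \<eta> * f x"
    and h: "1 \<le> h" and t: "0 \<le> t"
  shows "AE x in lborel. exp (t / 2) * u t x \<le>
    \<eta> * (2 + C) * (pi * sqrt h / exp (h - 1/2)) * enn2real (sp_conv kg_K (enn f) (t + 1 + 2 * h, x))"
proof -
  note [measurable] = f0(1) f1(1) f(1)
  have B: "0 \<le> B" using f(2,3)[of 0] by linarith
  obtain u' where u': "u' \<in> borel_measurable borel" "\<And>q. 0 \<le> u' q"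
    and ae: "AE \<tau> in lborel. 0 \<le> \<tau> \<longrightarrow> (AE y in lborel. u \<tau> y = u' (\<tau>, y))"
    using mild_solution_borel_version[OF mild] by blast
  let ?F = "\<lambda>y. ennreal (f y)"
  have sc: "sp_conv K (enn g) (t, x) \<le> ennreal \<eta> * sp_conv kg_K ?F (t + 1, x)"
    if "AE x in lborel. g x \<le> \<eta> * f x" and [measurable]: "K \<in> borel_measurable borel"
      and K: "\<And>y. K (t, y) \<le> ennreal (kg_kernel (t + 1, y))" for g K x
  proof -
    have "sp_conv K (enn g) (t, x) \<le> sp_conv kg_K (\<lambda>y. ennreal \<eta> * ?F y) (t + 1, x)"
    proof (rule sp_conv_mono)
      show "K (t, y) \<le> ennreal (kg_kernel (t + 1, y))" for y by (rule K)
      show "AE y in lborel. ennreal (g y) \<le> ennreal \<eta> * ?F y"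
        using that(1) by eventually_elim (use \<eta>(1) in \<open>simp add: ennreal_mult'[symmetric] ennreal_leI\<close>)
    qed
    then show ?thesis by (simp add: sp_conv_cmult_right)
  qed
  show ?thesis
    using mild_solution_kg_form[OF mild u' ae f0 f1 g0 g1 t] sphere_mean_le_sp_conv_kg[OF f(1) \<phi> C t]
      AE_affine[OF \<eta>(2) one_neq_zero, of t] AE_affine[OF \<eta>(2) one_neq_zero, of "- t"]
  proof eventually_elim
    case (elim x)
    let ?\<Phi> = "sp_conv kg_K ?F (t + 1, x)" and ?\<Psi> = "sp_conv kg_K ?F (t + 1 + 2 * h, x)"
    have "ennreal (exp (t / 2) * u t x) \<le> ennreal (exp (t / 2) * u t x) + st_conv kg_K (future (\<lambda>q. exp (fst q / 2) * u' q powr p)) (t, x)"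
      by (rule add_increasing2) auto
    also have "\<dots> \<le> ennreal \<eta> * ?\<Phi> + ennreal \<eta> * ?\<Phi> + ennreal \<eta> * (ennreal C * ?\<Phi>)"
      unfolding elim(1)
    proof (intro add_mono)
      show "sp_conv kg_K (enn f1) (t, x) \<le> ennreal \<eta> * ?\<Phi>"
        by (rule sc[OF \<eta>(3)]) (auto intro!: ennreal_leI kg_kernel_later)
      show "sp_conv kg_dt_K (enn f0) (t, x) \<le> ennreal \<eta> * ?\<Phi>"
        by (rule sc[OF \<eta>(2)]) (auto intro!: ennreal_leI kg_kernel_later)
      have "sphere_mean (enn f0) (t, x) = ennreal (1/2) * (ennreal (f0 (x + t)) + ennreal (f0 (x - t)))"
        using t by (simp add: sphere_mean_def)
      also have "\<dots> \<le> ennreal (1/2) * (ennreal \<eta> * ennreal (f (x + t)) + ennreal \<eta> * ennreal (f (x - t)))"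
        using elim(3,4) \<eta>(1) by (intro mult_left_mono add_mono) (auto simp: ennreal_mult'[symmetric] add.commute intro!: ennreal_leI)
      also have "\<dots> = ennreal \<eta> * sphere_mean ?F (t, x)"
        using t by (simp add: sphere_mean_def distrib_left mult.left_commute)
      also have "\<dots> \<le> ennreal \<eta> * (ennreal C * ?\<Phi>)"
        by (intro mult_left_mono elim(2)) auto
      finally show "sphere_mean (enn f0) (t, x) \<le> ennreal \<eta> * (ennreal C * ?\<Phi>)" .
    qed
    finally have bnd: "ennreal (exp (t / 2) * u t x) \<le> ennreal \<eta> * ?\<Phi> + ennreal \<eta> * ?\<Phi> + ennreal \<eta> * (ennreal C * ?\<Phi>)" .
    let ?c = "exp (h - 1/2) / (pi * sqrt h)"
    have c: "0 < ?c" using h by simp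
    have growth: "ennreal ?c * ?\<Phi> \<le> ?\<Psi>"
    proof -
      have "ennreal ?c * ?\<Phi> = sp_conv (\<lambda>p. ennreal ?c * kg_K p) ?F (t + 1, x)"
        by (rule sp_conv_cmult_left[symmetric]) auto
      also have "\<dots> \<le> ?\<Psi>"
        using kg_kernel_growth[OF h, of "t + 1"] c
        by (intro sp_conv_mono) (auto simp: ennreal_mult'[symmetric] add_ac intro!: ennreal_leI simp del: times_divide_eq_left)
      finally show ?thesis .
    qed
    have "?\<Phi> < \<infinity>" "?\<Psi> < \<infinity>" by (rule sp_conv_kg_finite[OF f(3) B]; use t h in simp)+
    then obtain r s where r: "?\<Phi> = ennreal r" "0 \<le> r" and s: "?\<Psi> = ennreal s" "0 \<le> s"
      by (cases ?\<Phi>; cases ?\<Psi>) auto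
    have "ennreal (?c * r) = ennreal ?c * ennreal r" using c by (intro ennreal_mult' less_imp_le)
    then have "ennreal (?c * r) \<le> ennreal s" using growth unfolding r(1) s(1) by (simp only:)
    then have cr: "?c * r \<le> s" using s(2) by (simp add: ennreal_le_iff)
    then have "r \<le> (pi * sqrt h / exp (h - 1/2)) * s" using c h by (simp add: field_simps)
    have "ennreal \<eta> * ennreal r + ennreal \<eta> * ennreal r + ennreal \<eta> * (ennreal C * ennreal r) =
        ennreal (\<eta> * r + \<eta> * r + \<eta> * (C * r))"
      using \<eta>(1) C(1) r(2) by (simp add: ennreal_mult'[symmetric] ennreal_plus[symmetric] del: ennreal_plus)
    with bnd have "ennreal (exp (t / 2) * u t x) \<le> ennreal (\<eta> * r + \<eta> * r + \<eta> * (C * r))"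
      unfolding r(1) by (simp only:)
    then have "exp (t / 2) * u t x \<le> \<eta> * r + \<eta> * r + \<eta> * (C * r)"
      using \<eta>(1) C(1) r(2) by (subst (asm) ennreal_le_iff) auto
    also have "\<dots> = \<eta> * (2 + C) * r" by (simp add: algebra_simps)
    also have "\<dots> \<le> \<eta> * (2 + C) * ((pi * sqrt h / exp (h - 1/2)) * s)"
      using \<eta>(1) C(1) \<open>r \<le> _\<close> by (intro mult_left_mono) auto
    finally show ?case using s by (simp add: mult.assoc)
  qed
qed

text \<open>In \<open>S s \<phi> + dt_S s \<phi>\<close> the damping removes only half of \<open>S s \<phi>\<close>, and the rest of the time
  derivative is non-negative.\<close>

lemma u_L_ge:
  assumes f: "f \<in> borel_measurable borel" "\<And>x. 0 \<le> f x" "\<And>x. f x \<le> B"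
    and \<phi>: "AE x in lborel. \<phi> x = f x" and s: "0 \<le> s" and e: "0 \<le> e"
  shows "AE x in lborel. e / 2 * (exp (- s / 2) * enn2real (sp_conv kg_K (enn f) (s, x))) \<le> u_L e \<phi> s x"
  using AE_dt_S[OF f \<phi> s]
proof eventually_elim
  case (elim x)
  have S: "S s \<phi> x = exp (- s / 2) * enn2real (sp_conv kg_K (enn f) (s, x))"
    by (rule S_eq_sp_conv[OF f(1,2) \<phi>])
  have "0 \<le> exp (- s / 2) * ((f (x + s) + f (x - s)) / 2 + enn2real (sp_conv kg_dt_K (enn f) (s, x)))"
    using f by (intro mult_nonneg_nonneg add_nonneg_nonneg) auto
  then have "S s \<phi> x / 2 \<le> S s \<phi> x + dt_S s \<phi> x" unfolding elim by simp
  then have "e * (S s \<phi> x / 2) \<le> e * (S s \<phi> x + dt_S s \<phi> x)" using e by (rule mult_left_mono)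
  then show ?case unfolding u_L_def S[symmetric] by (simp add: algebra_simps)
qed

text \<open>The two cases \<open>s * L powr (p - 1) \<le> 1\<close> and \<open>> 1\<close> decide which of the two summands in the
  denominator is dominant; the factor \<open>2 powr (1 / (p - 1))\<close> accounts for the other one.\<close>

lemma interpolation_bound:
  fixes p c s L w :: real
  assumes p: "1 < p" and c: "0 \<le> c" and s: "0 < s" and L: "0 \<le> L"
    and w: "w \<le> c * L" "w \<le> c * s powr (- (1 / (p - 1)))"
  shows "w \<le> 2 powr (1 / (p - 1)) * c * (L powr (p - 1) / (s * L powr (p - 1) + 1)) powr (1 / (p - 1))"
proof -
  define m where "m = 1 / (p - 1)"
  have m: "0 < m" "(p - 1) * m = 1" using p by (simp_all add: m_def)
  define Q where "Q = L powr (p - 1)"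
  have Q: "0 \<le> Q" by (simp add: Q_def)
  have half: "2 powr m * c * ((1/2) * z) powr m = c * z powr m" if "0 \<le> z" for z
    using that by (simp add: powr_mult powr_divide)
  show ?thesis
  proof (cases "s * Q \<le> 1")
    case True
    have "0 < s * Q + 1" using s Q by (simp add: add_nonneg_pos)
    then have "1/2 * Q \<le> Q / (s * Q + 1)"
      using True Q divide_left_mono[of "s * Q + 1" 2 Q] by simp
    then have "(1/2 * Q) powr m \<le> (Q / (s * Q + 1)) powr m" using Q m by (intro powr_mono2) auto
    then have "2 powr m * c * ((1/2) * Q) powr m \<le> 2 powr m * c * (Q / (s * Q + 1)) powr m"
      using c by (intro mult_left_mono) auto
    moreover have "Q powr m = L" using L m by (simp add: Q_def powr_powr)
    then have "w \<le> 2 powr m * c * ((1/2) * Q) powr m" unfolding half[OF Q] using w by simp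
    ultimately show ?thesis unfolding m_def[symmetric] Q_def[symmetric] by linarith
  next
    case False
    then have "1/2 * (1 / s) \<le> Q / (s * Q + 1)" using s Q by (simp add: field_simps)
    then have "(1/2 * (1 / s)) powr m \<le> (Q / (s * Q + 1)) powr m" using s m by (intro powr_mono2) auto
    then have "2 powr m * c * (1/2 * (1 / s)) powr m \<le> 2 powr m * c * (Q / (s * Q + 1)) powr m"
      using c by (intro mult_left_mono) auto
    moreover have "(1 / s) powr m = s powr (- m)" using s by (simp add: powr_minus_divide powr_divide)
    then have "w \<le> c * (1 / s) powr m" using w(2) by (simp only: m_def)
    then have "w \<le> 2 powr m * c * (1/2 * (1 / s)) powr m"
      by (subst half) (use s in auto)
    ultimately show ?thesis unfolding m_def[symmetric] Q_def[symmetric] by linarith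
  qed
qed

theorem theorem1p1:
  fixes p :: real and \<phi> \<phi>' :: "real \<Rightarrow> real"
  assumes "p > 1"
    and "\<phi> \<in> W1 L1 \<inter> W1 Linf"
    and "\<forall>x. 0 < \<phi> x"
    and "has_weak_derivative \<phi> \<phi>'"
    and "\<exists>C. (AE x in lebesgue. \<phi> x \<le> C * (INF y\<in>{x - 1<..<x + 1}. \<phi> y)) \<and>
             (AE x in lebesgue. \<phi> x \<le> C * (INF y\<in>{y. \<bar>y\<bar> < 2 * \<bar>x\<bar>}. \<phi> y)) \<and>
             (AE x in lebesgue. \<bar>\<phi>' x\<bar> \<le> C * \<phi> x)"
    and "\<forall>\<delta>>0. \<exists>C\<^sub>\<delta>>0. AE x in lebesgue. exp (- \<delta> * \<bar>x\<bar>) \<le> C\<^sub>\<delta> * \<phi> x"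
  shows "\<exists>C>0. \<exists>T\<^sub>0>0. \<exists>\<epsilon>\<^sub>0>0. \<forall>u\<^sub>0 u\<^sub>1.
           u\<^sub>0 \<in> W1 L1 \<inter> W1 Linf \<longrightarrow> u\<^sub>1 \<in> L1 \<inter> Linf \<longrightarrow>
           (AE x in lebesgue. 0 \<le> u\<^sub>0 x \<and>
              u\<^sub>0 x \<le> C * (\<epsilon>\<^sub>0 / T\<^sub>0 powr (p - 1/2)) * \<phi> x) \<longrightarrow>
           (AE x in lebesgue. 0 \<le> u\<^sub>1 x + 1/2 * u\<^sub>0 x \<and>
              u\<^sub>1 x + 1/2 * u\<^sub>0 x \<le> C * (\<epsilon>\<^sub>0 / T\<^sub>0 powr (p - 1/2)) * \<phi> x) \<longrightarrow>
           (\<forall>u. mild_solution p u\<^sub>0 u\<^sub>1 u \<longrightarrow>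
              (\<forall>t\<ge>0. AE x in lebesgue. 0 \<le> u t x \<and>
                 u t x \<le> C * (u_L \<epsilon>\<^sub>0 \<phi> (t + T\<^sub>0) x powr (p - 1) /
                   ((t + T\<^sub>0) * u_L \<epsilon>\<^sub>0 \<phi> (t + T\<^sub>0) x powr (p - 1) + 1)) powr (1 / (p - 1))))"
proof -
  define m where "m = 1 / (p - 1)"
  have m: "0 < m" "m * (p - 1) = 1" "(p - 1) * m = 1" using assms(1) by (simp_all add: m_def)
  define A where "A = m powr m"
  have A: "0 < A" "A powr (p - 1) = 1 / (p - 1)" using m by (simp_all add: A_def powr_powr m_def)
  define C where "C = 2 powr m * A"
  have C: "0 < C" using A by (simp add: C_def)
  obtain C1 where C1: "AE x in lebesgue. \<phi> x \<le> C1 * (INF y\<in>{x - 1<..<x + 1}. \<phi> y)" using assms(5) by blast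
  \<comment> \<open>Enlarging the constant makes its sign known before the infimum is replaced by a value.\<close>
  define K where "K = max 1 C1"
  have K: "0 < K" "AE x in lborel. \<forall>y. \<bar>y - x\<bar> < 1 \<longrightarrow> \<phi> x \<le> K * \<phi> y"
  proof -
    show "0 < K" by (simp add: K_def)
    show "AE x in lborel. \<forall>y. \<bar>y - x\<bar> < 1 \<longrightarrow> \<phi> x \<le> K * \<phi> y"
      using C1 unfolding AE_completion_iff
    proof (eventually_elim, intro allI impI)
      fix x y :: real
      assume x: "\<phi> x \<le> C1 * (INF y\<in>{x - 1<..<x + 1}. \<phi> y)" and y: "\<bar>y - x\<bar> < 1"
      let ?i = "INF y\<in>{x - 1<..<x + 1}. \<phi> y"
      have "0 \<le> ?i" by (rule cINF_greatest) (use assms(3) in \<open>auto intro: less_imp_le\<close>)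
      then have "C1 * ?i \<le> K * ?i" by (intro mult_right_mono) (auto simp: K_def)
      moreover have "?i \<le> \<phi> y"
        by (rule cINF_lower) (use y assms(3) in \<open>auto intro!: bdd_belowI[of _ 0] less_imp_le\<close>)
      then have "K * ?i \<le> K * \<phi> y" using \<open>0 < K\<close> by simp
      ultimately show "\<phi> x \<le> K * \<phi> y" using x by linarith
    qed
  qed
  have "\<phi> \<in> Linf" using assms(2) by (simp add: W1_def)
  then obtain B0 where \<phi>m: "\<phi> \<in> borel_measurable lebesgue" and B0: "AE x in lborel. \<bar>\<phi> x\<bar> \<le> B0"
    by (auto simp: Linf_def AE_completion_iff)
  define B where "B = max 1 B0"
  have B: "0 < B" by (simp add: B_def)
  have "AE x in lborel. 0 \<le> \<phi> x \<and> \<phi> x \<le> B"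
    using B0 by eventually_elim (use assms(3) in \<open>auto simp: B_def intro: less_imp_le\<close>)
  from ex_borel_representative[OF \<phi>m this] B obtain f where
    f: "f \<in> borel_measurable borel" "\<And>x. 0 \<le> f x" "\<And>x. f x \<le> B" and \<phi>f: "AE x in lborel. \<phi> x = f x" by auto
  define D where "D = 2 * (2 + K) * pi * exp 1"
  have D: "0 < D" using K by (simp add: D_def)
  \<comment> \<open>The three bounds give \<open>h \<ge> 1\<close>, the supersolution, and absorption of all constants of the linear bound.\<close>
  define T where "T = max 3 (max (4 * p / (p - 1)) ((2 powr m * D) powr m))"
  have T: "3 \<le> T" "4 * p / (p - 1) \<le> T" "(2 powr m * D) powr m \<le> T" by (simp_all add: T_def)
  then have T0: "0 < T" by linarith
  have TD: "2 powr m * D \<le> T powr (p - 1)"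
  proof -
    have "((2 powr m * D) powr m) powr (p - 1) \<le> T powr (p - 1)"
      using T assms(1) by (intro powr_mono2) auto
    moreover have "((2 powr m * D) powr m) powr (p - 1) = 2 powr m * D"
      using m D by (simp only: powr_powr) simp
    ultimately show ?thesis by simp
  qed
  \<comment> \<open>Chosen so that the data lie below \<open>W 0 / 4\<close>, see the value of \<open>\<eta> * B\<close> below.\<close>
  define \<epsilon> where "\<epsilon> = A * T powr (- m) / 4 * T powr (p - 1/2) / (C * B)"
  have \<epsilon>: "0 < \<epsilon>" using A T0 B C by (simp add: \<epsilon>_def)
  define \<eta> where "\<eta> = C * (\<epsilon> / T powr (p - 1/2))"
  have \<eta>: "0 < \<eta>" using \<epsilon> C T0 by (simp add: \<eta>_def)
  have \<eta>B: "\<eta> * B = A * (0 + T) powr (- (1 / (p - 1))) / 4"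
    using C B T0 by (simp add: \<eta>_def \<epsilon>_def m_def)
  \<comment> \<open>The time shift is split as \<open>T = 1 + 2 * h\<close>.\<close>
  define h where "h = (T - 1) / 2"
  have h: "1 \<le> h" "h \<le> T" using T by (simp_all add: h_def)
  show ?thesis
  proof (rule exI[of _ C], intro conjI C, rule exI[of _ T], intro conjI T0, rule exI[of _ \<epsilon>], intro conjI \<epsilon> allI impI)
    fix u0 u1 :: "real \<Rightarrow> real" and u :: "real \<Rightarrow> real \<Rightarrow> real" and t :: real
    assume u0: "u0 \<in> W1 L1 \<inter> W1 Linf" and u1: "u1 \<in> L1 \<inter> Linf"
      and b0: "AE x in lebesgue. 0 \<le> u0 x \<and> u0 x \<le> C * (\<epsilon> / T powr (p - 1 / 2)) * \<phi> x"
      and b1: "AE x in lebesgue. 0 \<le> u1 x + 1 / 2 * u0 x \<and> u1 x + 1 / 2 * u0 x \<le> C * (\<epsilon> / T powr (p - 1 / 2)) * \<phi> x"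
      and mild: "mild_solution p u0 u1 u" and t: "0 \<le> t"
    note b0 = b0[unfolded AE_completion_iff, folded \<eta>_def] and b1 = b1[unfolded AE_completion_iff, folded \<eta>_def]
    have m0: "u0 \<in> borel_measurable lebesgue" using u0 by (auto simp: W1_def Linf_def)
    have "u1 \<in> borel_measurable lebesgue" using u1 by (auto simp: Linf_def)
    with m0 have m1: "(\<lambda>x. u1 x + 1/2 * u0 x) \<in> borel_measurable lebesgue"
      by (intro borel_measurable_add borel_measurable_times) auto
    have \<eta>f: "\<eta> * f x \<le> \<eta> * B" for x using f(3) \<eta> by simp
    have \<eta>B0: "0 \<le> \<eta> * B" using \<eta> B by simp
    have "AE x in lborel. 0 \<le> u0 x \<and> u0 x \<le> \<eta> * B"
      using b0 \<phi>f by eventually_elim (use \<eta>f order_trans in auto)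
    from ex_borel_representative[OF m0 this \<eta>B0] obtain f0 where
      f0: "f0 \<in> borel_measurable borel" "\<And>x. 0 \<le> f0 x" "\<And>x. f0 x \<le> \<eta> * B" and g0: "AE x in lborel. u0 x = f0 x" by blast
    have "AE x in lborel. 0 \<le> u1 x + 1/2 * u0 x \<and> u1 x + 1/2 * u0 x \<le> \<eta> * B"
      using b1 \<phi>f by eventually_elim (use \<eta>f order_trans in auto)
    from ex_borel_representative[OF m1 this \<eta>B0] obtain f1 where
      f1: "f1 \<in> borel_measurable borel" "\<And>x. 0 \<le> f1 x" "\<And>x. f1 x \<le> \<eta> * B" and g1: "AE x in lborel. u1 x + 1/2 * u0 x = f1 x" by blast
    have l0: "AE x in lborel. f0 x \<le> \<eta> * f x" using b0 \<phi>f g0 by eventually_elim auto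
    have l1: "AE x in lborel. f1 x \<le> \<eta> * f x" using b1 \<phi>f g1 by eventually_elim auto
    have pos: "AE x in lborel. 0 \<le> u t x" using mild t by (auto simp: mild_solution_def AE_completion_iff)
    have ode: "AE x in lborel. u t x \<le> A * (t + T) powr (- (1 / (p - 1)))"
      by (rule mild_solution_le_supersolution[OF assms(1) A(2,1) T(2) _ mild f0 f1 g0 g1 t]) (simp add: \<eta>B)
    have lin: "AE x in lborel. exp (t / 2) * u t x \<le>
        \<eta> * (2 + K) * (pi * sqrt h / exp (h - 1/2)) * enn2real (sp_conv kg_K (enn f) (t + 1 + 2 * h, x))"
      by (rule mild_solution_linear_bound[OF mild f0 f1 g0 g1 f \<phi>f _ K _ l0 l1 h(1) t]) (use assms(3) \<eta> in auto)
    have th: "t + 1 + 2 * h = t + T" by (simp add: h_def field_simps)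
    have uL: "AE x in lborel. \<epsilon> / 2 * (exp (- (t + T) / 2) * enn2real (sp_conv kg_K (enn f) (t + T, x))) \<le> u_L \<epsilon> \<phi> (t + T) x"
      by (rule u_L_ge[OF f \<phi>f]) (use t T0 \<epsilon> in auto)
    show "AE x in lebesgue. 0 \<le> u t x \<and> u t x \<le> C * (u_L \<epsilon> \<phi> (t + T) x powr (p - 1) /
                   ((t + T) * u_L \<epsilon> \<phi> (t + T) x powr (p - 1) + 1)) powr (1 / (p - 1))"
      unfolding AE_completion_iff using pos ode lin uL
    proof eventually_elim
      case (elim x)
      define r where "r = enn2real (sp_conv kg_K (enn f) (t + T, x))"
      have r: "0 \<le> r" by (simp add: r_def)
      let ?L = "u_L \<epsilon> \<phi> (t + T) x"
      have L: "\<epsilon> / 2 * (exp (- (t + T) / 2) * r) \<le> ?L" using elim(4) by (simp add: r_def)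
      moreover have "0 \<le> \<epsilon> / 2 * (exp (- (t + T) / 2) * r)" using r \<epsilon> by simp
      ultimately have L0: "0 \<le> ?L" by linarith
      have "u t x = exp (- t / 2) * (exp (t / 2) * u t x)"
        by (simp add: mult.assoc[symmetric] exp_add[symmetric])
      also have "\<dots> \<le> exp (- t / 2) * (\<eta> * (2 + K) * (pi * sqrt h / exp (h - 1/2)) * r)"
        using elim(3) unfolding th r_def by (intro mult_left_mono) auto
      also have "\<dots> = \<eta> / \<epsilon> * D * sqrt h * (\<epsilon> / 2 * (exp (- (t + T) / 2) * r))"
      proof -
        have "exp (- t / 2) / exp (h - 1/2) = exp 1 * exp (- (t + T) / 2)"
          by (simp add: exp_diff[symmetric] exp_add[symmetric] h_def field_simps)
        moreover have "exp (- t / 2) * (\<eta> * (2 + K) * (pi * sqrt h / exp (h - 1/2)) * r) =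
            \<eta> * (2 + K) * pi * sqrt h * r * (exp (- t / 2) / exp (h - 1/2))"
          by simp
        ultimately have "exp (- t / 2) * (\<eta> * (2 + K) * (pi * sqrt h / exp (h - 1/2)) * r) =
            \<eta> * (2 + K) * pi * sqrt h * r * (exp 1 * exp (- (t + T) / 2))" by simp
        then show ?thesis using \<epsilon> by (simp add: D_def)
      qed
      also have "\<dots> \<le> \<eta> / \<epsilon> * D * sqrt h * ?L"
        using \<eta> \<epsilon> D h by (intro mult_left_mono L mult_nonneg_nonneg) auto
      also have "\<dots> \<le> A * ?L"
      proof (rule mult_right_mono[OF _ L0])
        have "\<eta> / \<epsilon> * D * sqrt h \<le> \<eta> / \<epsilon> * D * sqrt T"
          using \<eta> \<epsilon> D h by (intro mult_left_mono) auto
        also have "\<eta> / \<epsilon> * D * sqrt T = C * D * (T powr (1/2) / T powr (p - 1/2))"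
          using \<epsilon> T0 by (simp add: \<eta>_def powr_half_sqrt)
        also have "T powr (1/2) / T powr (p - 1/2) = 1 / T powr (p - 1)"
          using T0 by (simp add: powr_diff[symmetric] powr_minus_divide[symmetric])
        also have "C * D * (1 / T powr (p - 1)) = A * (2 powr m * D / T powr (p - 1))"
          by (simp add: C_def)
        also have "\<dots> \<le> A * 1"
          using TD T0 A by (intro mult_left_mono) auto
        finally show "\<eta> / \<epsilon> * D * sqrt h \<le> A" by simp
      qed
      finally have "u t x \<le> A * ?L" .
      then have "u t x \<le> 2 powr (1 / (p - 1)) * A * (?L powr (p - 1) / ((t + T) * ?L powr (p - 1) + 1)) powr (1 / (p - 1))"
        by (intro interpolation_bound assms(1) L0 elim(2)) (use A t T0 in auto)
      then show ?case using elim(1) by (simp add: C_def m_def)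
    qed
  qed
qed

end
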